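(* Let $\mu,\nu$ be probability measures on $\Gamma_X$ satisfying Hypothesis (H), with $\mu(\eta(X)=+\infty)=1$, $\mu$ regular, and $\inf_{\gamma\in\Sigma(\mu,\nu)}\int c\,d\gamma<\infty$. Let $\gamma$ be an optimal measure for MKP$(\mu,\nu,c)$ and let $\Lambda\subset X$ be compact. Then there exists a measurable map $T_\Lambda:\Gamma_\Lambda\times\Gamma_{\Lambda^c}\to\Gamma_X$ such that $$\gamma\Big((\eta,\omega):\ r_2^\Lambda(\beta_{\eta,\omega})=T_\Lambda(\pi^\Lambda\eta,\pi^{\Lambda^c}\eta)\Big)=1,$$ for $\beta_{\eta,\omega}$ realizing $c(\eta,\omega)$.
   Context: $X=\mathbb{R}^k$; for $Y\subset X$, $\Gamma_Y$ is the set of locally finite subsets of $Y$ identified with counting measures, vague topology; $\eta(B)$ = number of points in $B$. Cost: $c(\eta_1,\eta_2)=\inf\{\int\frac12\|x-y\|^2d\beta:\beta\in\Gamma_{X\times X}$ with marginals $\eta_1,\eta_2\}$, $\inf\emptyset=+\infty$; a minimizing $\beta$ is denoted $\beta_{\eta_1,\eta_2}$ and said to realize $c(\eta_1,\eta_2)$. MKP$(\mu,\nu,c)$: minimize $\int c\,d\gamma$ over couplings $\gamma\in\Sigma(\mu,\nu)$; minimizers are optimal measures. $\pi^\Lambda(\eta)=\eta\cap\Lambda$. For $\beta\in\Gamma_{X\times X}$, $r^\Lambda\beta=\beta\cap(\Lambda\times X)$ and $r^\Lambda_2\beta=p_2(r^\Lambda\beta)$ is its second-coordinate configuration. Hypothesis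 (H) on a probability $\mu$ on $\Gamma_X$: (i) $\eta(\{x\})\in\{0,1\}$ for all $x$, $\mu$-a.s.; (ii) either $\mu(\eta(X)<\infty)=1$ or $\mu(\eta(X)=\infty)=1$; (iii) for every smooth compactly supported vector field $v$ with flow $\mathcal V^v_t$ and every $t$, $\mu$ is quasi-invariant under $\eta\mapsto\sum_{x\in\eta}\varepsilon_{\mathcal V^v_t(x)}$. The expected number of points $E_\mu[\eta(B)]$ defines a Radon measure (so $\eta(\Lambda)<\infty$ a.s. for compact $\Lambda$). Regularity: for a probability $m$ on $\Gamma_\Lambda$, $\Lambda$ compact, and $n\ge1$, let $\hat m_n$ be the symmetric probability on $\{(x_1,\dots,x_n)\in\Lambda^n:x_i\ne x_j\}$ whose image under $(x_i)\mapsto\sum\varepsilon_{x_i}$ is $m(\cdot\mid\eta(\Lambda)=n)$; $m$ is regular if every $\hat m_n$ is absolutely continuous w.r.t. Lebesgue measure. For $\mu$ on $\Gamma_X$, "regular" is taken to mean that $\pi^\Lambda\mu$ is regular for every compact $\Lambda$. *)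

theory Defs
  imports "HOL-Analysis.Analysis" "HOL-Probability.Probability"
begin

text \<open>A configuration (point measure) on a space is represented by its
multiplicity function \<open>eta :: 'a \<Rightarrow> nat\<close>; the counting measure is
\<open>eta(B) = sum of eta x over x in B\<close>.\<close>

definition locfin :: "('a::metric_space \<Rightarrow> nat) \<Rightarrow> bool" where
  "locfin eta \<longleftrightarrow> (\<forall>K. compact K \<longrightarrow> finite {x\<in>K. eta x \<noteq> 0})"

definition Gamma :: "'a::metric_space set \<Rightarrow> ('a \<Rightarrow> nat) set" where
  "Gamma Y = {eta. locfin eta \<and> (\<forall>x. eta x \<noteq> 0 \<longrightarrow> x \<in> Y)}"

definition npts :: "('a \<Rightarrow> nat) \<Rightarrow> 'a set \<Rightarrow> ennreal" where
  "npts eta B = (\<integral>\<^sup>+ x. indicator B x * of_nat (eta x) \<partial>count_space UNIV)"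

text \<open>Measurable structure on \<open>Gamma Y\<close>: generated by the counting maps
\<open>eta \<mapsto> eta(B)\<close>, \<open>B\<close> bounded Borel (= Borel sigma-algebra of the vague topology).\<close>
definition GammaM :: "'a::metric_space set \<Rightarrow> ('a \<Rightarrow> nat) measure" where
  "GammaM Y = sigma (Gamma Y)
     {{eta \<in> Gamma Y. npts eta B \<in> A} | B A. B \<in> sets borel \<and> bounded B \<and> A \<in> sets borel}"

definition proj :: "'a set \<Rightarrow> ('a \<Rightarrow> nat) \<Rightarrow> ('a \<Rightarrow> nat)" where
  "proj L eta = (\<lambda>x. if x \<in> L then eta x else 0)"

definition push :: "('a \<Rightarrow> 'b) \<Rightarrow> ('a \<Rightarrow> nat) \<Rightarrow> ('b \<Rightarrow> nat)" where
  "push f eta = (\<lambda>y. \<Sum>x\<in>{x. f x = y \<and> eta x \<noteq> 0}. eta x)"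

definition marginals :: "('a \<times> 'a \<Rightarrow> nat) \<Rightarrow> ('a \<Rightarrow> nat) \<Rightarrow> ('a \<Rightarrow> nat) \<Rightarrow> bool" where
  "marginals beta eta1 eta2 \<longleftrightarrow>
     (\<forall>x. (\<integral>\<^sup>+ y. of_nat (beta (x, y)) \<partial>count_space UNIV) = of_nat (eta1 x)) \<and>
     (\<forall>y. (\<integral>\<^sup>+ x. of_nat (beta (x, y)) \<partial>count_space UNIV) = of_nat (eta2 y))"

definition beta_cost :: "('a::real_normed_vector \<times> 'a \<Rightarrow> nat) \<Rightarrow> ennreal" where
  "beta_cost beta = (\<integral>\<^sup>+ p. of_nat (beta p) * ennreal (norm (fst p - snd p)^2 / 2) \<partial>count_space UNIV)"

definition admissible :: "('a::real_normed_vector \<Rightarrow> nat) \<Rightarrow> ('a \<Rightarrow> nat) \<Rightarrow> ('a \<times> 'a \<Rightarrow> nat) set" where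
  "admissible eta1 eta2 = {beta \<in> Gamma UNIV. marginals beta eta1 eta2}"

text \<open>\<open>c(eta1,eta2)\<close>; \<open>Inf {} = \<infinity>\<close> in ennreal.\<close>
definition cost :: "('a::real_normed_vector \<Rightarrow> nat) \<Rightarrow> ('a \<Rightarrow> nat) \<Rightarrow> ennreal" where
  "cost eta1 eta2 = (INF beta \<in> admissible eta1 eta2. beta_cost beta)"

definition realizes :: "('a::real_normed_vector \<times> 'a \<Rightarrow> nat) \<Rightarrow> ('a \<Rightarrow> nat) \<Rightarrow> ('a \<Rightarrow> nat) \<Rightarrow> bool" where
  "realizes beta eta1 eta2 \<longleftrightarrow> beta \<in> admissible eta1 eta2 \<and> beta_cost beta = cost eta1 eta2"

definition r2 :: "'a set \<Rightarrow> ('a \<times> 'a \<Rightarrow> nat) \<Rightarrow> ('a \<Rightarrow> nat)" where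
  "r2 L beta = (\<lambda>y. \<Sum>x\<in>{x. x \<in> L \<and> beta (x, y) \<noteq> 0}. beta (x, y))"

definition couplings :: "'b measure \<Rightarrow> 'b measure \<Rightarrow> ('b \<times> 'b) measure set" where
  "couplings mu nu = {g. prob_space g \<and> sets g = sets (mu \<Otimes>\<^sub>M nu) \<and>
      distr g mu fst = mu \<and> distr g nu snd = nu}"

definition total_cost :: "(('a::real_normed_vector \<Rightarrow> nat) \<times> ('a \<Rightarrow> nat)) measure \<Rightarrow> ennreal" where
  "total_cost g = (\<integral>\<^sup>+ p. cost (fst p) (snd p) \<partial>g)"

definition MKP_inf where
  "MKP_inf mu nu = (INF g \<in> couplings mu nu. total_cost g)"

definition optimal :: "(('a::real_normed_vector \<Rightarrow> nat) \<times> ('a \<Rightarrow> nat)) measure \<Rightarrow> _ \<Rightarrow> _ \<Rightarrow> bool" where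
  "optimal g mu nu \<longleftrightarrow> g \<in> couplings mu nu \<and> total_cost g = MKP_inf mu nu"

text \<open>Smooth (C-infinity) maps: all iterated directional (Frechet) derivatives exist everywhere.\<close>
coinductive smooth :: "('a::euclidean_space \<Rightarrow> 'b::real_normed_vector) \<Rightarrow> bool" where
  "\<lbrakk>\<forall>x. f differentiable (at x); \<forall>u. smooth (\<lambda>x. frechet_derivative f (at x) u)\<rbrakk> \<Longrightarrow> smooth f"

definition compact_support :: "('a::real_normed_vector \<Rightarrow> 'b::zero) \<Rightarrow> bool" where
  "compact_support v \<longleftrightarrow> compact (closure {x. v x \<noteq> 0})"

definition is_flow :: "('a::real_normed_vector \<Rightarrow> 'a) \<Rightarrow> (real \<Rightarrow> 'a \<Rightarrow> 'a) \<Rightarrow> bool" where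
  "is_flow v V \<longleftrightarrow> (\<forall>x. V 0 x = x \<and>
      (\<forall>t. ((\<lambda>s. V s x) has_vector_derivative v (V t x)) (at t)))"

definition quasi_invariant :: "'b measure \<Rightarrow> ('b \<Rightarrow> 'b) \<Rightarrow> bool" where
  "quasi_invariant mu f \<longleftrightarrow>
     (\<forall>A \<in> sets mu. emeasure mu A = 0 \<longleftrightarrow> emeasure mu (f -` A \<inter> space mu) = 0)"

definition hypH :: "('a::euclidean_space \<Rightarrow> nat) measure \<Rightarrow> bool" where
  "hypH mu \<longleftrightarrow> prob_space mu \<and> sets mu = sets (GammaM (UNIV :: 'a set)) \<and>
     (AE eta in mu. \<forall>x. eta x \<le> 1) \<and>
     (emeasure mu {eta \<in> space mu. npts eta UNIV < \<infinity>} = 1 \<or>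
      emeasure mu {eta \<in> space mu. npts eta UNIV = \<infinity>} = 1) \<and>
     (\<forall>v V. smooth v \<and> compact_support v \<and> is_flow v V \<longrightarrow>
        (\<forall>t. quasi_invariant mu (push (V t)))) \<and>
     (\<forall>K. compact K \<longrightarrow> (\<integral>\<^sup>+ eta. npts eta K \<partial>mu) < \<infinity>)"

definition cond_measure :: "'b measure \<Rightarrow> 'b set \<Rightarrow> 'b measure" where
  "cond_measure m E = density m (\<lambda>x. indicator E x / emeasure m E)"

definition tuple_config :: "nat \<Rightarrow> (nat \<Rightarrow> 'a) \<Rightarrow> ('a \<Rightarrow> nat)" where
  "tuple_config n xs = (\<lambda>y. card {i. i < n \<and> xs i = y})"

definition tupleM :: "nat \<Rightarrow> (nat \<Rightarrow> 'a::euclidean_space) measure" where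
  "tupleM n = PiM {..<n} (\<lambda>_. lborel)"

text \<open>\<open>P\<close> is the symmetric lift \<open>hat m_n\<close> of \<open>m\<close> on the distinct \<open>n\<close>-tuples in \<open>L\<close>
(this lift is unique).\<close>
definition is_hat :: "('a::euclidean_space \<Rightarrow> nat) measure \<Rightarrow> 'a set \<Rightarrow> nat \<Rightarrow> (nat \<Rightarrow> 'a) measure \<Rightarrow> bool" where
  "is_hat m L n P \<longleftrightarrow> prob_space P \<and> sets P = sets (tupleM n) \<and>
     (AE xs in P. (\<forall>i<n. xs i \<in> L) \<and> inj_on xs {..<n}) \<and>
     (\<forall>s. s permutes {..<n} \<longrightarrow> distr P (tupleM n) (\<lambda>xs. \<lambda>i\<in>{..<n}. xs (s i)) = P) \<and>
     distr P (GammaM L) (tuple_config n) = cond_measure m {eta \<in> space m. npts eta L = of_nat n}"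

definition regular_on :: "'a::euclidean_space set \<Rightarrow> ('a \<Rightarrow> nat) measure \<Rightarrow> bool" where
  "regular_on L m \<longleftrightarrow> (\<forall>n\<ge>1. emeasure m {eta \<in> space m. npts eta L = of_nat n} > 0 \<longrightarrow>
      (\<forall>P. is_hat m L n P \<longrightarrow> absolutely_continuous (tupleM n) P))"

definition regular :: "('a::euclidean_space \<Rightarrow> nat) measure \<Rightarrow> bool" where
  "regular mu \<longleftrightarrow> (\<forall>L. compact L \<longrightarrow> regular_on L (distr mu (GammaM L) (proj L)))"

end

theory Submission
  imports Defs "HOL-Library.Diagonal_Subsequence" "HOL-Library.Multiset"
begin

text \<open>
  Let \<open>V\<close> be the flow of a smooth compactly supported field \<open>v\<close>, acting on configurations. Moving the
  first coordinates of a plan \<open>beta\<close> realizing \<open>c(eta, omega)\<close> along \<open>V\<close> gives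
  \<open>c(V_t eta, omega) \<le> c(eta, omega) + t D + O(t^2)\<close> with \<open>D = sum of v(x) \<bullet> (x - y)\<close> over the pairs
  \<open>(x, y)\<close> of \<open>beta\<close>. If \<open>D\<close> were not a function of \<open>eta\<close> up to null sets, there would be \<open>p < q\<close> and a
  set \<open>E\<close> of positive \<open>mu\<close>-measure such that over every \<open>eta\<close> in \<open>E\<close> the coupling charges both \<open>D < p\<close>
  and \<open>D > q\<close>. By quasi-invariance \<open>E\<close> meets \<open>V_t^{-1} E\<close> in positive measure for arbitrarily small
  \<open>t > 0\<close>: otherwise the uncountably many sets \<open>V_s^{-1} E\<close> would be almost disjoint. Exchanging the
  partners of \<open>eta\<close> (where \<open>D < p\<close>) and of \<open>V_t eta\<close> (where \<open>D > q\<close>) then lowers the total cost by an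
  amount of order \<open>t (q - p)\<close>, contradicting optimality.

  So \<open>D\<close> is a function of \<open>eta\<close>. Taking \<open>v\<close> to be a bump on a small rational ball, times a basis vector, and
  using that \<open>eta\<close> is simple, one reads off the partner \<open>y\<close> of each point \<open>x\<close> of \<open>eta\<close> separately.
\<close>

section \<open>Smooth bump functions\<close>

text \<open>Only upper bounds for the cost along the flow enter. The shifted plan is a competitor,
  not a minimizer; it is used at time \<open>t\<close> over one set and at time \<open>- t\<close>
  over the other, and the two bounds add up to the gain. Three obstacles shape the rest.
  Quasi-invariance controls null sets but no masses, so partners cannot be exchanged one for one:
  what is exchanged is the minimum of two Radon-Nikodym densities with respect to \<open>mu\<close>.
  The quadratic error depends on the pair (eta, omega) without a uniform bound, while an exchange
  uses one \<open>t\<close> for all pairs; hence the sets on which \<open>D\<close> is compared with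
  a rational number also carry a bound on the error. Minimizers \<open>beta\<close> may fail to be
  unique and are not selected measurably; all of them are treated at once, as the quantifier over
  \<open>beta\<close> in the conclusion demands. Finally, eta is the sum of its restrictions to
  \<open>L\<close> and to the complement, so \<open>T\<close> may be any measurable function of eta;
  its measurability rests on a labelling of the points of eta by measurable functions.\<close>

definition bump :: "nat \<Rightarrow> real \<Rightarrow> real" where
  "bump n s = (if s > 0 then exp (- inverse s) / s ^ n else 0)"

lemma power_le_fact_exp:
  fixes u :: real assumes "u \<ge> 0" shows "u ^ m \<le> fact m * exp u"
proof -
  have "(\<Sum>n<Suc m. u ^ n / fact n) \<le> exp u"
    using sum_le_suminf[of "\<lambda>n. inverse (fact n) * u ^ n" "{..<Suc m}"] summable_exp[of u] assms
    by (simp add: exp_def divide_inverse mult.commute scaleR_conv_of_real)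
  moreover have "u ^ m / fact m \<le> (\<Sum>n<Suc m. u ^ n / fact n)"
    using assms by (intro member_le_sum) auto
  ultimately have "u ^ m / fact m \<le> exp u" by linarith
  then show ?thesis by (simp add: field_simps)
qed

lemma bump_nonneg: "0 \<le> bump n s"
  by (simp add: bump_def)

lemma bump_pos: "0 < s \<Longrightarrow> 0 < bump n s"
  by (simp add: bump_def)

text \<open>Flatness of every order at 0: the exponential series at \<open>1 / s\<close> beats the
  power \<open>n + m\<close> of \<open>1 / s\<close>, of which \<open>n\<close> factors sit in
  \<open>bump\<close> and \<open>m\<close> become the factor on the right.\<close>

lemma bump_le: "bump n s \<le> fact (n + m) * \<bar>s\<bar> ^ m"
proof (cases "s > 0")
  case True
  have "inverse s ^ (n + m) \<le> fact (n + m) * exp (inverse s)"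
    using True by (intro power_le_fact_exp) auto
  then have "exp (- inverse s) * inverse s ^ (n+m) \<le> exp (- inverse s) * (fact (n + m) * exp (inverse s))"
    by (intro mult_left_mono) auto
  also have "\<dots> = fact (n + m)"
    by (simp add: exp_minus field_simps)
  finally have "exp (- inverse s) * inverse s ^ (n+m) * s ^ m \<le> fact (n + m) * s ^ m"
    using True by (intro mult_right_mono) auto
  moreover have "exp (- inverse s) * inverse s ^ (n+m) * s ^ m = bump n s"
    using True by (simp add: bump_def field_simps power_add)
  ultimately show ?thesis using True by simp
qed (simp add: bump_def)

text \<open>The powers of \<open>s\<close> in the denominator make the family closed under
  differentiation, up to linear combinations. At 0 the quadratic bound from \<open>bump_le\<close>
  sends the difference quotient to 0.\<close>

lemma DERIV_bump: "(bump n has_real_derivative bump (n + 2) s - real n * bump (n + 1) s) (at s)"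
proof (cases "s = 0")
  case True
  have "((\<lambda>h. bump n h / h) \<longlongrightarrow> 0) (at 0)"
  proof (rule Lim_null_comparison)
    show "\<forall>\<^sub>F h in at 0. norm (bump n h / h) \<le> fact (n + 2) * \<bar>h\<bar>"
    proof (rule eventually_mono[OF eventually_at_ball'[of 1]])
      fix h :: real assume "h \<in> ball 0 1 \<and> h \<noteq> 0 \<and> h \<in> UNIV"
      then have "h \<noteq> 0" by auto
      have "bump n h \<le> fact (n+2) * \<bar>h\<bar>^2" by (rule bump_le)
      then have "bump n h / \<bar>h\<bar> \<le> fact (n+2) * \<bar>h\<bar>"
        using \<open>h \<noteq> 0\<close> by (simp add: pos_divide_le_eq power2_eq_square mult.assoc del: fact_Suc power2_abs abs_mult_self_eq)
      then show "norm (bump n h / h) \<le> fact (n + 2) * \<bar>h\<bar>"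
        using bump_nonneg[of n h] by (simp add: abs_divide del: fact_Suc)
    qed simp
    show "((\<lambda>h. fact (n + 2) * \<bar>h\<bar>) \<longlongrightarrow> (0::real)) (at 0)"
      by (auto intro!: tendsto_eq_intros)
  qed
  then have "(bump n has_real_derivative 0) (at 0)"
    by (simp add: DERIV_def bump_def)
  then show ?thesis using True by (simp add: bump_def)
next
  case False
  show ?thesis
  proof (cases "s > 0")
    case True
    have "((\<lambda>s. exp (- inverse s) / s ^ n) has_real_derivative
        bump (n + 2) s - real n * bump (n + 1) s) (at s)"
      using True unfolding bump_def
      apply (auto intro!: derivative_eq_intros)
      apply (cases n)
      apply (auto simp: field_simps power2_eq_square)
      done
    then show ?thesis
      by (rule has_field_derivative_transform_within_open[of _ _ _ "{0<..}"]) (use True in \<open>auto simp: bump_def\<close>)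
  next
    case False
    with \<open>s \<noteq> 0\<close> have "s < 0" by simp
    have "((\<lambda>s. 0) has_real_derivative 0) (at s)" by simp
    then have "(bump n has_real_derivative 0) (at s)"
      by (rule has_field_derivative_transform_within_open[of _ _ _ "{..<0}"])
         (use \<open>s < 0\<close> in \<open>auto simp: bump_def\<close>)
    then show ?thesis using \<open>s < 0\<close> by (simp add: bump_def)
  qed
qed

text \<open>\<open>smooth\<close> is coinductive, so proving it takes a class of functions stable
  under all directional derivatives. This is the algebra generated by the constants, the affine
  functions vanishing at \<open>a\<close>, and the profiles \<open>bump n\<close> in r^2 minus the
  squared distance.\<close>

inductive bump_alg :: "'a::euclidean_space \<Rightarrow> real \<Rightarrow> ('a \<Rightarrow> real) \<Rightarrow> bool" for a r where
  const: "bump_alg a r (\<lambda>_. c)"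
| inner: "bump_alg a r (\<lambda>x. (x - a) \<bullet> u)"
| bump: "bump_alg a r (\<lambda>x. bump n (r\<^sup>2 - (x - a) \<bullet> (x - a)))"
| add: "bump_alg a r f \<Longrightarrow> bump_alg a r g \<Longrightarrow> bump_alg a r (\<lambda>x. f x + g x)"
| mult: "bump_alg a r f \<Longrightarrow> bump_alg a r g \<Longrightarrow> bump_alg a r (\<lambda>x. f x * g x)"

lemma bump_alg_deriv:
  assumes "bump_alg a r f"
  shows "\<exists>f'. (\<forall>x. (f has_derivative f' x) (at x)) \<and> (\<forall>u. bump_alg a r (\<lambda>x. f' x u))"
  using assms
proof induction
  case (const c)
  show ?case by (rule exI[of _ "\<lambda>x u. 0"]) (auto intro: bump_alg.const)
next
  case (inner u)
  show ?case by (rule exI[of _ "\<lambda>x w. w \<bullet> u"]) (auto intro!: derivative_eq_intros bump_alg.const)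
next
  case (bump n)
  let ?s = "\<lambda>x. r\<^sup>2 - (x - a) \<bullet> (x - a)"
  have d: "((\<lambda>x. bump n (?s x)) has_derivative
      (\<lambda>u. (bump (n + 2) (?s x) + (- real n) * bump (n + 1) (?s x)) * ((-2) * ((x - a) \<bullet> u)))) (at x)" for x
  proof -
    have "(?s has_derivative (\<lambda>u. (-2) * ((x - a) \<bullet> u))) (at x)"
      by (auto intro!: derivative_eq_intros simp: inner_commute)
    from has_derivative_compose[OF this DERIV_bump[of n "?s x", unfolded has_field_derivative_def]]
    show ?thesis by (simp add: algebra_simps)
  qed
  show ?case
    by (intro exI[of _ "\<lambda>x u. (bump (n + 2) (?s x) + (- real n) * bump (n + 1) (?s x)) * ((-2) * ((x - a) \<bullet> u))"]
        conjI allI d bump_alg.intros)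
next
  case (add f g)
  then obtain f' g' where "\<forall>x. (f has_derivative f' x) (at x)" "\<forall>u. bump_alg a r (\<lambda>x. f' x u)"
    "\<forall>x. (g has_derivative g' x) (at x)" "\<forall>u. bump_alg a r (\<lambda>x. g' x u)" by blast
  then show ?case
    by (intro exI[of _ "\<lambda>x u. f' x u + g' x u"]) (auto intro!: derivative_eq_intros bump_alg.intros)
next
  case (mult f g)
  then obtain f' g' where "\<forall>x. (f has_derivative f' x) (at x)" "\<forall>u. bump_alg a r (\<lambda>x. f' x u)"
    "\<forall>x. (g has_derivative g' x) (at x)" "\<forall>u. bump_alg a r (\<lambda>x. g' x u)" by blast
  with mult show ?case
    by (intro exI[of _ "\<lambda>x u. f x * g' x u + f' x u * g x"]) (auto intro!: derivative_eq_intros bump_alg.intros)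
qed

lemma bump_alg_smooth:
  assumes "bump_alg a r f" shows "smooth (\<lambda>x. f x *\<^sub>R w)"
  using assms
proof (coinduction arbitrary: f)
  case (smooth f)
  then obtain f' where f': "\<forall>x. (f has_derivative f' x) (at x)" "\<forall>u. bump_alg a r (\<lambda>x. f' x u)"
    using bump_alg_deriv by blast
  have d: "((\<lambda>x. f x *\<^sub>R w) has_derivative (\<lambda>u. f' x u *\<^sub>R w)) (at x)" for x
    using f' by (auto intro!: derivative_eq_intros)
  then have "frechet_derivative (\<lambda>x. f x *\<^sub>R w) (at x) = (\<lambda>u. f' x u *\<^sub>R w)" for x
    by (rule frechet_derivative_at[symmetric])
  then show ?case
    using d f'(2) by (intro exI[of _ "\<lambda>x. f x *\<^sub>R w"]) (auto simp: differentiable_def)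
qed

text \<open>The profile takes the squared distance, a polynomial in \<open>x\<close>, so the centre
  is no singular point; the sphere is harmless because \<open>bump 0\<close> is flat at 0.\<close>

definition bumpf :: "'a::euclidean_space \<Rightarrow> real \<Rightarrow> 'a \<Rightarrow> real" where
  "bumpf a r x = bump 0 (r\<^sup>2 - (x - a) \<bullet> (x - a))"

lemma bumpf_smooth: "smooth (\<lambda>x. bumpf a r x *\<^sub>R w)"
  unfolding bumpf_def by (rule bump_alg_smooth[OF bump_alg.bump])

lemma bumpf_outside: "r \<ge> 0 \<Longrightarrow> x \<notin> ball a r \<Longrightarrow> bumpf a r x = 0"
  by (auto simp: bumpf_def bump_def dist_norm norm_minus_commute power_mono simp flip: power2_norm_eq_inner)
     (smt (verit) power_mono)

lemma bumpf_pos: "x \<in> ball a r \<Longrightarrow> bumpf a r x > 0"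
  unfolding bumpf_def
  by (intro bump_pos) (auto simp: dist_norm norm_minus_commute power_strict_mono simp flip: power2_norm_eq_inner)

lemma bumpf_le_1: "bumpf a r x \<le> 1" "0 \<le> bumpf a r x"
  by (auto simp: bumpf_def bump_def)

lemma bump_0_lipschitz: "\<bar>bump 0 s - bump 0 t\<bar> \<le> 2 * \<bar>s - t\<bar>"
proof -
  have "norm (bump 0 s - bump 0 t) \<le> 2 * norm (s - t)"
  proof (rule field_differentiable_bound[of UNIV])
    fix z :: real
    show "(bump 0 has_field_derivative bump 2 z) (at z within UNIV)" using DERIV_bump[of 0 z] by (simp add: numeral_2_eq_2)
    show "norm (bump 2 z) \<le> 2" using bump_le[of 2 z 0] bump_nonneg[of 2 z] by (simp add: fact_numeral)
  qed auto
  then show ?thesis by simp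
qed

text \<open>Truncating the distance to \<open>a\<close> at \<open>r\<close> leaves the value
  unchanged, and squares of numbers in [0, r] differ by at most \<open>2 * r\<close> times their
  difference. The profile contributes another factor 2.\<close>

lemma bumpf_lipschitz:
  assumes "r \<ge> 0" shows "\<bar>bumpf a r x - bumpf a r y\<bar> \<le> 4 * r * norm (x - y)"
proof -
  define m where "m x = min (norm (x - a)) r" for x
  have eq: "bumpf a r x = bump 0 (r\<^sup>2 - (m x)\<^sup>2)" for x
  proof (cases "norm (x - a) \<le> r")
    case True
    then show ?thesis by (simp add: bumpf_def m_def power2_norm_eq_inner)
  next
    case False
    then have "r\<^sup>2 \<le> (norm (x-a))\<^sup>2" using assms by (intro power_mono) auto
    then show ?thesis using False by (simp add: bumpf_def m_def bump_def flip: power2_norm_eq_inner)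
  qed
  have m1: "\<bar>m x - m y\<bar> \<le> norm (x - y)"
  proof -
    have "\<bar>norm (x - a) - norm (y - a)\<bar> \<le> norm (x - y)"
      using norm_triangle_ineq3[of "x - a" "y - a"] by simp
    then show ?thesis unfolding m_def by linarith
  qed
  have m2: "\<bar>m x + m y\<bar> \<le> 2 * r" unfolding m_def using assms by simp
  have "\<bar>bumpf a r x - bumpf a r y\<bar> \<le> 2 * \<bar>(m y)\<^sup>2 - (m x)\<^sup>2\<bar>"
    using bump_0_lipschitz[of "r\<^sup>2 - (m x)\<^sup>2" "r\<^sup>2 - (m y)\<^sup>2"] by (simp add: eq)
  also have "\<dots> = 2 * (\<bar>m x - m y\<bar> * \<bar>m x + m y\<bar>)"
    by (simp add: abs_mult[symmetric] power2_eq_square algebra_simps abs_minus_commute)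
  also have "\<dots> \<le> 2 * (norm (x - y) * (2 * r))"
    by (intro mult_left_mono mult_mono m1 m2) auto
  finally show ?thesis by (simp add: mult_ac)
qed

lemma bumpf_compact_support:
  fixes w :: "'b::real_vector"
  assumes "r \<ge> 0" shows "compact_support (\<lambda>x. bumpf a r x *\<^sub>R w)"
proof -
  have "bumpf a r x *\<^sub>R w = 0" if "x \<notin> ball a r" for x
    using bumpf_outside[OF assms that] by simp
  then have "{x. bumpf a r x *\<^sub>R w \<noteq> 0} \<subseteq> ball a r" by blast
  then have "bounded {x. bumpf a r x *\<^sub>R w \<noteq> 0}" by (rule bounded_subset[OF bounded_ball])
  then show ?thesis unfolding compact_support_def by (simp add: compact_closure)
qed

section \<open>Flows of bounded Lipschitz vector fields\<close>

text \<open>The oriented integral from 0 to \<open>t\<close>: one of the two terms is an integral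
  over an empty or degenerate interval.\<close>

definition oint :: "(real \<Rightarrow> 'a::euclidean_space) \<Rightarrow> real \<Rightarrow> 'a" where
  "oint f t = integral {0..t} f - integral {t..0} f"

lemma oint_0: "oint f 0 = 0"
  by (simp add: oint_def)

lemma oint_has_vector_derivative:
  assumes "continuous_on UNIV f"
  shows "(oint f has_vector_derivative f t) (at t)"
proof -
  define T where "T = \<bar>t\<bar> + 1"
  have c: "continuous_on S f" for S using assms continuous_on_subset by blast
  have i: "f integrable_on {a..b}" for a b by (intro integrable_continuous_interval c)
  have eq: "integral {-T..u} f - integral {-T..0} f = oint f u" if "u \<in> {-T<..<T}" for u
  proof (cases "u \<ge> 0")
    case True
    have "integral {-T..0} f + integral {0..u} f = integral {-T..u} f"
      using that True by (intro Henstock_Kurzweil_Integration.integral_combine i) auto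
    moreover have "integral {u..0} f = 0"
      using True by (cases "u = 0") auto
    ultimately show ?thesis by (auto simp: oint_def algebra_simps)
  next
    case False
    have "integral {-T..u} f + integral {u..0} f = integral {-T..0} f"
      using that False by (intro Henstock_Kurzweil_Integration.integral_combine i) auto
    moreover have "integral {0..u} f = 0" using False by simp
    ultimately show ?thesis by (simp add: oint_def algebra_simps)
  qed
  have "((\<lambda>u. integral {-T..u} f) has_vector_derivative f t) (at t within {-T..T})"
    by (intro integral_has_vector_derivative c) (auto simp: T_def)
  then have "((\<lambda>u. integral {-T..u} f) has_vector_derivative f t) (at t)"
    by (subst (asm) at_within_Icc_at) (auto simp: T_def)
  then have "((\<lambda>u. integral {-T..u} f - integral {-T..0} f) has_vector_derivative f t) (at t)"
    by (auto intro!: derivative_eq_intros)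
  then show ?thesis
    by (rule has_vector_derivative_transform_within_open[where S="{-T<..<T}"]) (auto simp: eq, auto simp: T_def)
qed

lemma oint_diff:
  assumes "continuous_on UNIV f" "continuous_on UNIV g"
  shows "oint f t - oint g t = oint (\<lambda>s. f s - g s) t"
proof -
  have i: "f integrable_on {a..b}" "g integrable_on {a..b}" for a b
    by (intro integrable_continuous_interval continuous_on_subset[OF assms(1)] continuous_on_subset[OF assms(2)]; simp)+
  show ?thesis by (simp add: oint_def Henstock_Kurzweil_Integration.integral_diff i)
qed

text \<open>The weight is its own primitive up to the factor \<open>1 / K\<close>; this gain is what
  makes the Picard map a contraction for all times at once.\<close>

lemma oint_exp_bound:
  assumes f: "continuous_on UNIV f" and "K > 0" "C \<ge> 0" and b: "\<And>s. norm (f s) \<le> C * exp (K * \<bar>s\<bar>)"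
  shows "norm (oint f t) \<le> C / K * exp (K * \<bar>t\<bar>)"
proof -
  have i: "f integrable_on {a..b}" for a b
    by (intro integrable_continuous_interval continuous_on_subset[OF f]) simp
  show ?thesis
  proof (cases "t \<ge> 0")
    case True
    have "((\<lambda>s. C * exp (K * s)) has_integral (C / K * exp (K * t) - C / K * exp (K * 0))) {0..t}"
      using True \<open>K > 0\<close> by (intro fundamental_theorem_of_calculus)
        (auto intro!: derivative_eq_intros simp flip: has_real_derivative_iff_has_vector_derivative)
    moreover have "norm (integral {0..t} f) \<le> integral {0..t} (\<lambda>s. C * exp (K * s))"
    proof (rule integral_norm_bound_integral[OF i])
      show "norm (f s) \<le> C * exp (K * s)" if "s \<in> {0..t}" for s using b[of s] that by simp
    qed (use calculation in \<open>auto simp: has_integral_iff\<close>)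
    moreover have "integral {t..0} f = 0" using True by (cases "t = 0") auto
    moreover have "C / K \<ge> 0" using \<open>K > 0\<close> \<open>C \<ge> 0\<close> by simp
    ultimately show ?thesis using True by (simp add: oint_def has_integral_iff)
  next
    case False
    have "((\<lambda>s. C * exp (- K * s)) has_integral (- C / K * exp (- K * 0) - (- C / K * exp (- K * t)))) {t..0}"
      using False \<open>K > 0\<close> by (intro fundamental_theorem_of_calculus)
        (auto intro!: derivative_eq_intros simp flip: has_real_derivative_iff_has_vector_derivative)
    moreover have "norm (f s) \<le> C * exp (- K * s)" if "s \<in> {t..0}" for s
      using b[of s] that by simp
    moreover have "norm (integral {t..0} f) \<le> integral {t..0} (\<lambda>s. C * exp (- K * s))"
      using calculation b by (intro integral_norm_bound_integral i) (auto simp: has_integral_iff)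
    moreover have "integral {0..t} f = 0" using False by simp
    moreover have "C / K \<ge> 0" using \<open>K > 0\<close> \<open>C \<ge> 0\<close> by simp
    ultimately show ?thesis using False by (simp add: oint_def has_integral_iff)
  qed
qed

text \<open>Picard iteration is a contraction on all of the real line in the norm weighted by \<open>exp (- K |t|)\<close>; the
  unknown is written \<open>x + exp (K |t|) w t\<close> with \<open>w\<close> bounded.\<close>

lemma flow_exists:
  fixes v :: "'a::euclidean_space \<Rightarrow> 'a"
  assumes lip: "\<And>x y. norm (v x - v y) \<le> Lc * norm (x - y)" and bdd: "\<And>x. norm (v x) \<le> M"
  shows "\<exists>V. is_flow v V"
proof -
  \<comment> \<open>Makes \<open>|Lc| / K\<close> at most 1/2, the contraction constant, and keeps
    \<open>K\<close> positive when \<open>Lc\<close> is 0.\<close>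
  define K where "K = 2 * \<bar>Lc\<bar> + 1"
  have K: "K > 0" by (simp add: K_def)
  have M: "M \<ge> 0" using bdd[of 0] norm_ge_zero order_trans by blast
  have lip': "norm (v x - v y) \<le> \<bar>Lc\<bar> * norm (x - y)" for x y
    using lip[of x y] mult_right_mono[OF abs_ge_self[of Lc], of "norm (x - y)"] by simp
  have cv: "continuous_on UNIV v"
    by (rule lipschitz_on_continuous_on[of "\<bar>Lc\<bar>"], rule lipschitz_onI) (auto simp: dist_norm lip')
  have "\<exists>u. u 0 = x \<and> (\<forall>t. (u has_vector_derivative v (u t)) (at t))" for x
  proof -
    define F where "F w s = v (x + exp (K * \<bar>s\<bar>) *\<^sub>R apply_bcontfun w s)" for w s
    define P where "P w t = exp (- K * \<bar>t\<bar>) *\<^sub>R oint (F w) t" for w t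
    have cF: "continuous_on UNIV (F w)" for w
      unfolding F_def by (intro continuous_on_compose2[OF cv] continuous_intros) auto
    have co: "continuous_on UNIV (oint (F w))" for w
      using oint_has_vector_derivative[OF cF] 
      by (intro continuous_at_imp_continuous_on ballI has_vector_derivative_continuous)
    have Pb: "norm (P w t) \<le> M / K" for w t
    proof -
      have "norm (oint (F w) t) \<le> M / K * exp (K * \<bar>t\<bar>)"
      proof (rule oint_exp_bound[OF cF K M])
        fix s show "norm (F w s) \<le> M * exp (K * \<bar>s\<bar>)"
          using bdd[of "x + exp (K * \<bar>s\<bar>) *\<^sub>R apply_bcontfun w s"] M K mult_left_mono[of 1 "exp (K * \<bar>s\<bar>)" M]
          by (simp add: F_def)
      qed
      then have "exp (- K * \<bar>t\<bar>) * norm (oint (F w) t) \<le> exp (- K * \<bar>t\<bar>) * (M / K * exp (K * \<bar>t\<bar>))"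
        by (intro mult_left_mono) auto
      then show ?thesis by (simp add: P_def exp_minus field_simps)
    qed
    have PC: "P w \<in> bcontfun" for w
      by (rule bcontfun_normI[OF _ Pb]) (auto simp: P_def intro!: continuous_intros co)
    have "\<exists>!w. Bcontfun (P w) = w"
    proof (rule banach_fix_type[of "1/2"], safe)
      fix w1 w2 :: "real \<Rightarrow>\<^sub>C 'a"
      show "dist (Bcontfun (P w1)) (Bcontfun (P w2)) \<le> 1/2 * dist w1 w2"
      proof (rule dist_bound)
        fix t
        have "norm (oint (\<lambda>s. F w1 s - F w2 s) t) \<le> (\<bar>Lc\<bar> * dist w1 w2) / K * exp (K * \<bar>t\<bar>)"
        proof (rule oint_exp_bound[OF _ K])
          show "continuous_on UNIV (\<lambda>s. F w1 s - F w2 s)" by (intro continuous_intros cF)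
          fix s
          have "norm (F w1 s - F w2 s) \<le> \<bar>Lc\<bar> * norm (exp (K * \<bar>s\<bar>) *\<^sub>R (apply_bcontfun w1 s - apply_bcontfun w2 s))"
            unfolding F_def by (rule order_trans[OF lip']) (simp add: scaleR_diff_right)
          also have "\<dots> \<le> \<bar>Lc\<bar> * (exp (K * \<bar>s\<bar>) * dist w1 w2)"
            using dist_bounded[of w1 s w2] by (intro mult_left_mono) (auto simp: dist_norm)
          finally show "norm (F w1 s - F w2 s) \<le> \<bar>Lc\<bar> * dist w1 w2 * exp (K * \<bar>s\<bar>)"
            by (simp add: mult_ac)
        qed auto
        then have "exp (- K * \<bar>t\<bar>) * norm (oint (\<lambda>s. F w1 s - F w2 s) t)
            \<le> exp (- K * \<bar>t\<bar>) * ((\<bar>Lc\<bar> * dist w1 w2) / K * exp (K * \<bar>t\<bar>))"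
          by (intro mult_left_mono) auto
        also have "\<dots> = (\<bar>Lc\<bar> / K) * dist w1 w2" by (simp add: exp_minus field_simps)
        also have "\<dots> \<le> 1/2 * dist w1 w2"
          by (intro mult_right_mono) (auto simp: K_def field_simps)
        finally have "dist (P w1 t) (P w2 t) \<le> 1/2 * dist w1 w2"
          by (simp add: P_def dist_norm oint_diff[OF cF cF, symmetric] flip: scaleR_diff_right)
        then show "dist (apply_bcontfun (Bcontfun (P w1)) t) (apply_bcontfun (Bcontfun (P w2)) t) \<le> 1/2 * dist w1 w2"
          by (simp add: Bcontfun_inverse PC)
      qed
    qed auto
    then obtain w where w: "Bcontfun (P w) = w" by blast
    define u where "u t = x + oint (F w) t" for t
    have wt: "apply_bcontfun w t = P w t" for t
      using w Bcontfun_inverse[OF PC[of w]] by simp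
    have "F w t = v (u t)" for t
      by (simp add: F_def u_def wt P_def exp_minus)
    then have "(u has_vector_derivative v (u t)) (at t)" for t
      using oint_has_vector_derivative[OF cF, of w t] unfolding u_def
      by (auto intro!: derivative_eq_intros)
    moreover have "u 0 = x" by (simp add: u_def oint_0)
    ultimately show ?thesis by blast
  qed
  then obtain U where "\<And>x. U x 0 = x \<and> (\<forall>t. (U x has_vector_derivative v (U x t)) (at t))" by metis
  then show ?thesis unfolding is_flow_def by (intro exI[of _ "\<lambda>t x. U x t"]) auto
qed

text \<open>Gronwall's argument: the squared distance multiplied by
  \<open>exp (- 2 * Lc * s)\<close> has nonpositive derivative.\<close>

lemma solutions_dist_forward:
  fixes v :: "'a::euclidean_space \<Rightarrow> 'a"
  assumes lip: "\<And>x y. norm (v x - v y) \<le> Lc * norm (x - y)"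
    and u: "\<And>t. (u has_vector_derivative v (u t)) (at t)"
    and w: "\<And>t. (w has_vector_derivative v (w t)) (at t)" and "t \<ge> 0"
  shows "norm (u t - w t) \<le> exp (Lc * t) * norm (u 0 - w 0)"
proof -
  define g where "g s = exp (- 2 * Lc * s) * ((u s - w s) \<bullet> (u s - w s))" for s
  have "g t \<le> g 0"
  proof (rule DERIV_nonpos_imp_nonincreasing[OF \<open>t \<ge> 0\<close>])
    fix s
    let ?D = "exp (- 2 * Lc * s) * (2 * ((u s - w s) \<bullet> (v (u s) - v (w s)))) - 2 * Lc * exp (- 2 * Lc * s) * ((u s - w s) \<bullet> (u s - w s))"
    have "((\<lambda>s. u s - w s) has_derivative (\<lambda>h. h *\<^sub>R (v (u s) - v (w s)))) (at s)"
      using u[of s] w[of s] unfolding has_vector_derivative_def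
      by (auto intro!: derivative_eq_intros simp: scaleR_diff_right)
    from has_derivative_inner[OF this this]
    have "((\<lambda>s. (u s - w s) \<bullet> (u s - w s)) has_real_derivative 2 * ((u s - w s) \<bullet> (v (u s) - v (w s)))) (at s)"
      unfolding has_field_derivative_def
      by (rule has_derivative_eq_rhs) (simp add: fun_eq_iff inner_commute)
    then have "(g has_real_derivative ?D) (at s)"
      unfolding g_def by (auto intro!: derivative_eq_intros)
    moreover have "?D \<le> 0"
    proof -
      have "(u s - w s) \<bullet> (v (u s) - v (w s)) \<le> norm (u s - w s) * norm (v (u s) - v (w s))"
        by (rule norm_cauchy_schwarz)
      also have "\<dots> \<le> norm (u s - w s) * (Lc * norm (u s - w s))"
        by (intro mult_left_mono lip) auto
      also have "\<dots> = Lc * ((u s - w s) \<bullet> (u s - w s))"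
        by (simp add: power2_norm_eq_inner[symmetric] power2_eq_square)
      finally have "exp (- 2 * Lc * s) * (2 * ((u s - w s) \<bullet> (v (u s) - v (w s)))) \<le> exp (- 2 * Lc * s) * (2 * (Lc * ((u s - w s) \<bullet> (u s - w s))))"
        by (intro mult_left_mono) auto
      then show ?thesis by (simp add: mult_ac)
    qed
    ultimately show "\<exists>y. (g has_real_derivative y) (at s) \<and> y \<le> 0" by blast
  qed
  then have "exp (2 * Lc * t) * (exp (- 2 * Lc * t) * (norm (u t - w t))\<^sup>2) \<le> exp (2 * Lc * t) * (norm (u 0 - w 0))\<^sup>2"
    by (intro mult_left_mono) (simp_all add: g_def power2_norm_eq_inner)
  moreover have "exp (2 * Lc * t) * (exp (- 2 * Lc * t) * (norm (u t - w t))\<^sup>2) = (norm (u t - w t))\<^sup>2"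
    by (simp flip: exp_add mult.assoc)
  moreover have "exp (2 * Lc * t) = (exp (Lc * t))\<^sup>2" by (simp add: mult.assoc flip: exp_double)
  ultimately have "(norm (u t - w t))\<^sup>2 \<le> (exp (Lc * t) * norm (u 0 - w 0))\<^sup>2"
    by (simp only: power_mult_distrib)
  then show ?thesis by (rule power2_le_imp_le) auto
qed

text \<open>Negative times are reduced to positive ones by reversing time, which replaces
  \<open>v\<close> by \<open>- v\<close>. Equal initial values force equal solutions, so this is
  also the uniqueness statement behind the group law and the fixed points of the flow.\<close>

lemma solutions_dist:
  fixes v :: "'a::euclidean_space \<Rightarrow> 'a"
  assumes lip: "\<And>x y. norm (v x - v y) \<le> Lc * norm (x - y)"
    and u: "\<And>t. (u has_vector_derivative v (u t)) (at t)"
    and w: "\<And>t. (w has_vector_derivative v (w t)) (at t)"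
  shows "norm (u t - w t) \<le> exp (Lc * \<bar>t\<bar>) * norm (u 0 - w 0)"
proof (cases "t \<ge> 0")
  case True
  then show ?thesis using solutions_dist_forward[OF assms, of t] by simp
next
  case False
  have rev: "((\<lambda>s. f (- s)) has_vector_derivative - v (f (- s))) (at s)"
    if "\<And>t. (f has_vector_derivative v (f t)) (at t)" for f s
  proof -
    have "(uminus has_vector_derivative -1) (at s)"
      by (auto intro!: derivative_eq_intros)
    from vector_diff_chain_at[OF this that] show ?thesis by (simp add: o_def)
  qed
  have "norm (u (- (- t)) - w (- (- t))) \<le> exp (Lc * (- t)) * norm (u (-0) - w (-0))"
  proof (rule solutions_dist_forward[where v="\<lambda>x. - v x" and u="\<lambda>s. u (- s)" and w="\<lambda>s. w (- s)"])
    show "norm (- v x - - v y) \<le> Lc * norm (x - y)" for x y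
      using lip[of y x] by (simp add: norm_minus_commute)
  qed (use False in \<open>auto intro!: rev u w\<close>)
  then show ?thesis using False by simp
qed

section \<open>Group law and Taylor expansion of a Lipschitz flow\<close>

locale lipschitz_flow =
  fixes v :: "'a::euclidean_space \<Rightarrow> 'a" and V :: "real \<Rightarrow> 'a \<Rightarrow> 'a" and Lc :: real
  assumes lip: "norm (v x - v y) \<le> Lc * norm (x - y)"
    and bdd: "norm (v x) \<le> 1"
    and flow: "is_flow v V"
begin

lemma V_0: "V 0 x = x"
  using flow by (simp add: is_flow_def)

lemma V_deriv: "((\<lambda>t. V t x) has_vector_derivative v (V t x)) (at t)"
  using flow by (simp add: is_flow_def)

lemma V_add: "V s (V t x) = V (s + t) x"
proof -
  have "((\<lambda>s. V (s + t) x) has_vector_derivative v (V (s + t) x)) (at s)" for s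
  proof -
    have "((\<lambda>s. s + t) has_vector_derivative 1) (at s)"
      by (auto intro!: derivative_eq_intros)
    from vector_diff_chain_at[OF this V_deriv] show ?thesis by (simp add: o_def)
  qed
  from solutions_dist[OF lip V_deriv[of "V t x"] this, of s]
  show ?thesis by (simp add: V_0)
qed

lemma V_uminus: "V (- t) (V t x) = x" "V t (V (- t) x) = x"
  by (simp_all add: V_add V_0)

lemma bij_V: "bij (V t)"
  by (rule bij_betw_byWitness[where f'="V (- t)"]) (auto simp: V_uminus)

lemma Lc_nonneg: "DIM('a) > 0 \<Longrightarrow> 0 \<le> Lc"
  using lip[of "SOME b. b \<in> Basis" 0] norm_ge_zero[of "v (SOME b. b \<in> Basis) - v 0"]
  by (smt (verit) SOME_Basis diff_zero mult_cancel_left1 norm_Basis norm_ge_zero zero_le_mult_iff)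

lemma continuous_V: "continuous_on UNIV (V t)"
proof (rule lipschitz_on_continuous_on[of "exp (Lc * \<bar>t\<bar>)"], rule lipschitz_onI)
  show "dist (V t x) (V t y) \<le> exp (Lc * \<bar>t\<bar>) * dist x y" for x y
    using solutions_dist[OF lip V_deriv[of x] V_deriv[of y], of t] by (simp add: dist_norm V_0)
qed auto

text \<open>The constant curve solves the equation. Points where the field vanishes do not move, so
  for a field supported in a bounded set only finitely many pairs of a plan change their
  cost.\<close>

lemma V_fixed: "v x = 0 \<Longrightarrow> V t x = x"
  using solutions_dist[OF lip V_deriv[of x], of "\<lambda>_. x" t] by (simp add: V_0)

lemma V_dist: "norm (V t x - x) \<le> \<bar>t\<bar>"
proof -
  have "norm (V t x - V 0 x) \<le> 1 * norm (t - 0)"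
  proof (rule differentiable_bound[where S=UNIV and f'="\<lambda>s h. h *\<^sub>R v (V s x)"])
    show "((\<lambda>t. V t x) has_derivative (\<lambda>h. h *\<^sub>R v (V s x))) (at s within UNIV)" for s
      using V_deriv[of x s] by (simp add: has_vector_derivative_def)
    show "onorm (\<lambda>h. h *\<^sub>R v (V s x)) \<le> 1" for s
      using bdd[of "V s x"] by (intro onorm_le) (simp add: mult_left_le)
  qed auto
  then show ?thesis by (simp add: V_0)
qed

text \<open>Subtracting the linear part leaves a curve with velocity \<open>v (V s x) - v x\<close>,
  of size at most \<open>Lc * |s|\<close> since the speed is at most 1.\<close>

lemma V_taylor: "norm (V t x - x - t *\<^sub>R v x) \<le> Lc * t\<^sup>2"
proof -
  let ?S = "{- \<bar>t\<bar>..\<bar>t\<bar>}"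
  have L: "0 \<le> Lc" by (rule Lc_nonneg) simp
  have "norm ((V t x - t *\<^sub>R v x) - (V 0 x - 0 *\<^sub>R v x)) \<le> (Lc * \<bar>t\<bar>) * norm (t - 0)"
  proof (rule differentiable_bound[where S="?S" and f'="\<lambda>s h. h *\<^sub>R (v (V s x) - v x)"])
    show "((\<lambda>t. V t x - t *\<^sub>R v x) has_derivative (\<lambda>h. h *\<^sub>R (v (V s x) - v x))) (at s within ?S)" for s
      using V_deriv[of x s, unfolded has_vector_derivative_def, THEN has_derivative_at_withinI, of ?S]
      by (auto intro!: derivative_eq_intros simp: scaleR_diff_right)
    show "onorm (\<lambda>h. h *\<^sub>R (v (V s x) - v x)) \<le> Lc * \<bar>t\<bar>" if "s \<in> ?S" for s
    proof (rule onorm_le)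
      fix h :: real
      have "norm (v (V s x) - v x) \<le> Lc * norm (V s x - x)" by (rule lip)
      also have "\<dots> \<le> Lc * \<bar>t\<bar>"
        using V_dist[of s x] that L by (intro mult_left_mono) auto
      finally show "norm (h *\<^sub>R (v (V s x) - v x)) \<le> Lc * \<bar>t\<bar> * norm h"
        by (simp add: mult.commute[of _ "\<bar>h\<bar>"] mult_left_mono)
    qed
  qed auto
  then show ?thesis by (simp add: V_0 power2_eq_square algebra_simps)
qed

end

section \<open>Measurable enumeration of configurations\<close>

lemma space_GammaM [simp]: "space (GammaM Y) = Gamma Y"
  unfolding GammaM_def by (rule space_measure_of) auto

lemma measurable_npts [measurable]:
  assumes "B \<in> sets borel" "bounded B"
  shows "(\<lambda>eta. npts eta B) \<in> borel_measurable (GammaM Y)"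
proof (rule measurableI)
  fix A :: "ennreal set" assume "A \<in> sets borel"
  then have "{eta \<in> Gamma Y. npts eta B \<in> A} \<in> sets (GammaM Y)"
    using assms unfolding GammaM_def by (subst sets_measure_of) auto
  then show "(\<lambda>eta. npts eta B) -` A \<inter> space (GammaM Y) \<in> sets (GammaM Y)"
    by (simp add: vimage_def Int_def conj_commute)
qed simp

lemma measurable_GammaM_I:
  assumes "\<And>x. x \<in> space M \<Longrightarrow> f x \<in> Gamma Y"
    and "\<And>B. B \<in> sets borel \<Longrightarrow> bounded B \<Longrightarrow> (\<lambda>x. npts (f x) B) \<in> borel_measurable M"
  shows "f \<in> measurable M (GammaM Y)"
  unfolding GammaM_def
proof (rule measurable_measure_of)
  show "f \<in> space M \<rightarrow> Gamma Y" using assms(1) by auto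
  fix y assume "y \<in> {{eta \<in> Gamma Y. npts eta B \<in> A} |B A. B \<in> sets borel \<and> bounded B \<and> A \<in> sets borel}"
  then obtain B A where y: "y = {eta \<in> Gamma Y. npts eta B \<in> A}" "B \<in> sets borel" "bounded B" "A \<in> sets borel"
    by blast
  then have "f -` y \<inter> space M = (\<lambda>x. npts (f x) B) -` A \<inter> space M"
    using assms(1) by auto
  also have "\<dots> \<in> sets M" using assms(2) y by (intro measurable_sets) auto
  finally show "f -` y \<inter> space M \<in> sets M" .
qed auto

lemma Gamma_finite: 
  fixes eta :: "'a::euclidean_space \<Rightarrow> nat"
  assumes "eta \<in> Gamma Y" "bounded B"
  shows "finite {x \<in> B. eta x \<noteq> 0}"
proof -
  have "compact (closure B)" using assms(2) by (simp add: compact_closure)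
  then have "finite {x \<in> closure B. eta x \<noteq> 0}"
    using assms(1) by (simp add: Gamma_def locfin_def)
  then show ?thesis by (rule finite_subset[rotated]) (use closure_subset in auto)
qed

lemma Gamma_UNIV_I:
  assumes "\<And>K. compact K \<Longrightarrow> finite {x \<in> K. eta x \<noteq> 0}"
  shows "eta \<in> Gamma UNIV"
  using assms unfolding Gamma_def locfin_def by blast

lemma npts_eq_sum:
  assumes "finite {x \<in> B. eta x \<noteq> 0}"
  shows "npts eta B = of_nat (\<Sum>x\<in>{x \<in> B. eta x \<noteq> 0}. eta x)"
proof -
  have "npts eta B = (\<integral>\<^sup>+x. of_nat (eta x) * indicator {x \<in> B. eta x \<noteq> 0} x \<partial>count_space UNIV)"
    unfolding npts_def by (intro nn_integral_cong) (auto simp: indicator_def)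
  also have "\<dots> = (\<Sum>x\<in>{x \<in> B. eta x \<noteq> 0}. of_nat (eta x))"
    using assms by (subst nn_integral_indicator_finite) auto
  finally show ?thesis by simp
qed

lemma npts_zero_iff: "npts eta B = 0 \<longleftrightarrow> (\<forall>x\<in>B. eta x = 0)"
  unfolding npts_def
  by (subst nn_integral_0_iff_AE) (auto simp: AE_count_space indicator_def)

lemma npts_add: "npts (\<lambda>x. a x + b x) B = npts a B + npts b B"
  unfolding npts_def by (subst nn_integral_add[symmetric]) (auto simp: distrib_left)

section \<open>Images of configurations under homeomorphisms\<close>

lemma push_inverse:
  assumes "\<And>x. g (f x) = x" "\<And>y. f (g y) = y"
  shows "push f eta = (\<lambda>y. eta (g y))"
proof
  fix y
  have "{x. f x = y \<and> eta x \<noteq> 0} = (if eta (g y) \<noteq> 0 then {g y} else {})"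
    using assms by auto
  then show "push f eta y = eta (g y)" by (auto simp: push_def)
qed

lemma push_compose:
  assumes "\<And>x. g (f x) = x" "\<And>y. f (g y) = y" "\<And>x. g' (f' x) = x" "\<And>y. f' (g' y) = y"
  shows "push f (push f' eta) = push (f \<circ> f') eta"
proof -
  have "push (f \<circ> f') eta = (\<lambda>y. eta (g' (g y)))"
    by (rule push_inverse) (simp_all add: assms)
  then show ?thesis by (simp add: push_inverse[OF assms(1,2)] push_inverse[OF assms(3,4)])
qed

lemma npts_push:
  assumes "\<And>x. g (f x) = x" "\<And>y. f (g y) = y"
  shows "npts (push f eta) B = npts eta (f -` B)"
proof -
  have "bij f" using assms by (intro bij_betw_byWitness[where f'=g]) auto
  have "npts eta (f -` B) = (\<integral>\<^sup>+ x. (\<lambda>y. indicator B y * of_nat (eta (g y))) (f x) \<partial>count_space UNIV)"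
    unfolding npts_def by (intro nn_integral_cong) (auto simp: assms indicator_def)
  also have "\<dots> = (\<integral>\<^sup>+ y. indicator B y * of_nat (eta (g y)) \<partial>count_space UNIV)"
    by (rule nn_integral_bij_count_space[OF \<open>bij f\<close>])
  finally show ?thesis by (simp add: npts_def push_inverse[OF assms])
qed

lemma push_Gamma:
  assumes "\<And>x. g (f x) = x" "\<And>y. f (g y) = y" "continuous_on UNIV g" "eta \<in> Gamma UNIV"
  shows "push f eta \<in> Gamma UNIV"
proof (rule Gamma_UNIV_I)
  fix K :: "'b set" assume "compact K"
  then have "compact (g ` K)" by (intro compact_continuous_image continuous_on_subset[OF assms(3)]) simp_all
  then have "finite {x \<in> g ` K. eta x \<noteq> 0}" using assms(4) by (simp add: Gamma_def locfin_def)
  then have "finite (f ` {x \<in> g ` K. eta x \<noteq> 0})" by simp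
  moreover have "{y \<in> K. push f eta y \<noteq> 0} \<subseteq> f ` {x \<in> g ` K. eta x \<noteq> 0}"
  proof
    fix y assume "y \<in> {y \<in> K. push f eta y \<noteq> 0}"
    then have "g y \<in> {x \<in> g ` K. eta x \<noteq> 0}" by (simp add: push_inverse[OF assms(1,2)])
    then have "f (g y) \<in> f ` {x \<in> g ` K. eta x \<noteq> 0}" by (rule imageI)
    then show "y \<in> f ` {x \<in> g ` K. eta x \<noteq> 0}" by (simp add: assms(2))
  qed
  ultimately show "finite {y \<in> K. push f eta y \<noteq> 0}" by (rule finite_subset[rotated])
qed

lemma measurable_push:
  fixes f g :: "'a::euclidean_space \<Rightarrow> 'a"
  assumes "\<And>x. g (f x) = x" "\<And>y. f (g y) = y" "continuous_on UNIV f" "continuous_on UNIV g"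
  shows "push f \<in> measurable (GammaM UNIV) (GammaM UNIV)"
proof (rule measurable_GammaM_I)
  show "push f eta \<in> Gamma UNIV" if "eta \<in> space (GammaM UNIV)" for eta
    using push_Gamma[OF assms(1,2,4)] that by simp
  fix B :: "'a set" assume B: "B \<in> sets borel" "bounded B"
  have "f -` B \<in> sets borel"
    using measurable_sets[OF borel_measurable_continuous_onI[OF assms(3)] B(1)] by simp
  moreover have "bounded (f -` B)"
  proof -
    have "f -` B = g ` B" 
    proof (intro equalityI subsetI)
      fix x assume "x \<in> f -` B"
      then have "g (f x) \<in> g ` B" by (intro imageI) simp
      then show "x \<in> g ` B" by (simp only: assms(1))
    next
      fix x assume "x \<in> g ` B"
      then obtain y where "x = g y" "y \<in> B" by blast
      then show "x \<in> f -` B" by (simp add: assms(2))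
    qed
    moreover have "compact (g ` closure B)"
      using B assms(4) by (intro compact_continuous_image continuous_on_subset[OF assms(4)]) (auto simp: compact_closure)
    ultimately show ?thesis
      using bounded_subset[OF compact_imp_bounded image_mono[OF closure_subset]] by metis
  qed
  ultimately show "(\<lambda>eta. npts (push f eta) B) \<in> borel_measurable (GammaM UNIV)"
    unfolding npts_push[OF assms(1,2)] by (rule measurable_npts)
qed

section \<open>Numbering the points of a configuration by a countable base of balls\<close>

lemma ball_basis_exists:
  "\<exists>(a :: nat \<Rightarrow> 'a::euclidean_space) r. (\<forall>j. r j > 0) \<and>
     (\<forall>x e. e > 0 \<longrightarrow> (\<exists>j. x \<in> ball (a j) (r j) \<and> ball (a j) (r j) \<subseteq> ball x e))"
proof -
  obtain D :: "'a set" where D: "countable D" "\<And>X. open X \<Longrightarrow> X \<noteq> {} \<Longrightarrow> \<exists>d\<in>D. d \<in> X"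
    by (rule countable_dense_setE) blast
  define f where "f = from_nat_into (D \<times> {q::real. q \<in> \<rat> \<and> q > 0})"
  have "D \<noteq> {}" using D(2)[of UNIV] by auto
  have c: "countable (D \<times> {q::real. q \<in> \<rat> \<and> q > 0})"
    by (intro countable_SIGMA D countable_subset[OF _ countable_rat]) auto
  have ne: "D \<times> {q::real. q \<in> \<rat> \<and> q > 0} \<noteq> {}"
    using \<open>D \<noteq> {}\<close> by (auto intro!: exI[of _ 1])
  show ?thesis
  proof (intro exI[of _ "fst \<circ> f"] exI[of _ "snd \<circ> f"] conjI allI impI)
    fix j show "(snd \<circ> f) j > 0" using from_nat_into[OF ne, of j] by (auto simp: f_def)
  next
    fix x :: 'a and e :: real assume "e > 0"
    obtain q where q: "q \<in> \<rat>" "0 < q" "q < e / 2" using Rats_dense_in_real[of 0 "e/2"] \<open>e > 0\<close> by auto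
    obtain d where d: "d \<in> D" "d \<in> ball x q" using D(2)[of "ball x q"] q by auto
    obtain j where j: "f j = (d, q)"
      using from_nat_into_surj[OF c, of "(d, q)"] q d by (auto simp: f_def)
    have "ball d q \<subseteq> ball x e"
    proof
      fix y assume "y \<in> ball d q"
      then have "dist x y \<le> dist x d + dist d y" by (intro dist_triangle)
      then show "y \<in> ball x e" using d \<open>y \<in> ball d q\<close> q by auto
    qed
    then show "\<exists>j. x \<in> ball ((fst \<circ> f) j) ((snd \<circ> f) j) \<and> ball ((fst \<circ> f) j) ((snd \<circ> f) j) \<subseteq> ball x e"
      using d by (intro exI[of _ j]) (auto simp: j dist_commute)
  qed
qed

locale ball_basis =
  fixes ctr :: "nat \<Rightarrow> 'a::euclidean_space" and rad :: "nat \<Rightarrow> real"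
  assumes rad_pos: "rad j > 0"
    and basis: "e > 0 \<Longrightarrow> \<exists>j. x \<in> ball (ctr j) (rad j) \<and> ball (ctr j) (rad j) \<subseteq> ball x e"
begin

definition bl :: "nat \<Rightarrow> 'a set" where "bl j = ball (ctr j) (rad j)"

lemma bl_basis: "e > 0 \<Longrightarrow> \<exists>j. x \<in> bl j \<and> bl j \<subseteq> ball x e"
  unfolding bl_def by (rule basis)

lemma borel_bl [measurable]: "bl j \<in> sets borel"
  by (simp add: bl_def)

lemma bounded_bl: "bounded (bl j)"
  by (simp add: bl_def)

lemma measurable_npts_Int_bl [measurable]:
  "B \<in> sets borel \<Longrightarrow> (\<lambda>eta. npts eta (bl j \<inter> B)) \<in> borel_measurable (GammaM Y)"
  by (intro measurable_npts bounded_Int disjI1 bounded_bl) auto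

text \<open>A point of a configuration is numbered by the first ball of the basis that contains no other point of it:
  \<open>act j eta\<close> says that \<open>j\<close> is such a number, \<open>pt j eta\<close> is the corresponding point and \<open>ix eta\<close> the inverse.
  Isolation is expressed by counts only, which makes it measurable.\<close>

definition isolates :: "nat \<Rightarrow> ('a \<Rightarrow> nat) \<Rightarrow> bool" where
  "isolates j eta \<longleftrightarrow> npts eta (bl j) \<noteq> 0 \<and> (\<forall>i. npts eta (bl j \<inter> bl i) = 0 \<or> npts eta (bl j - bl i) = 0)"

definition act :: "nat \<Rightarrow> ('a \<Rightarrow> nat) \<Rightarrow> bool" where
  "act j eta \<longleftrightarrow> isolates j eta \<and> (\<forall>i<j. \<not> (isolates i eta \<and> npts eta (bl i \<inter> bl j) \<noteq> 0))"

definition pt :: "nat \<Rightarrow> ('a \<Rightarrow> nat) \<Rightarrow> 'a" where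
  "pt j eta = (if act j eta then (THE x. x \<in> bl j \<and> eta x \<noteq> 0) else 0)"

definition ix :: "('a \<Rightarrow> nat) \<Rightarrow> 'a \<Rightarrow> nat" where
  "ix eta x = (LEAST j. isolates j eta \<and> x \<in> bl j)"

text \<open>\<open>isolates\<close> sees support points, not multiplicities: two distinct support
  points in \<open>bl j\<close> are told apart by a base ball around one of them, and then both
  counts are nonzero.\<close>

lemma isolates_iff: "isolates j eta \<longleftrightarrow> (\<exists>x\<in>bl j. eta x \<noteq> 0 \<and> (\<forall>y\<in>bl j. eta y \<noteq> 0 \<longrightarrow> y = x))"
proof
  assume iso: "isolates j eta"
  then obtain x where x: "x \<in> bl j" "eta x \<noteq> 0" by (auto simp: isolates_def npts_zero_iff)
  have uniq: "y = x" if "y \<in> bl j" "eta y \<noteq> 0" for y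
  proof (rule ccontr)
    assume "y \<noteq> x"
    then obtain i where i: "x \<in> bl i" "bl i \<subseteq> ball x (dist x y)" using bl_basis[of "dist x y" x] by auto
    then have "y \<notin> bl i" by auto
    then have "y \<in> bl j - bl i" "x \<in> bl j \<inter> bl i" using x that i by auto
    moreover have "(\<forall>x\<in>bl j \<inter> bl i. eta x = 0) \<or> (\<forall>x\<in>bl j - bl i. eta x = 0)"
      using iso unfolding isolates_def npts_zero_iff by blast
    ultimately show False using x(2) that(2) by metis
  qed
  show "\<exists>x\<in>bl j. eta x \<noteq> 0 \<and> (\<forall>y\<in>bl j. eta y \<noteq> 0 \<longrightarrow> y = x)"
    by (intro bexI[OF _ x(1)] conjI x(2) ballI impI uniq)
next
  assume "\<exists>x\<in>bl j. eta x \<noteq> 0 \<and> (\<forall>y\<in>bl j. eta y \<noteq> 0 \<longrightarrow> y = x)"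
  then obtain x where x: "x \<in> bl j" "eta x \<noteq> 0" "\<forall>y\<in>bl j. eta y \<noteq> 0 \<longrightarrow> y = x" by blast
  show "isolates j eta"
    unfolding isolates_def npts_zero_iff
  proof (intro conjI allI)
    fix i show "(\<forall>x\<in>bl j \<inter> bl i. eta x = 0) \<or> (\<forall>x\<in>bl j - bl i. eta x = 0)"
      using x(3) by (cases "x \<in> bl i") blast+
  qed (use x in auto)
qed

lemma act_unique: "act j eta \<Longrightarrow> x \<in> bl j \<Longrightarrow> eta x \<noteq> 0 \<Longrightarrow> pt j eta = x"
  unfolding pt_def act_def isolates_iff by (simp del: neq0_conv) (rule the_equality, blast+)

lemma pt_act:
  assumes "act j eta"
  shows "pt j eta \<in> bl j" "eta (pt j eta) \<noteq> 0"
proof -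
  obtain x where x: "x \<in> bl j" "eta x \<noteq> 0"
    using assms unfolding act_def isolates_iff by blast
  then have "pt j eta = x" using act_unique[OF assms] by blast
  with x show "pt j eta \<in> bl j" "eta (pt j eta) \<noteq> 0" by auto
qed

lemma isolates_ex:
  assumes "eta \<in> Gamma Y" "eta x \<noteq> 0"
  shows "\<exists>j. isolates j eta \<and> x \<in> bl j"
proof -
  have "finite {y \<in> ball x 1. eta y \<noteq> 0}" using assms(1) by (rule Gamma_finite) simp
  then have "finite ({y \<in> ball x 1. eta y \<noteq> 0} - {x})" by simp
  from finite_set_avoid[OF this, of x]
  obtain d where d: "d > 0" "\<And>y. y \<in> ball x 1 \<Longrightarrow> eta y \<noteq> 0 \<Longrightarrow> y \<noteq> x \<Longrightarrow> d \<le> dist x y" by auto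
  obtain j where j: "x \<in> bl j" "bl j \<subseteq> ball x (min d 1)" using bl_basis[of "min d 1" x] d(1) by auto
  have "y = x" if "y \<in> bl j" "eta y \<noteq> 0" for y
  proof (rule ccontr)
    assume "y \<noteq> x"
    moreover have "y \<in> ball x (min d 1)" using j that by blast
    ultimately show False using d(2)[of y] that by simp
  qed
  then show ?thesis using j assms(2) unfolding isolates_iff by blast
qed

text \<open>Minimality in \<open>act\<close> follows from minimality of \<open>ix\<close>: an
  earlier isolating ball that shares a point of the configuration with \<open>bl (ix eta x)\<close>
  must share \<open>x\<close>, the only one there, and so would be a smaller candidate.\<close>

lemma ix_act:
  assumes "eta \<in> Gamma Y" "eta x \<noteq> 0"
  shows "act (ix eta x) eta" "pt (ix eta x) eta = x"
proof -
  have P: "isolates (ix eta x) eta \<and> x \<in> bl (ix eta x)"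
    unfolding ix_def by (rule LeastI_ex[OF isolates_ex[OF assms]])
  show a: "act (ix eta x) eta"
    unfolding act_def
  proof (intro conjI allI impI notI)
    fix i assume i: "i < ix eta x" "isolates i eta \<and> npts eta (bl i \<inter> bl (ix eta x)) \<noteq> 0"
    then obtain y where "y \<in> bl i" "y \<in> bl (ix eta x)" "eta y \<noteq> 0"
      unfolding npts_zero_iff by blast
    then have "y = x" using P assms(2) unfolding isolates_iff by blast
    then show False using i not_less_Least[of i "\<lambda>j. isolates j eta \<and> x \<in> bl j"] \<open>y \<in> bl i\<close>
      unfolding ix_def[symmetric] by auto
  qed (use P in auto)
  show "pt (ix eta x) eta = x" using act_unique[OF a] P assms(2) by auto
qed

lemma act_inj: "act i eta \<Longrightarrow> act j eta \<Longrightarrow> pt i eta = pt j eta \<Longrightarrow> i = j"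
proof (induction i j rule: linorder_wlog)
  case (le i j)
  show ?case
  proof (rule ccontr)
    assume "i \<noteq> j"
    then have "i < j" using le by simp
    moreover have "npts eta (bl i \<inter> bl j) \<noteq> 0"
      using pt_act[OF le(2)] pt_act[OF le(3)] le(4) unfolding npts_zero_iff by auto
    ultimately show False using le(2,3) by (auto simp: act_def)
  qed
qed (metis)

lemma ix_pt: "eta \<in> Gamma Y \<Longrightarrow> act j eta \<Longrightarrow> ix eta (pt j eta) = j"
  using ix_act[of eta Y "pt j eta"] pt_act[of j eta] act_inj by blast

lemma bij_pt: "eta \<in> Gamma Y \<Longrightarrow> bij_betw (\<lambda>j. pt j eta) {j. act j eta} {x. eta x \<noteq> 0}"
  by (rule bij_betw_byWitness[where f'="ix eta"]) (use ix_pt ix_act pt_act in blast)+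

lemma measurable_act [measurable]: "Measurable.pred (GammaM Y) (act j)"
proof -
  have [measurable]: "(\<lambda>eta. npts eta (bl j)) \<in> borel_measurable (GammaM Y)" for j
    by (intro measurable_npts bounded_bl borel_bl)
  have "Measurable.pred (GammaM Y) (isolates j)" for j
    unfolding isolates_def Diff_eq by measurable
  note [measurable] = this
  show ?thesis unfolding act_def by measurable
qed

text \<open>Since an active ball carries a single support point, membership of that point in
  \<open>B\<close> is the event that the count on \<open>bl j \<inter> B\<close> is nonzero.
  Inactive numbers contribute the default value 0 of \<open>pt\<close>.\<close>

lemma measurable_pt [measurable]: "pt j \<in> borel_measurable (GammaM Y)"
proof (rule measurableI)
  fix B :: "'a set" assume [measurable]: "B \<in> sets borel"
  have "pt j eta \<in> B \<longleftrightarrow> (act j eta \<and> npts eta (bl j \<inter> B) \<noteq> 0) \<or> (\<not> act j eta \<and> 0 \<in> B)" for eta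
  proof (cases "act j eta")
    case True
    have "pt j eta \<in> B \<longleftrightarrow> (\<exists>x\<in>bl j \<inter> B. eta x \<noteq> 0)"
    proof
      assume "pt j eta \<in> B"
      then show "\<exists>x\<in>bl j \<inter> B. eta x \<noteq> 0" using pt_act[OF True] by (intro bexI[of _ "pt j eta"] IntI)
    next
      assume "\<exists>x\<in>bl j \<inter> B. eta x \<noteq> 0"
      then obtain x where "x \<in> bl j" "x \<in> B" "eta x \<noteq> 0" by blast
      with act_unique[OF True this(1,3)] show "pt j eta \<in> B" by simp
    qed
    with True show ?thesis unfolding npts_zero_iff by simp
  qed (simp add: pt_def)
  then have "pt j -` B \<inter> space (GammaM Y) = {eta \<in> space (GammaM Y).
      (act j eta \<and> npts eta (bl j \<inter> B) \<noteq> 0) \<or> (\<not> act j eta \<and> 0 \<in> B)}"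
    by auto
  also have "\<dots> \<in> sets (GammaM Y)" by measurable
  finally show "pt j -` B \<inter> space (GammaM Y) \<in> sets (GammaM Y)" .
qed simp

lemma npts_bl_act:
  assumes "act j eta" shows "npts eta (bl j) = of_nat (eta (pt j eta))"
proof -
  have eq: "{x \<in> bl j. eta x \<noteq> 0} = {pt j eta}"
  proof (intro equalityI subsetI)
    fix x assume "x \<in> {x \<in> bl j. eta x \<noteq> 0}"
    then have "pt j eta = x" by (intro act_unique[OF assms]) auto
    then show "x \<in> {pt j eta}" by simp
  qed (use pt_act[OF assms] in simp)
  show ?thesis by (subst npts_eq_sum) (simp_all only: eq, simp_all)
qed

lemma nn_integral_act:
  assumes "eta \<in> Gamma Y" "\<And>x. eta x = 0 \<Longrightarrow> f x = 0"
  shows "(\<integral>\<^sup>+ x. f x \<partial>count_space UNIV) = (\<integral>\<^sup>+ j. (if act j eta then f (pt j eta) else 0) \<partial>count_space UNIV)"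
proof -
  have "(\<integral>\<^sup>+ x. f x \<partial>count_space UNIV) = (\<integral>\<^sup>+ x. f x \<partial>count_space {x. eta x \<noteq> 0})"
    by (rule nn_integral_count_space_eq) (use assms in auto)
  also have "\<dots> = (\<integral>\<^sup>+ j. f (pt j eta) \<partial>count_space {j. act j eta})"
    by (rule nn_integral_bij_count_space[OF bij_pt[OF assms(1)], symmetric])
  also have "\<dots> = (\<integral>\<^sup>+ j. (if act j eta then f (pt j eta) else 0) \<partial>count_space {j. act j eta})"
    by (intro nn_integral_cong) auto
  also have "\<dots> = (\<integral>\<^sup>+ j. (if act j eta then f (pt j eta) else 0) \<partial>count_space UNIV)"
    by (rule nn_integral_count_space_eq) auto
  finally show ?thesis .
qed

end

section \<open>Measurability of the cost\<close>

lemma marginals_support: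
  assumes "marginals beta eta om" "beta (x, y) \<noteq> 0"
  shows "eta x \<noteq> 0" "om y \<noteq> 0"
proof -
  have "(of_nat (beta (x, y)) :: ennreal) \<le> (\<integral>\<^sup>+ y. of_nat (beta (x, y)) \<partial>count_space UNIV)"
    by (rule nn_integral_ge_point) simp
  then show "eta x \<noteq> 0" using assms by (intro notI) (simp add: marginals_def)
  have "(of_nat (beta (x, y)) :: ennreal) \<le> (\<integral>\<^sup>+ x. of_nat (beta (x, y)) \<partial>count_space UNIV)"
    by (rule nn_integral_ge_point[of x UNIV "\<lambda>x. of_nat (beta (x, y))"]) simp
  then show "om y \<noteq> 0" using assms by (intro notI) (simp add: marginals_def)
qed

lemma marginals_Gamma:
  fixes beta :: "'a::euclidean_space \<times> 'a \<Rightarrow> nat"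
  assumes "marginals beta eta om" "eta \<in> Gamma UNIV" "om \<in> Gamma UNIV"
  shows "beta \<in> Gamma UNIV"
proof (rule Gamma_UNIV_I)
  fix K :: "('a \<times> 'a) set" assume "compact K"
  then have c: "bounded (fst ` K)" "bounded (snd ` K)"
    by (auto intro!: compact_imp_bounded compact_continuous_image continuous_intros)
  have "{p \<in> K. beta p \<noteq> 0} \<subseteq> {x \<in> fst ` K. eta x \<noteq> 0} \<times> {y \<in> snd ` K. om y \<noteq> 0}"
  proof
    fix p assume "p \<in> {p \<in> K. beta p \<noteq> 0}"
    then show "p \<in> {x \<in> fst ` K. eta x \<noteq> 0} \<times> {y \<in> snd ` K. om y \<noteq> 0}"
      using marginals_support[OF assms(1), of "fst p" "snd p"] by (cases p) force
  qed
  then show "finite {p \<in> K. beta p \<noteq> 0}"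
    by (rule finite_subset) (intro finite_cartesian_product Gamma_finite[OF assms(2) c(1)] Gamma_finite[OF assms(3) c(2)])
qed

lemma one_le_of_nat_ennreal: "n \<noteq> 0 \<Longrightarrow> (1::ennreal) \<le> of_nat n"
  using of_nat_mono[of 1 n, where ?'a=ennreal] by simp

lemma nn_integral_of_nat_finite_support:
  assumes "(\<integral>\<^sup>+ j. of_nat (f j) \<partial>count_space UNIV) < (\<infinity>::ennreal)"
  shows "finite {j. f j \<noteq> (0::nat)}"
proof -
  have "emeasure (count_space UNIV) {j. f j \<noteq> 0} = (\<integral>\<^sup>+ j. indicator {j. f j \<noteq> 0} j \<partial>count_space UNIV)"
    by simp
  also have "\<dots> \<le> (\<integral>\<^sup>+ j. of_nat (f j) \<partial>count_space UNIV)"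
    by (intro nn_integral_mono) (simp add: indicator_def one_le_of_nat_ennreal)
  finally have "emeasure (count_space UNIV) {j. f j \<noteq> 0} < \<infinity>" using assms by (rule le_less_trans)
  then show ?thesis by (simp add: emeasure_count_space split: if_splits)
qed

text \<open>Bounded sequences of natural numbers have constant subsequences; a diagonal over the
  countably many entries makes every entry eventually constant.\<close>

lemma diagonal_constant_subsequence:
  fixes B :: "nat \<Rightarrow> 'p::countable \<Rightarrow> nat"
  assumes "\<And>n p. B n p \<le> M p"
  shows "\<exists>(s :: nat \<Rightarrow> nat) b. strict_mono s \<and> (\<forall>p. \<exists>N. \<forall>l\<ge>N. B (s l) p = b p)"
proof -
  define P where "P n s \<longleftrightarrow> (\<exists>c. \<forall>l. B (s l) (from_nat n) = c)" for n and s :: "nat \<Rightarrow> nat"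
  interpret subseqs P
  proof
    fix n and s :: "nat \<Rightarrow> nat" assume "strict_mono s"
    have "finite (range (\<lambda>l. B (s l) (from_nat n)))"
      by (rule finite_subset[of _ "{..M (from_nat n)}"]) (auto simp: assms)
    from pigeonhole_infinite[OF infinite_UNIV_nat this]
    obtain l0 where inf: "infinite {l. B (s l) (from_nat n) = B (s l0) (from_nat n)}" by auto
    show "\<exists>r'. strict_mono r' \<and> P n (s \<circ> r')"
    proof (intro exI conjI)
      show "strict_mono (enumerate {l. B (s l) (from_nat n) = B (s l0) (from_nat n)})"
        by (rule strict_mono_enumerate[OF inf])
      show "P n (s \<circ> enumerate {l. B (s l) (from_nat n) = B (s l0) (from_nat n)})"
        unfolding P_def using enumerate_in_set[OF inf] by auto
    qed
  qed
  \<comment> \<open>The diagonal sequence is known to satisfy \<open>P k\<close> only after its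
    first \<open>Suc k\<close> terms, hence the shift.\<close>
  have "P k (diagseq \<circ> ((+) (Suc k)))" for k
    by (rule diagseq_holds) (auto simp: P_def)
  then have "\<forall>k. \<exists>c. \<forall>l. B (diagseq (Suc k + l)) (from_nat k) = c" by (simp add: P_def)
  then obtain c where c: "\<And>k l. B (diagseq (Suc k + l)) (from_nat k) = c k" by metis
  show ?thesis
  proof (intro exI[of _ diagseq] exI[of _ "\<lambda>p. c (to_nat p)"] conjI allI)
    show "strict_mono diagseq" by (rule subseq_diagseq)
    fix p :: 'p
    show "\<exists>N. \<forall>l\<ge>N. B (diagseq l) p = c (to_nat p)"
    proof (intro exI[of _ "Suc (to_nat p)"] allI impI)
      fix l assume "l \<ge> Suc (to_nat p)"
      then show "B (diagseq l) p = c (to_nat p)"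
        using c[of "to_nat p" "l - Suc (to_nat p)"] by simp
    qed
  qed
qed

section \<open>Integer transport plans on pairs of numbers\<close>

definition rowsum :: "('a \<times> 'b \<Rightarrow> nat) \<Rightarrow> 'a \<Rightarrow> ennreal" where
  "rowsum b i = (\<integral>\<^sup>+ j. of_nat (b (i, j)) \<partial>count_space UNIV)"

definition colsum :: "('a \<times> 'b \<Rightarrow> nat) \<Rightarrow> 'b \<Rightarrow> ennreal" where
  "colsum b j = (\<integral>\<^sup>+ i. of_nat (b (i, j)) \<partial>count_space UNIV)"

definition plan_cost :: "('p \<Rightarrow> real) \<Rightarrow> ('p \<Rightarrow> nat) \<Rightarrow> ennreal" where
  "plan_cost C b = (\<integral>\<^sup>+ p. of_nat (b p) * ennreal (C p) \<partial>count_space UNIV)"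

text \<open>What survives of a plan when finitely many of its entries are kept: rows and columns
  with number below \<open>n\<close> are saturated, the others may lose mass but never exceed their
  weight.\<close>

definition partial_plan ::
  "nat \<Rightarrow> (nat \<Rightarrow> nat) \<Rightarrow> (nat \<Rightarrow> nat) \<Rightarrow> (nat \<times> nat \<Rightarrow> nat) \<Rightarrow> bool" where
  "partial_plan n m m' b \<longleftrightarrow>
     (\<forall>i. rowsum b i \<le> of_nat (m i)) \<and> (\<forall>j. colsum b j \<le> of_nat (m' j)) \<and>
     (\<forall>i<n. of_nat (m i) \<le> rowsum b i) \<and> (\<forall>j<n. of_nat (m' j) \<le> colsum b j)"

lemma le_rowsum: "of_nat (b (i, j)) \<le> rowsum b i"
  unfolding rowsum_def by (rule nn_integral_ge_point) simp

lemma le_colsum: "of_nat (b (i, j)) \<le> colsum b j"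
  unfolding colsum_def by (rule nn_integral_ge_point[of i UNIV "\<lambda>i. of_nat (b (i, j))"]) simp

lemma le_plan_cost: "of_nat (b p) * ennreal (C p) \<le> plan_cost C b"
  unfolding plan_cost_def by (rule nn_integral_ge_point) simp

lemma partial_plan_le:
  assumes "partial_plan n m m' b"
  shows "b (i, j) \<le> m i" "b (i, j) \<le> m' j"
proof -
  have "(of_nat (b (i, j)) :: ennreal) \<le> of_nat (m i)" "(of_nat (b (i, j)) :: ennreal) \<le> of_nat (m' j)"
    using assms le_rowsum[of b i j] le_colsum[of b i j] unfolding partial_plan_def by (blast intro: order_trans)+
  then show "b (i, j) \<le> m i" "b (i, j) \<le> m' j" by simp_all
qed

text \<open>Multiplicities are integers, so a charged pair alone contributes at least
  \<open>C p\<close>. A budget thus bounds the cost of every pair in use, which is the source of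
  compactness.\<close>

lemma plan_cost_support:
  assumes "plan_cost C b \<le> ennreal a" "b p \<noteq> 0" "0 \<le> a"
  shows "C p \<le> a"
proof -
  have "ennreal (C p) \<le> of_nat (b p) * ennreal (C p)"
    using mult_right_mono[OF one_le_of_nat_ennreal[OF assms(2)], of "ennreal (C p)"] by simp
  also have "\<dots> \<le> ennreal a" using le_plan_cost assms(1) by (rule order_trans)
  finally show ?thesis using assms(3) by (simp add: ennreal_le_iff)
qed

lemma rowsum_finite_support:
  assumes "finite J" "\<And>j. j \<notin> J \<Longrightarrow> b (i, j) = 0"
  shows "rowsum b i = of_nat (\<Sum>j\<in>J. b (i, j))"
proof -
  have "rowsum b i = (\<integral>\<^sup>+ j. of_nat (b (i, j)) * indicator J j \<partial>count_space UNIV)"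
    unfolding rowsum_def by (intro nn_integral_cong) (auto simp: indicator_def assms(2))
  also have "\<dots> = (\<Sum>j\<in>J. of_nat (b (i, j)))"
    using assms(1) by (subst nn_integral_indicator_finite) auto
  finally show ?thesis by simp
qed

lemma colsum_swap: "colsum b j = rowsum (\<lambda>p. b (snd p, fst p)) j"
  by (simp add: colsum_def rowsum_def)

lemma colsum_finite_support:
  assumes "finite I" "\<And>i. i \<notin> I \<Longrightarrow> b (i, j) = 0"
  shows "colsum b j = of_nat (\<Sum>i\<in>I. b (i, j))"
  unfolding colsum_swap using rowsum_finite_support[of I "\<lambda>p. b (snd p, fst p)" j] assms by simp

text \<open>No mass escapes in the limit: the budget confines each row and each column to finitely
  many entries, where the diagonal subsequence stabilizes, so saturated sums stay saturated. The
  cost bound passes to the limit by Fatou's lemma.\<close>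

lemma plan_compactness:
  assumes a: "0 \<le> a"
    and row: "\<And>i. m i \<noteq> 0 \<Longrightarrow> finite {j. m' j \<noteq> 0 \<and> C (i, j) \<le> a}"
    and col: "\<And>j. m' j \<noteq> 0 \<Longrightarrow> finite {i. m i \<noteq> 0 \<and> C (i, j) \<le> a}"
    and ex: "\<And>n. \<exists>b. partial_plan n m m' b \<and> plan_cost C b \<le> ennreal a"
  shows "\<exists>b. rowsum b = (\<lambda>i. of_nat (m i)) \<and> colsum b = (\<lambda>j. of_nat (m' j)) \<and> plan_cost C b \<le> ennreal a"
proof -
  obtain B where B: "\<And>n. partial_plan n m m' (B n)" "\<And>n. plan_cost C (B n) \<le> ennreal a" using ex by metis
  have "B n p \<le> m (fst p)" for n p using partial_plan_le(1)[OF B(1), of n "fst p" "snd p"] by simp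
  from diagonal_constant_subsequence[of B, OF this]
  obtain s b where s: "strict_mono (s :: nat \<Rightarrow> nat)" and lim': "\<forall>p. \<exists>N. \<forall>l\<ge>N. B (s l) p = b p"
    by (elim exE conjE)
  have ev: "eventually (\<lambda>l. B (s l) p = b p) sequentially" for p
    unfolding eventually_sequentially using lim'[THEN spec, of p] .
  have big: "eventually (\<lambda>l. s l > k) sequentially" for k
    using seq_suble[OF s] by (auto simp: eventually_sequentially intro!: exI[of _ "Suc k"] intro: less_le_trans)
  have supp: "m (fst p) \<noteq> 0 \<and> m' (snd p) \<noteq> 0 \<and> C p \<le> a" if "B n p \<noteq> 0" for n p
    using partial_plan_le[OF B(1), of n "fst p" "snd p"] that plan_cost_support[OF B(2)[of n] that a]
    by (cases p) auto
  have bsupp: "m (fst p) \<noteq> 0 \<and> m' (snd p) \<noteq> 0 \<and> C p \<le> a" if "b p \<noteq> 0" for p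
  proof -
    obtain l where "B (s l) p = b p" using lim'[THEN spec, of p] by blast
    then show ?thesis using supp[of "s l" p] that by simp
  qed
  have Bz: "B n (i, j) = 0" if "m i = 0 \<or> m' j = 0 \<or> \<not> C (i, j) \<le> a" for n i j
    using supp[of n "(i, j)"] that by (cases "B n (i, j) = 0") simp_all
  have bz: "b (i, j) = 0" if "m i = 0 \<or> m' j = 0 \<or> \<not> C (i, j) \<le> a" for i j
    using bsupp[of "(i, j)"] that by (cases "b (i, j) = 0") simp_all
  have "rowsum b i = of_nat (m i)" for i
  proof (cases "m i = 0")
    case True
    then have "b (i, j) = 0" for j using bsupp[of "(i, j)"] by auto
    then show ?thesis using True by (simp add: rowsum_def)
  next
    case False
    let ?J = "{j. m' j \<noteq> 0 \<and> C (i, j) \<le> a}"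
    have fin: "finite ?J" by (rule row[OF False])
    \<comment> \<open>\<open>s l > i\<close> ensures that row \<open>i\<close> is already saturated
      in the plan \<open>B (s l)\<close>.\<close>
    have "eventually (\<lambda>l. (\<forall>j\<in>?J. B (s l) (i, j) = b (i, j)) \<and> s l > i) sequentially"
      by (intro eventually_conj eventually_ball_finite[OF fin] ballI ev big)
    then obtain l where l: "\<And>j. j \<in> ?J \<Longrightarrow> B (s l) (i, j) = b (i, j)" "s l > i"
      by (auto simp: eventually_sequentially)
    have "rowsum (B (s l)) i = of_nat (m i)"
      using B(1)[of "s l"] l(2) unfolding partial_plan_def by (intro antisym) auto
    moreover have "rowsum (B (s l)) i = of_nat (\<Sum>j\<in>?J. B (s l) (i, j))"
      by (rule rowsum_finite_support[OF fin]) (auto intro: Bz)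
    moreover have "rowsum b i = of_nat (\<Sum>j\<in>?J. b (i, j))"
      by (rule rowsum_finite_support[OF fin]) (auto intro: bz)
    moreover have "(\<Sum>k\<in>?J. B (s l) (i, k)) = (\<Sum>k\<in>?J. b (i, k))" by (intro sum.cong refl l(1))
    ultimately show ?thesis by metis
  qed
  moreover have "colsum b j = of_nat (m' j)" for j
  proof (cases "m' j = 0")
    case True
    then have "b (i, j) = 0" for i using bsupp[of "(i, j)"] by auto
    then show ?thesis using True by (simp add: colsum_def)
  next
    case False
    let ?J = "{i. m i \<noteq> 0 \<and> C (i, j) \<le> a}"
    have fin: "finite ?J" by (rule col[OF False])
    have "eventually (\<lambda>l. (\<forall>i\<in>?J. B (s l) (i, j) = b (i, j)) \<and> s l > j) sequentially"
      by (intro eventually_conj eventually_ball_finite[OF fin] ballI ev big)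
    then obtain l where l: "\<And>i. i \<in> ?J \<Longrightarrow> B (s l) (i, j) = b (i, j)" "s l > j"
      by (auto simp: eventually_sequentially)
    have "colsum (B (s l)) j = of_nat (m' j)"
      using B(1)[of "s l"] l(2) unfolding partial_plan_def by (intro antisym) auto
    moreover have "colsum (B (s l)) j = of_nat (\<Sum>i\<in>?J. B (s l) (i, j))"
      by (rule colsum_finite_support[OF fin]) (auto intro: Bz)
    moreover have "colsum b j = of_nat (\<Sum>i\<in>?J. b (i, j))"
      by (rule colsum_finite_support[OF fin]) (auto intro: bz)
    moreover have "(\<Sum>k\<in>?J. B (s l) (k, j)) = (\<Sum>k\<in>?J. b (k, j))" by (intro sum.cong refl l(1))
    ultimately show ?thesis by metis
  qed
  moreover have "plan_cost C b \<le> ennreal a"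
  proof -
    have "plan_cost C b = (\<integral>\<^sup>+ p. liminf (\<lambda>l. of_nat (B (s l) p) * ennreal (C p)) \<partial>count_space UNIV)"
      unfolding plan_cost_def
    proof (intro nn_integral_cong)
      fix p
      have "liminf (\<lambda>l. of_nat (B (s l) p) * ennreal (C p)) = liminf (\<lambda>l. of_nat (b p) * ennreal (C p))"
        by (intro Liminf_eq eventually_mono[OF ev[of p]]) simp
      then show "of_nat (b p) * ennreal (C p) = liminf (\<lambda>l. of_nat (B (s l) p) * ennreal (C p))"
        by (simp add: Liminf_const)
    qed
    also have "\<dots> \<le> liminf (\<lambda>l. plan_cost C (B (s l)))"
      unfolding plan_cost_def by (rule nn_integral_liminf) simp
    also have "\<dots> \<le> liminf (\<lambda>l. ennreal a)"
      by (intro Liminf_mono always_eventually allI B(2))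
    finally show ?thesis by (simp add: Liminf_const)
  qed
  ultimately show ?thesis by (intro exI[of _ b]) auto
qed

text \<open>The entries in the first \<open>n\<close> rows or columns are kept. They are finitely
  many because a row or column of natural numbers with finite sum has finite support, so they form a
  multiset.\<close>

lemma partial_plan_restrict:
  assumes "rowsum b = (\<lambda>i. of_nat (m i))" "colsum b = (\<lambda>j. of_nat (m' j))" "plan_cost C b \<le> a"
  shows "\<exists>xs. partial_plan n m m' (count (mset xs)) \<and> plan_cost C (count (mset xs)) \<le> a"
proof -
  define b' where "b' p = (if fst p < n \<or> snd p < n then b p else 0)" for p
  have le: "b' p \<le> b p" for p by (simp add: b'_def)
  have r: "finite {j. b (i, j) \<noteq> 0}" for i
    using fun_cong[OF assms(1), of i] by (intro nn_integral_of_nat_finite_support) (simp add: rowsum_def of_nat_less_top)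
  have c: "finite {i. b (i, j) \<noteq> 0}" for j
    using fun_cong[OF assms(2), of j] by (intro nn_integral_of_nat_finite_support) (simp add: colsum_def of_nat_less_top)
  have "{p. b' p > 0} \<subseteq> (\<Union>i<n. (\<lambda>j. (i, j)) ` {j. b (i, j) \<noteq> 0}) \<union> (\<Union>j<n. (\<lambda>i. (i, j)) ` {i. b (i, j) \<noteq> 0})"
    by (auto simp: b'_def split: if_splits)
  moreover have "finite \<dots>" using r c by (intro finite_UnI finite_UN_I finite_imageI) auto
  ultimately have "finite {p. b' p > 0}" by (rule finite_subset)
  then have cnt: "count (Abs_multiset b') = b'" by (intro count_Abs_multiset) simp
  have "rowsum b' i \<le> of_nat (m i)" for i
    unfolding fun_cong[OF assms(1), symmetric] rowsum_def by (intro nn_integral_mono) (simp add: le)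
  moreover have "colsum b' j \<le> of_nat (m' j)" for j
    unfolding fun_cong[OF assms(2), symmetric] colsum_def by (intro nn_integral_mono) (simp add: le)
  moreover have "of_nat (m i) \<le> rowsum b' i" if "i < n" for i
    unfolding fun_cong[OF assms(1), symmetric] rowsum_def using that by (simp add: b'_def)
  moreover have "of_nat (m' j) \<le> colsum b' j" if "j < n" for j
    unfolding fun_cong[OF assms(2), symmetric] colsum_def using that by (simp add: b'_def)
  ultimately have "partial_plan n m m' b'" by (simp add: partial_plan_def)
  moreover have "plan_cost C b' \<le> a"
  proof -
    have "plan_cost C b' \<le> plan_cost C b"
      unfolding plan_cost_def by (intro nn_integral_mono mult_right_mono) (simp_all add: le)
    then show ?thesis using assms(3) by (rule order_trans)
  qed
  moreover obtain xs where "mset xs = Abs_multiset b'" using ex_mset by blast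
  ultimately show ?thesis using cnt by (intro exI[of _ xs]) simp
qed

lemma beta_cost_eq_plan_cost: "beta_cost beta = plan_cost (\<lambda>p. norm (fst p - snd p)^2 / 2) beta"
  by (simp add: beta_cost_def plan_cost_def)

lemma marginals_iff: "marginals beta eta om \<longleftrightarrow>
    rowsum beta = (\<lambda>x. of_nat (eta x)) \<and> colsum beta = (\<lambda>y. of_nat (om y))"
  by (auto simp: marginals_def rowsum_def colsum_def fun_eq_iff)

section \<open>Translating plans between configurations into plans between numbers\<close>

context ball_basis
begin

definition wt :: "('a \<Rightarrow> nat) \<Rightarrow> nat \<Rightarrow> nat" where
  "wt eta j = (if act j eta then eta (pt j eta) else 0)"

text \<open>For inactive numbers the value is meaningless, but these have weight 0 and are never
  charged.\<close>

definition dcost :: "('a \<Rightarrow> nat) \<Rightarrow> ('a \<Rightarrow> nat) \<Rightarrow> nat \<times> nat \<Rightarrow> real" where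
  "dcost eta om p = norm (pt (fst p) eta - pt (snd p) om)^2 / 2"

lemma nn_integral_act2:
  assumes "eta \<in> Gamma Y" "om \<in> Gamma Y'" "\<And>x y. eta x = 0 \<or> om y = 0 \<Longrightarrow> f (x, y) = 0"
  shows "(\<integral>\<^sup>+ p. f p \<partial>count_space UNIV) =
    (\<integral>\<^sup>+ p. (if act (fst p) eta \<and> act (snd p) om then f (pt (fst p) eta, pt (snd p) om) else 0) \<partial>count_space UNIV)"
proof -
  let ?A = "{i. act i eta} \<times> {j. act j om}" and ?B = "{x. eta x \<noteq> 0} \<times> {y. om y \<noteq> 0}"
  have bij: "bij_betw (map_prod (\<lambda>i. pt i eta) (\<lambda>j. pt j om)) ?A ?B"
    by (intro bij_betw_map_prod bij_pt[OF assms(1)] bij_pt[OF assms(2)])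
  have "(\<integral>\<^sup>+ p. f p \<partial>count_space UNIV) = (\<integral>\<^sup>+ p. f p \<partial>count_space ?B)"
  proof (rule nn_integral_count_space_eq)
    fix p assume "p \<in> UNIV - ?B"
    then show "f p = 0" using assms(3)[of "fst p" "snd p"] by (cases p) auto
  qed auto
  also have "\<dots> = (\<integral>\<^sup>+ p. f (map_prod (\<lambda>i. pt i eta) (\<lambda>j. pt j om) p) \<partial>count_space ?A)"
    by (rule nn_integral_bij_count_space[OF bij, symmetric])
  also have "\<dots> = (\<integral>\<^sup>+ p. (if act (fst p) eta \<and> act (snd p) om then f (pt (fst p) eta, pt (snd p) om) else 0) \<partial>count_space ?A)"
    by (intro nn_integral_cong) (auto simp: map_prod_def)
  also have "\<dots> = (\<integral>\<^sup>+ p. (if act (fst p) eta \<and> act (snd p) om then f (pt (fst p) eta, pt (snd p) om) else 0) \<partial>count_space UNIV)"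
    by (rule nn_integral_count_space_eq) auto
  finally show ?thesis .
qed

text \<open>Relabelling replaces the supports, which vary with the configurations, by the fixed
  countable set of pairs of numbers; entries and costs are carried over unchanged.\<close>

lemma index_plan_of_plan:
  assumes eta: "eta \<in> Gamma UNIV" and om: "om \<in> Gamma UNIV" and beta: "marginals beta eta om"
  shows "\<exists>b. rowsum b = (\<lambda>i. of_nat (wt eta i)) \<and> colsum b = (\<lambda>j. of_nat (wt om j)) \<and>
    plan_cost (dcost eta om) b = beta_cost beta"
proof -
  define b where "b p = (if act (fst p) eta \<and> act (snd p) om then beta (pt (fst p) eta, pt (snd p) om) else 0)" for p
  have z: "beta (x, y) = 0" if "eta x = 0 \<or> om y = 0" for x y
    using marginals_support[OF beta, of x y] that by (cases "beta (x, y) = 0") simp_all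
  have "rowsum b i = of_nat (wt eta i)" for i
  proof (cases "act i eta")
    case True
    have "rowsum b i = (\<integral>\<^sup>+ j. (if act j om then of_nat (beta (pt i eta, pt j om)) else 0) \<partial>count_space UNIV)"
      unfolding rowsum_def by (intro nn_integral_cong) (simp add: b_def True)
    also have "\<dots> = (\<integral>\<^sup>+ y. of_nat (beta (pt i eta, y)) \<partial>count_space UNIV)"
      by (rule nn_integral_act[OF om, symmetric]) (simp add: z)
    also have "\<dots> = of_nat (wt eta i)" using beta by (simp add: marginals_def wt_def True)
    finally show ?thesis .
  qed (simp add: rowsum_def b_def wt_def)
  moreover have "colsum b j = of_nat (wt om j)" for j
  proof (cases "act j om")
    case True
    have "colsum b j = (\<integral>\<^sup>+ i. (if act i eta then of_nat (beta (pt i eta, pt j om)) else 0) \<partial>count_space UNIV)"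
      unfolding colsum_def by (intro nn_integral_cong) (simp add: b_def True)
    also have "\<dots> = (\<integral>\<^sup>+ x. of_nat (beta (x, pt j om)) \<partial>count_space UNIV)"
      by (rule nn_integral_act[OF eta, symmetric]) (simp add: z)
    also have "\<dots> = of_nat (wt om j)" using beta by (simp add: marginals_def wt_def True)
    finally show ?thesis .
  qed (simp add: colsum_def b_def wt_def)
  moreover have "plan_cost (dcost eta om) b = beta_cost beta"
    unfolding beta_cost_def plan_cost_def
    by (subst nn_integral_act2[OF eta om]) (auto simp: z b_def dcost_def intro!: nn_integral_cong)
  ultimately show ?thesis by (intro exI[of _ b]) (simp add: fun_eq_iff)
qed

lemma plan_of_index_plan:
  assumes eta: "eta \<in> Gamma UNIV" and om: "om \<in> Gamma UNIV"
    and b: "rowsum b = (\<lambda>i. of_nat (wt eta i))" "colsum b = (\<lambda>j. of_nat (wt om j))"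
  shows "\<exists>beta. marginals beta eta om \<and> beta_cost beta = plan_cost (dcost eta om) b"
proof -
  define beta where "beta p = (if eta (fst p) \<noteq> 0 \<and> om (snd p) \<noteq> 0 then b (ix eta (fst p), ix om (snd p)) else 0)" for p
  have z: "beta (x, y) = 0" if "eta x = 0 \<or> om y = 0" for x y
    using that by (auto simp: beta_def)
  have bz: "b (i, j) = 0" if "\<not> act i eta \<or> \<not> act j om" for i j
    using le_rowsum[of b i j] le_colsum[of b i j] that
    by (auto simp: b wt_def split: if_splits)
  have bt: "beta (pt i eta, pt j om) = b (i, j)" if "act i eta" "act j om" for i j
    using that pt_act by (simp add: beta_def ix_pt[OF eta] ix_pt[OF om])
  have "rowsum beta x = of_nat (eta x)" for x
  proof (cases "eta x = 0")
    case False
    have x: "act (ix eta x) eta" "pt (ix eta x) eta = x" by (rule ix_act[OF eta False])+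
    have "rowsum beta x = (\<integral>\<^sup>+ j. (if act j om then of_nat (beta (x, pt j om)) else 0) \<partial>count_space UNIV)"
      unfolding rowsum_def by (rule nn_integral_act[OF om]) (simp add: z)
    also have "\<dots> = rowsum b (ix eta x)"
      unfolding rowsum_def using bt[OF x(1)] bz by (intro nn_integral_cong) (simp add: x)
    also have "\<dots> = of_nat (eta x)" by (simp add: b wt_def x)
    finally show ?thesis .
  qed (simp add: rowsum_def z)
  moreover have "colsum beta y = of_nat (om y)" for y
  proof (cases "om y = 0")
    case False
    have y: "act (ix om y) om" "pt (ix om y) om = y" by (rule ix_act[OF om False])+
    have "colsum beta y = (\<integral>\<^sup>+ i. (if act i eta then of_nat (beta (pt i eta, y)) else 0) \<partial>count_space UNIV)"
      unfolding colsum_def by (rule nn_integral_act[OF eta]) (simp add: z)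
    also have "\<dots> = colsum b (ix om y)"
      unfolding colsum_def using bt[OF _ y(1)] bz by (intro nn_integral_cong) (simp add: y)
    also have "\<dots> = of_nat (om y)" by (simp add: b wt_def y)
    finally show ?thesis .
  qed (simp add: colsum_def z)
  moreover have "beta_cost beta = plan_cost (dcost eta om) b"
    unfolding beta_cost_def plan_cost_def
    by (subst nn_integral_act2[OF eta om]) (auto simp: z bt bz dcost_def intro!: nn_integral_cong)
  ultimately show ?thesis by (intro exI[of _ beta]) (simp add: fun_eq_iff marginals_iff)
qed

text \<open>A budget \<open>a\<close> keeps the partners of \<open>x\<close> in the closed ball of
  radius \<open>sqrt (2 * a)\<close>, where a locally finite configuration has finitely many
  points.\<close>

lemma finite_near_active:
  assumes "om \<in> Gamma UNIV"
  shows "finite {j. wt om j \<noteq> 0 \<and> norm (x - pt j om)^2 / 2 \<le> a}"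
proof -
  let ?S = "{j. wt om j \<noteq> 0 \<and> norm (x - pt j om)^2 / 2 \<le> a}"
  have "(\<lambda>j. pt j om) ` ?S \<subseteq> {y \<in> cball x (sqrt (2 * a)). om y \<noteq> 0}"
  proof
    fix y assume "y \<in> (\<lambda>j. pt j om) ` ?S"
    then obtain j where j: "y = pt j om" "wt om j \<noteq> 0" "norm (x - pt j om)^2 / 2 \<le> a" by blast
    then have "pt j om \<in> cball x (sqrt (2 * a))"
      by (simp add: dist_norm real_le_rsqrt)
    moreover have "om (pt j om) \<noteq> 0" using j(2) by (simp add: wt_def split: if_splits)
    ultimately show "y \<in> {y \<in> cball x (sqrt (2 * a)). om y \<noteq> 0}" using j(1) by simp
  qed
  moreover have "finite {y \<in> cball x (sqrt (2 * a)). om y \<noteq> 0}"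
    by (rule Gamma_finite[OF assms]) simp
  ultimately have "finite ((\<lambda>j. pt j om) ` ?S)" by (rule finite_subset)
  moreover have "inj_on (\<lambda>j. pt j om) ?S"
    by (rule inj_onI) (auto simp: wt_def split: if_splits intro: act_inj)
  ultimately show ?thesis by (rule finite_imageD)
qed

text \<open>The right-hand side quantifies over countably many finite partial plans; multisets are represented by
  lists because lists form a countable type.\<close>

lemma cost_less_iff:
  assumes eta: "eta \<in> Gamma UNIV" and om: "om \<in> Gamma UNIV"
  shows "cost eta om < c \<longleftrightarrow> (\<exists>q::rat. 0 \<le> q \<and> ennreal (of_rat q) < c \<and>
    (\<forall>n. \<exists>xs. partial_plan n (wt eta) (wt om) (count (mset xs)) \<and> plan_cost (dcost eta om) (count (mset xs)) \<le> ennreal (of_rat q)))"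
    (is "_ \<longleftrightarrow> ?R")
proof
  assume "cost eta om < c"
  then obtain beta where beta: "marginals beta eta om" "beta_cost beta < c"
    by (auto simp: cost_def admissible_def INF_less_iff)
  \<comment> \<open>The rational budget leaves a gap below \<open>c\<close>, because a limit of
    partial plans within the budget \<open>q\<close> only satisfies the bound with
    \<open><=\<close>.\<close>
  obtain q :: rat where q: "0 \<le> q" "beta_cost beta \<le> ennreal (of_rat q)" "ennreal (of_rat q) < c"
  proof -
    obtain r where r: "beta_cost beta < r" "r < c" using beta(2) dense by blast
    from ennreal_rat_dense[OF r(1)] obtain q where "beta_cost beta < real_of_rat q" "real_of_rat q < r" by blast
    then show ?thesis using r(2) that[of q] by (cases "0 \<le> q") (auto simp: ennreal_neg intro: less_imp_le)
  qed
  obtain b where "rowsum b = (\<lambda>i. of_nat (wt eta i))" "colsum b = (\<lambda>j. of_nat (wt om j))"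
      "plan_cost (dcost eta om) b = beta_cost beta"
    using index_plan_of_plan[OF eta om beta(1)] by auto
  then show ?R using q by (intro exI[of _ q] conjI allI partial_plan_restrict[of b]) auto
next
  assume ?R
  then obtain q :: rat where q: "0 \<le> q" "ennreal (of_rat q) < c"
    and M: "\<And>n. \<exists>xs. partial_plan n (wt eta) (wt om) (count (mset xs)) \<and> plan_cost (dcost eta om) (count (mset xs)) \<le> ennreal (of_rat q)"
    by blast
  have "\<exists>b. rowsum b = (\<lambda>i. of_nat (wt eta i)) \<and> colsum b = (\<lambda>j. of_nat (wt om j)) \<and> plan_cost (dcost eta om) b \<le> ennreal (of_rat q)"
  proof (rule plan_compactness)
    show "finite {j. wt om j \<noteq> 0 \<and> dcost eta om (i, j) \<le> real_of_rat q}" for i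
      using finite_near_active[OF om, of "pt i eta"] by (simp add: dcost_def)
    show "finite {i. wt eta i \<noteq> 0 \<and> dcost eta om (i, j) \<le> real_of_rat q}" for j
      using finite_near_active[OF eta, of "pt j om"] by (simp add: dcost_def norm_minus_commute)
    show "\<exists>b. partial_plan n (wt eta) (wt om) b \<and> plan_cost (dcost eta om) b \<le> ennreal (of_rat q)" for n
      using M[of n] by blast
  qed (use q in simp)
  then obtain b where b: "rowsum b = (\<lambda>i. of_nat (wt eta i))" "colsum b = (\<lambda>j. of_nat (wt om j))"
    "plan_cost (dcost eta om) b \<le> ennreal (of_rat q)" by blast
  obtain beta where beta: "marginals beta eta om" "beta_cost beta = plan_cost (dcost eta om) b"
    using plan_of_index_plan[OF eta om b(1,2)] by blast
  have "beta \<in> admissible eta om"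
    using marginals_Gamma[OF beta(1) eta om] beta(1) by (simp add: admissible_def)
  then have "cost eta om \<le> beta_cost beta" unfolding cost_def by (rule INF_lower)
  also have "\<dots> < c" using beta(2) b(3) q(2) by simp
  finally show "cost eta om < c" .
qed

lemma measurable_wt [measurable]: "(\<lambda>eta. wt eta j) \<in> measurable (GammaM Y) (count_space UNIV)"
  unfolding measurable_count_space_eq2_countable
proof (intro conjI ballI)
  have [measurable]: "(\<lambda>eta. npts eta (bl j)) \<in> borel_measurable (GammaM Y)"
    by (intro measurable_npts bounded_bl borel_bl)
  fix k :: nat
  have iff: "wt eta j = k \<longleftrightarrow> (act j eta \<and> npts eta (bl j) = of_nat k) \<or> (\<not> act j eta \<and> k = 0)" for eta
    by (cases "act j eta") (auto simp: wt_def npts_bl_act)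
  have "(\<lambda>eta. wt eta j) -` {k} \<inter> space (GammaM Y) = {eta \<in> space (GammaM Y). wt eta j = k}"
    by auto
  also have "\<dots> = {eta \<in> space (GammaM Y). (act j eta \<and> npts eta (bl j) = of_nat k) \<or> (\<not> act j eta \<and> k = 0)}"
    by (simp only: iff)
  also have "\<dots> \<in> sets (GammaM Y)" by measurable
  finally show "(\<lambda>eta. wt eta j) -` {k} \<inter> space (GammaM Y) \<in> sets (GammaM Y)" .
qed auto

lemma plan_cost_multiset: "plan_cost C (count M) = (\<Sum>p\<in>set_mset M. of_nat (count M p) * ennreal (C p))"
proof -
  have "plan_cost C (count M) = (\<integral>\<^sup>+ p. (of_nat (count M p) * ennreal (C p)) * indicator (set_mset M) p \<partial>count_space UNIV)"
    unfolding plan_cost_def by (intro nn_integral_cong) (auto simp: indicator_def not_in_iff)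
  then show ?thesis by (simp add: nn_integral_indicator_finite)
qed

text \<open>By \<open>cost_less_iff\<close> a strict sublevel set is a countable combination of
  conditions on fixed finite plans, and for a fixed plan the marginal conditions and the cost
  involve only the measurable functions \<open>wt\<close> and \<open>pt\<close>.\<close>

lemma measurable_cost: 
  "(\<lambda>p. cost (fst p) (snd p)) \<in> borel_measurable (GammaM UNIV \<Otimes>\<^sub>M GammaM (UNIV :: 'a set))"
proof (rule borel_measurableI_less)
  fix c :: ennreal
  let ?M = "GammaM UNIV \<Otimes>\<^sub>M GammaM (UNIV :: 'a set)"
  have [measurable]: "(\<lambda>p. plan_cost (dcost (fst p) (snd p)) (count M)) \<in> borel_measurable ?M" for M
    unfolding plan_cost_multiset dcost_def by measurable
  have [measurable]: "Measurable.pred ?M (\<lambda>p. partial_plan n (wt (fst p)) (wt (snd p)) (count M))" for n M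
    unfolding partial_plan_def by measurable
  have "{p \<in> space ?M. cost (fst p) (snd p) < c} = {p \<in> space ?M. \<exists>q::rat. 0 \<le> q \<and> ennreal (of_rat q) < c \<and>
    (\<forall>n. \<exists>xs. partial_plan n (wt (fst p)) (wt (snd p)) (count (mset xs)) \<and> plan_cost (dcost (fst p) (snd p)) (count (mset xs)) \<le> ennreal (of_rat q))}"
    by (intro Collect_cong conj_cong refl cost_less_iff) (auto simp: space_pair_measure)
  also have "\<dots> \<in> sets ?M" by measurable
  finally show "{p \<in> space ?M. cost (fst p) (snd p) < c} \<in> sets ?M" .
qed

end

section \<open>Exchange argument for optimal couplings\<close>

text \<open>A label in {0, 1, 2} beside the point turns the sum of three weighted images into a
  single image of a single density.\<close>

lemma mixture_exists:
  fixes g :: "'p measure" and w0 w1 w2 :: "'p \<Rightarrow> ennreal"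
  assumes "prob_space g"
    and [measurable]: "f1 \<in> measurable g g" "f2 \<in> measurable g g"
      "w0 \<in> borel_measurable g" "w1 \<in> borel_measurable g" "w2 \<in> borel_measurable g"
  shows "\<exists>g'. sets g' = sets g \<and> (\<forall>h\<in>borel_measurable g.
    (\<integral>\<^sup>+ p. h p \<partial>g') = (\<integral>\<^sup>+ p. w0 p * h p + w1 p * h (f1 p) + w2 p * h (f2 p) \<partial>g))"
proof -
  interpret prob_space g by fact
  let ?N = "count_space {0, 1, 2::nat}"
  define W where "W = (\<lambda>(i::nat, p). if i = 0 then w0 p else if i = 1 then w1 p else w2 p)"
  define F where "F = (\<lambda>(i::nat, p). if i = 0 then p else if i = 1 then f1 p else f2 p)"
  have Wm[measurable]: "W \<in> borel_measurable (?N \<Otimes>\<^sub>M g)" unfolding W_def by measurable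
  have Fm[measurable]: "F \<in> measurable (?N \<Otimes>\<^sub>M g) g" unfolding F_def by measurable
  let ?g = "distr (density (?N \<Otimes>\<^sub>M g) W) g F"
  have "(\<integral>\<^sup>+ p. h p \<partial>?g) = (\<integral>\<^sup>+ p. w0 p * h p + w1 p * h (f1 p) + w2 p * h (f2 p) \<partial>g)"
    if hm[measurable]: "h \<in> borel_measurable g" for h :: "'p \<Rightarrow> ennreal"
  proof -
    have "(\<integral>\<^sup>+ p. h p \<partial>?g) = (\<integral>\<^sup>+ z. W z * h (F z) \<partial>(?N \<Otimes>\<^sub>M g))"
      by (subst nn_integral_distr, measurable, subst nn_integral_density, measurable)
    also have "\<dots> = (\<integral>\<^sup>+ i. \<integral>\<^sup>+ p. W (i, p) * h (F (i, p)) \<partial>g \<partial>?N)"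
      using nn_integral_fst[OF borel_measurable_times_ennreal[OF Wm measurable_compose[OF Fm hm]]] by simp
    also have "\<dots> = (\<integral>\<^sup>+ p. w0 p * h p \<partial>g) + (\<integral>\<^sup>+ p. w1 p * h (f1 p) \<partial>g) + (\<integral>\<^sup>+ p. w2 p * h (f2 p) \<partial>g)"
      by (subst nn_integral_count_space_finite) (simp_all add: W_def F_def add_ac)
    also have "\<dots> = (\<integral>\<^sup>+ p. w0 p * h p + w1 p * h (f1 p) + w2 p * h (f2 p) \<partial>g)"
      by (simp add: nn_integral_add)
    finally show ?thesis .
  qed
  then show ?thesis by (intro exI[of _ ?g]) auto
qed

lemma couplings_D:
  assumes "g \<in> couplings mu nu"
  shows "prob_space g" "sets g = sets (mu \<Otimes>\<^sub>M nu)" "distr g mu fst = mu" "distr g nu snd = nu"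
  using assms by (auto simp: couplings_def)

lemma coupling_fst:
  assumes "g \<in> couplings mu nu" and h: "h \<in> borel_measurable mu"
  shows "(\<integral>\<^sup>+ p. h (fst p) \<partial>g) = (\<integral>\<^sup>+ x. h x \<partial>mu)"
proof -
  have "fst \<in> measurable g mu" using couplings_D(2)[OF assms(1)] by (simp cong: measurable_cong_sets)
  then have "(\<integral>\<^sup>+ x. h x \<partial>distr g mu fst) = (\<integral>\<^sup>+ p. h (fst p) \<partial>g)"
    using h by (simp add: nn_integral_distr)
  then show ?thesis using couplings_D(3)[OF assms(1)] by simp
qed

lemma coupling_AE_fst:
  assumes "g \<in> couplings mu nu" "AE x in mu. P x"
  shows "AE p in g. P (fst p)"
proof -
  have "fst \<in> measurable g mu" using couplings_D(2)[OF assms(1)] by (simp cong: measurable_cong_sets)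
  moreover have "AE x in distr g mu fst. P x" unfolding couplings_D(3)[OF assms(1)] by (rule assms(2))
  ultimately show ?thesis by (rule AE_distrD)
qed

text \<open>The competitor moves half of the mass \<open>k\<close> over \<open>A\<close> along \<open>V\<close> and half of the mass \<open>l\<close> over \<open>B\<close> back along
  \<open>W = V\<^sup>-\<^sup>1\<close>; the balance condition makes its first marginal again \<open>mu\<close>.\<close>

lemma swap_not_improving:
  fixes mu nu :: "'b measure" and c :: "'b \<times> 'b \<Rightarrow> ennreal" and k l :: "'b \<Rightarrow> ennreal"
  assumes g: "g \<in> couplings mu nu"
    and c[measurable]: "c \<in> borel_measurable (mu \<Otimes>\<^sub>M nu)"
    and opt: "\<And>g'. g' \<in> couplings mu nu \<Longrightarrow> (\<integral>\<^sup>+ p. c p \<partial>g) \<le> (\<integral>\<^sup>+ p. c p \<partial>g')"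
    and fin: "(\<integral>\<^sup>+ p. c p \<partial>g) < \<infinity>"
    and V[measurable]: "V \<in> measurable mu mu" and W[measurable]: "W \<in> measurable mu mu"
    and WV: "\<And>x. x \<in> space mu \<Longrightarrow> W (V x) = x"
    and AB[measurable]: "A \<in> sets g" "B \<in> sets g"
    and kl[measurable]: "k \<in> borel_measurable mu" "l \<in> borel_measurable mu"
    and k1: "\<And>x. k x \<le> 1" and l1: "\<And>x. l x \<le> 1"
    and bal: "\<And>h. h \<in> borel_measurable mu \<Longrightarrow>
       (\<integral>\<^sup>+ p. k (fst p) * indicator A p * h (V (fst p)) \<partial>g) = (\<integral>\<^sup>+ p. l (fst p) * indicator B p * h (fst p) \<partial>g)"
    and inA: "AE p in g. p \<in> A \<longrightarrow> c (V (fst p), snd p) + ennreal u \<le> c p + ennreal u'"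
    and inB: "AE p in g. p \<in> B \<longrightarrow> c (W (fst p), snd p) + ennreal r \<le> c p + ennreal r'"
    and ur: "0 \<le> u" "0 \<le> u'" "0 \<le> r" "0 \<le> r'" "u' + r' < u + r"
  shows "(\<integral>\<^sup>+ p. k (fst p) * indicator A p \<partial>g) = 0"
proof (rule ccontr)
  assume pos: "(\<integral>\<^sup>+ p. k (fst p) * indicator A p \<partial>g) \<noteq> 0"
  interpret prob_space g using g by (rule couplings_D)
  note [measurable_cong] = couplings_D(2)[OF g]
  \<comment> \<open>\<open>A\<close> and \<open>B\<close> may overlap; halving both weights keeps
    their sum at most 1, so that \<open>w0\<close> can complement them to 1.\<close>
  define hf where "hf = ennreal (1/2)"
  have hf: "hf + hf = 1" "hf \<noteq> 0"
    unfolding hf_def by (subst ennreal_plus[symmetric]; simp) simp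
  define w1 where "w1 p = hf * (k (fst p) * indicator A p)" for p
  define w2 where "w2 p = hf * (l (fst p) * indicator B p)" for p
  define w0 where "w0 p = 1 - (w1 p + w2 p)" for p
  have [measurable]: "w1 \<in> borel_measurable g" "w2 \<in> borel_measurable g" "w0 \<in> borel_measurable g"
    unfolding w0_def w1_def w2_def by measurable
  have le1: "w1 p + w2 p \<le> 1" for p
  proof -
    have "w1 p \<le> hf * (1 * 1)" "w2 p \<le> hf * (1 * 1)"
      unfolding w1_def w2_def using k1[of "fst p"] l1[of "fst p"]
      by (intro mult_left_mono mult_mono; simp add: indicator_def)+
    then have "w1 p + w2 p \<le> hf + hf" by (intro add_mono) simp_all
    also have "\<dots> = 1" by (rule hf)
    finally show ?thesis .
  qed
  have w_sum: "w0 p + w1 p + w2 p = 1" for p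
    using le1[of p] by (simp add: w0_def add.assoc diff_add_cancel_ennreal)
  have fin1: "w1 p \<le> 1" "w2 p \<le> 1" for p
    using le1[of p] by (auto intro: order_trans[rotated])
  define f1 where "f1 p = (V (fst p), snd p)" for p :: "'b \<times> 'b"
  define f2 where "f2 p = (W (fst p), snd p)" for p :: "'b \<times> 'b"
  have [measurable]: "f1 \<in> measurable g g" "f2 \<in> measurable g g"
    unfolding f1_def f2_def by measurable
  obtain g' where g': "sets g' = sets g" and int: "\<And>h. h \<in> borel_measurable g \<Longrightarrow>
    (\<integral>\<^sup>+ p. h p \<partial>g') = (\<integral>\<^sup>+ p. w0 p * h p + w1 p * h (f1 p) + w2 p * h (f2 p) \<partial>g)"
    using mixture_exists[of g f1 f2 w0 w1 w2] prob_space_axioms by auto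
  have bal': "(\<integral>\<^sup>+ p. w1 p * h (V (fst p)) \<partial>g) = (\<integral>\<^sup>+ p. w2 p * h (fst p) \<partial>g)"
    if [measurable]: "h \<in> borel_measurable mu" for h
  proof -
    have "(\<integral>\<^sup>+ p. w1 p * h (V (fst p)) \<partial>g) = hf * (\<integral>\<^sup>+ p. k (fst p) * indicator A p * h (V (fst p)) \<partial>g)"
      unfolding w1_def by (subst nn_integral_cmult[symmetric]) (auto simp: mult.assoc)
    also have "\<dots> = hf * (\<integral>\<^sup>+ p. l (fst p) * indicator B p * h (fst p) \<partial>g)" by (simp add: bal)
    also have "\<dots> = (\<integral>\<^sup>+ p. w2 p * h (fst p) \<partial>g)"
      unfolding w2_def by (subst nn_integral_cmult[symmetric]) (auto simp: mult.assoc)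
    finally show ?thesis .
  qed
  have sp: "p \<in> space g \<Longrightarrow> fst p \<in> space mu" for p
    using sets_eq_imp_space_eq[OF couplings_D(2)[OF g]] by (auto simp: space_pair_measure)
  \<comment> \<open>The balance tested with \<open>h \<circ> W\<close>: what is taken away over
    \<open>A\<close> is restored by the mass moved back from \<open>B\<close>.\<close>
  have bal'': "(\<integral>\<^sup>+ p. w1 p * h (fst p) \<partial>g) = (\<integral>\<^sup>+ p. w2 p * h (W (fst p)) \<partial>g)"
    if [measurable]: "h \<in> borel_measurable mu" for h
  proof -
    have "(\<integral>\<^sup>+ p. w1 p * h (fst p) \<partial>g) = (\<integral>\<^sup>+ p. w1 p * h (W (V (fst p))) \<partial>g)"
      by (intro nn_integral_cong) (simp add: WV sp)
    also have "\<dots> = (\<integral>\<^sup>+ p. w2 p * h (W (fst p)) \<partial>g)" by (rule bal') measurable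
    finally show ?thesis .
  qed
  have "g' \<in> couplings mu nu"
    unfolding couplings_def mem_Collect_eq
  proof (intro conjI)
    have "emeasure g' (space g') = (\<integral>\<^sup>+ p. 1 \<partial>g')" by simp
    also have "\<dots> = (\<integral>\<^sup>+ p. 1 \<partial>g)" by (subst int) (auto simp: w_sum)
    finally show "prob_space g'" by (intro prob_spaceI) (simp add: emeasure_space_1)
    show s: "sets g' = sets (mu \<Otimes>\<^sub>M nu)" using g' couplings_D(2)[OF g] by simp
    show "distr g' mu fst = mu"
    proof (rule measure_eqI)
      fix F assume "F \<in> sets (distr g' mu fst)"
      then have [measurable]: "F \<in> sets mu" by simp
      have m: "fst \<in> measurable g' mu" using s by (simp cong: measurable_cong_sets)
      have "emeasure (distr g' mu fst) F = (\<integral>\<^sup>+ x. indicator F x \<partial>distr g' mu fst)" by simp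
      also have "\<dots> = (\<integral>\<^sup>+ p. indicator F (fst p) \<partial>g')" using m by (subst nn_integral_distr) auto
      also have "\<dots> = (\<integral>\<^sup>+ p. w0 p * indicator F (fst p) + w1 p * indicator F (V (fst p)) + w2 p * indicator F (W (fst p)) \<partial>g)"
        by (subst int) (auto simp: f1_def f2_def)
      also have "\<dots> = (\<integral>\<^sup>+ p. w0 p * indicator F (fst p) \<partial>g) + (\<integral>\<^sup>+ p. w1 p * indicator F (V (fst p)) \<partial>g)
          + (\<integral>\<^sup>+ p. w2 p * indicator F (W (fst p)) \<partial>g)"
        by (simp add: nn_integral_add)
      also have "\<dots> = (\<integral>\<^sup>+ p. w0 p * indicator F (fst p) \<partial>g) + (\<integral>\<^sup>+ p. w2 p * indicator F (fst p) \<partial>g)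
          + (\<integral>\<^sup>+ p. w1 p * indicator F (fst p) \<partial>g)"
        using bal'[of "indicator F"] bal''[of "indicator F"] by simp
      also have "\<dots> = (\<integral>\<^sup>+ p. w0 p * indicator F (fst p) + w2 p * indicator F (fst p) + w1 p * indicator F (fst p) \<partial>g)"
        by (simp add: nn_integral_add)
      also have "\<dots> = (\<integral>\<^sup>+ p. indicator F (fst p) \<partial>g)"
      proof (intro nn_integral_cong)
        fix p
        have "w0 p * indicator F (fst p) + w2 p * indicator F (fst p) + w1 p * indicator F (fst p)
          = (w0 p + w1 p + w2 p) * indicator F (fst p)" by (simp only: distrib_right add_ac)
        then show "w0 p * indicator F (fst p) + w2 p * indicator F (fst p) + w1 p * indicator F (fst p) = indicator F (fst p)"
          by (simp add: w_sum)
      qed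
      also have "\<dots> = emeasure mu F" using coupling_fst[OF g, of "indicator F"] by simp
      finally show "emeasure (distr g' mu fst) F = emeasure mu F" .
    qed simp
    show "distr g' nu snd = nu"
    proof (rule measure_eqI)
      fix F assume "F \<in> sets (distr g' nu snd)"
      then have [measurable]: "F \<in> sets nu" by simp
      have m: "snd \<in> measurable g' nu" "snd \<in> measurable g nu" using s g' by (simp_all cong: measurable_cong_sets)
      have "emeasure (distr g' nu snd) F = (\<integral>\<^sup>+ x. indicator F x \<partial>distr g' nu snd)" by simp
      also have "\<dots> = (\<integral>\<^sup>+ p. indicator F (snd p) \<partial>g')" using m by (subst nn_integral_distr) auto
      also have "\<dots> = (\<integral>\<^sup>+ p. w0 p * indicator F (snd p) + w1 p * indicator F (snd p) + w2 p * indicator F (snd p) \<partial>g)"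
        by (subst int) (auto simp: f1_def f2_def)
      also have "\<dots> = (\<integral>\<^sup>+ p. indicator F (snd p) \<partial>g)" by (simp add: w_sum flip: distrib_right)
      also have "\<dots> = (\<integral>\<^sup>+ x. indicator F x \<partial>distr g nu snd)" using m by (subst nn_integral_distr) auto
      finally show "emeasure (distr g' nu snd) F = emeasure nu F" using couplings_D(4)[OF g] by simp
    qed simp
  qed
  then have le: "(\<integral>\<^sup>+ p. c p \<partial>g) \<le> (\<integral>\<^sup>+ p. c p \<partial>g')" by (rule opt)
  \<comment> \<open>The common mass of the two moved portions. It is finite and positive, so it can
    be cancelled at the end; until then the gains \<open>u\<close> and \<open>r\<close> are kept on
    the side of the competitor, which avoids subtraction in \<open>ennreal\<close>.\<close>
  define m where "m = (\<integral>\<^sup>+ p. w1 p \<partial>g)"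
  have m2: "m = (\<integral>\<^sup>+ p. w2 p \<partial>g)" using bal'[of "\<lambda>_. 1"] by (simp add: m_def)
  have mfin: "m \<le> 1" unfolding m_def
    using nn_integral_mono[of g w1 "\<lambda>_. 1"] fin1 by (simp add: emeasure_space_1)
  have m0: "m \<noteq> 0" using pos unfolding m_def w1_def by (subst nn_integral_cmult) (auto simp: hf)
  have cg[measurable]: "c \<in> borel_measurable g"
    using c couplings_D(2)[OF g] by (simp cong: measurable_cong_sets)
  have [measurable]: "(\<lambda>p. c (f1 p)) \<in> borel_measurable g" "(\<lambda>p. c (f2 p)) \<in> borel_measurable g"
    by (rule measurable_compose[OF _ cg], fact)+
  have "(\<integral>\<^sup>+ p. c p \<partial>g') + (m * ennreal u + m * ennreal r) =
      (\<integral>\<^sup>+ p. w0 p * c p + w1 p * c (f1 p) + w2 p * c (f2 p) \<partial>g) + ((\<integral>\<^sup>+ p. w1 p * ennreal u \<partial>g) + (\<integral>\<^sup>+ p. w2 p * ennreal r \<partial>g))"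
    by (simp add: int nn_integral_multc m_def[symmetric] m2[symmetric])
  also have "\<dots> = (\<integral>\<^sup>+ p. w0 p * c p + w1 p * (c (f1 p) + ennreal u) + w2 p * (c (f2 p) + ennreal r) \<partial>g)"
    by (subst nn_integral_add[symmetric], measurable)+ (auto intro!: nn_integral_cong simp: distrib_left add_ac)
  also have "\<dots> \<le> (\<integral>\<^sup>+ p. w0 p * c p + w1 p * (c p + ennreal u') + w2 p * (c p + ennreal r') \<partial>g)"
  proof (rule nn_integral_mono_AE)
    show "AE p in g. w0 p * c p + w1 p * (c (f1 p) + ennreal u) + w2 p * (c (f2 p) + ennreal r)
      \<le> w0 p * c p + w1 p * (c p + ennreal u') + w2 p * (c p + ennreal r')"
      using inA inB
    proof eventually_elim
      case (elim p)
      have "w1 p * (c (f1 p) + ennreal u) \<le> w1 p * (c p + ennreal u')"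
        using elim by (cases "p \<in> A") (auto simp: f1_def w1_def intro!: mult_left_mono)
      moreover have "w2 p * (c (f2 p) + ennreal r) \<le> w2 p * (c p + ennreal r')"
        using elim by (cases "p \<in> B") (auto simp: f2_def w2_def intro!: mult_left_mono)
      ultimately show ?case by (intro add_mono order_refl)
    qed
  qed
  also have "\<dots> = (\<integral>\<^sup>+ p. c p + (w1 p * ennreal u' + w2 p * ennreal r') \<partial>g)"
  proof (intro nn_integral_cong)
    fix p
    have "w0 p * c p + w1 p * (c p + ennreal u') + w2 p * (c p + ennreal r') =
      (w0 p + w1 p + w2 p) * c p + (w1 p * ennreal u' + w2 p * ennreal r')"
      by (simp only: distrib_right distrib_left add_ac)
    then show "w0 p * c p + w1 p * (c p + ennreal u') + w2 p * (c p + ennreal r') = c p + (w1 p * ennreal u' + w2 p * ennreal r')"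
      by (simp add: w_sum)
  qed
  also have "\<dots> = (\<integral>\<^sup>+ p. c p \<partial>g) + (m * ennreal u' + m * ennreal r')"
    by (simp add: nn_integral_add nn_integral_multc m_def[symmetric] m2[symmetric])
  finally have "(\<integral>\<^sup>+ p. c p \<partial>g') + (m * ennreal u + m * ennreal r) \<le> (\<integral>\<^sup>+ p. c p \<partial>g) + (m * ennreal u' + m * ennreal r')" .
  then have "(\<integral>\<^sup>+ p. c p \<partial>g) + (m * ennreal u + m * ennreal r) \<le> (\<integral>\<^sup>+ p. c p \<partial>g) + (m * ennreal u' + m * ennreal r')"
    using add_right_mono[OF le, of "m * ennreal u + m * ennreal r"] by (rule order_trans[rotated])
  then have "m * ennreal u + m * ennreal r \<le> m * ennreal u' + m * ennreal r'"
    using fin by (auto simp: ennreal_add_left_cancel_le)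
  then have "m * ennreal (u + r) \<le> m * ennreal (u' + r')"
    using ur by (simp add: distrib_left ennreal_plus)
  moreover obtain mr where mr: "m = ennreal mr" "mr > 0"
    using mfin m0 by (cases m) (auto simp: less_le top_unique)
  ultimately have "ennreal mr * ennreal (u + r) \<le> ennreal mr * ennreal (u' + r')" by (simp only:)
  moreover have "ennreal mr * ennreal (u + r) = ennreal (mr * (u + r))"
    "ennreal mr * ennreal (u' + r') = ennreal (mr * (u' + r'))"
    using mr ur by (intro ennreal_mult[symmetric]; simp)+
  ultimately have "ennreal (mr * (u + r)) \<le> ennreal (mr * (u' + r'))" by (simp only:)
  then have "mr * (u + r) \<le> mr * (u' + r')"
    using mr ur by (subst (asm) ennreal_le_iff) auto
  then show False using mr ur by simp
qed

text \<open>The part of \<open>g\<close> over \<open>A\<close> has a first marginal dominated by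
  \<open>mu\<close>. Its density \<open>f\<close> is the conditional probability of \<open>A\<close>
  given the first coordinate, and \<open>f x \<noteq> 0\<close> is the precise form of
  "\<open>A\<close> is charged over \<open>x\<close>".\<close>

lemma marginal_density:
  assumes g: "g \<in> couplings mu nu" and mu: "prob_space mu" and A[measurable]: "A \<in> sets g"
  shows "\<exists>f\<in>borel_measurable mu. \<forall>h\<in>borel_measurable mu.
    (\<integral>\<^sup>+ p. indicator A p * h (fst p) \<partial>g) = (\<integral>\<^sup>+ x. f x * h x \<partial>mu)"
proof -
  interpret mu: prob_space mu by fact
  note [measurable_cong] = couplings_D(2)[OF g]
  have fm: "fst \<in> measurable g mu" by measurable
  let ?N = "distr (density g (indicator A)) mu fst"
  have fm': "fst \<in> measurable (density g (indicator A)) mu" using fm by simp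
  have N: "(\<integral>\<^sup>+ x. h x \<partial>?N) = (\<integral>\<^sup>+ p. indicator A p * h (fst p) \<partial>g)" if [measurable]: "h \<in> borel_measurable mu" for h :: "'a \<Rightarrow> ennreal"
    using fm by (simp add: nn_integral_distr[OF fm'] nn_integral_density)
  have "absolutely_continuous mu ?N"
    unfolding absolutely_continuous_def
  proof
    fix F assume F: "F \<in> null_sets mu"
    then have [measurable]: "F \<in> sets mu" by auto
    have "emeasure ?N F = (\<integral>\<^sup>+ x. indicator F x \<partial>?N)" by simp
    also have "\<dots> = (\<integral>\<^sup>+ p. indicator A p * indicator F (fst p) \<partial>g)" by (rule N) simp
    also have "\<dots> \<le> (\<integral>\<^sup>+ p. indicator F (fst p) \<partial>g)" by (intro nn_integral_mono) (simp add: indicator_def)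
    also have "\<dots> = emeasure mu F" using coupling_fst[OF g, of "indicator F"] by simp
    also have "\<dots> = 0" using F by auto
    finally show "F \<in> null_sets ?N" by (auto simp: null_sets_def)
  qed
  then obtain f where f[measurable]: "f \<in> borel_measurable mu" and fN: "density mu f = ?N"
    using mu.Radon_Nikodym[of ?N] by auto
  show ?thesis
  proof (intro bexI[OF _ f] ballI)
    fix h :: "'a \<Rightarrow> ennreal" assume h[measurable]: "h \<in> borel_measurable mu"
    show "(\<integral>\<^sup>+ p. indicator A p * h (fst p) \<partial>g) = (\<integral>\<^sup>+ x. f x * h x \<partial>mu)"
      unfolding N[OF h, symmetric] fN[symmetric] by (simp add: nn_integral_density)
  qed
qed

section \<open>Densities shifted by a quasi-invariant map\<close>

lemma quasi_invariant_null_iff: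
  "quasi_invariant mu f \<Longrightarrow> A \<in> sets mu \<Longrightarrow> emeasure mu (f -` A \<inter> space mu) = 0 \<longleftrightarrow> emeasure mu A = 0"
  unfolding quasi_invariant_def by blast

text \<open>Quasi-invariance enters here in the form of absolute continuity: \<open>W\<close> pulls
  null sets back to null sets.\<close>

lemma pushforward_density:
  fixes mu :: "'b measure" and f :: "'b \<Rightarrow> ennreal"
  assumes mu: "prob_space mu" and [measurable]: "f \<in> borel_measurable mu" and W[measurable]: "W \<in> measurable mu mu"
    and qi: "quasi_invariant mu W"
  shows "\<exists>s\<in>borel_measurable mu. \<forall>h\<in>borel_measurable mu.
    (\<integral>\<^sup>+ x. f x * h (W x) \<partial>mu) = (\<integral>\<^sup>+ x. s x * h x \<partial>mu)"
proof -
  interpret mu: prob_space mu by fact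
  let ?N = "distr (density mu f) mu W"
  have W': "W \<in> measurable (density mu f) mu" using W by simp
  have N: "(\<integral>\<^sup>+ x. h x \<partial>?N) = (\<integral>\<^sup>+ x. f x * h (W x) \<partial>mu)" if [measurable]: "h \<in> borel_measurable mu" for h :: "'b \<Rightarrow> ennreal"
    by (simp add: nn_integral_distr[OF W'] nn_integral_density)
  have "absolutely_continuous mu ?N"
    unfolding absolutely_continuous_def
  proof
    fix F assume F: "F \<in> null_sets mu"
    then have [measurable]: "F \<in> sets mu" by auto
    have z: "emeasure mu (W -` F \<inter> space mu) = 0" using quasi_invariant_null_iff[OF qi, of F] F by (simp add: null_sets_def)
    have "emeasure ?N F = (\<integral>\<^sup>+ x. indicator F x \<partial>?N)" by simp
    also have "\<dots> = (\<integral>\<^sup>+ x. f x * indicator F (W x) \<partial>mu)" by (rule N) simp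
    also have "\<dots> = (\<integral>\<^sup>+ x. 0 \<partial>mu)"
    proof (intro nn_integral_cong_AE AE_I[where N="W -` F \<inter> space mu"])
      show "{x \<in> space mu. f x * indicator F (W x) \<noteq> 0} \<subseteq> W -` F \<inter> space mu" by (auto simp: indicator_def)
    qed (use z in auto)
    finally show "F \<in> null_sets ?N" by (auto simp: null_sets_def)
  qed
  then obtain s where s[measurable]: "s \<in> borel_measurable mu" and sN: "density mu s = ?N"
    using mu.Radon_Nikodym[of ?N] by auto
  show ?thesis
  proof (intro bexI[OF _ s] ballI)
    fix h :: "'b \<Rightarrow> ennreal" assume h[measurable]: "h \<in> borel_measurable mu"
    show "(\<integral>\<^sup>+ x. f x * h (W x) \<partial>mu) = (\<integral>\<^sup>+ x. s x * h x \<partial>mu)"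
      unfolding N[OF h, symmetric] sN[symmetric] by (simp add: nn_integral_density)
  qed
qed

lemma ennreal_divide_le_1:
  fixes m x :: ennreal
  assumes "m \<le> x" shows "m / x \<le> 1"
proof -
  have "m / x \<le> x / x" using assms by (rule divide_right_mono_ennreal)
  also have "x / x \<le> 1"
  proof (cases "x = 0 \<or> x = \<top>")
    case True
    then show ?thesis by (auto simp: divide_ennreal_def)
  next
    case False
    then have "x / x = 1" by (intro ennreal_divide_self) (auto simp: less_top)
    then show ?thesis by simp
  qed
  finally show ?thesis .
qed

lemma ennreal_mult_divide_cancel_le:
  fixes m x :: ennreal
  assumes "x \<noteq> \<infinity>" "m \<le> x" shows "x * (m / x) = m"
proof (cases "x = 0")
  case False
  have "x * (m / x) = m * x / x" by (simp add: ennreal_times_divide mult.commute[of x])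
  also have "\<dots> = m" using assms False by (intro ennreal_mult_divide_eq) (auto simp: less_top)
  finally show ?thesis .
qed (use assms in auto)

text \<open>Let \<open>s\<close> be the density of the image under \<open>W\<close> of the mass
  \<open>fB\<close>. The minimum of \<open>fA\<close> and \<open>s\<close> is the mass that can be
  exchanged between \<open>x\<close> and \<open>V x\<close>; an exchange would lower the cost, so
  the minimum vanishes almost everywhere.\<close>

lemma shifted_densities_disjoint:
  fixes mu nu :: "'b measure" and c :: "'b \<times> 'b \<Rightarrow> ennreal" and fA fB :: "'b \<Rightarrow> ennreal"
  assumes g: "g \<in> couplings mu nu" and mu: "prob_space mu"
    and c[measurable]: "c \<in> borel_measurable (mu \<Otimes>\<^sub>M nu)"
    and opt: "\<And>g'. g' \<in> couplings mu nu \<Longrightarrow> (\<integral>\<^sup>+ p. c p \<partial>g) \<le> (\<integral>\<^sup>+ p. c p \<partial>g')"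
    and fin: "(\<integral>\<^sup>+ p. c p \<partial>g) < \<infinity>"
    and V[measurable]: "V \<in> measurable mu mu" and W[measurable]: "W \<in> measurable mu mu"
    and WV: "\<And>x. x \<in> space mu \<Longrightarrow> W (V x) = x" and VW: "\<And>x. x \<in> space mu \<Longrightarrow> V (W x) = x"
    and qi: "quasi_invariant mu W"
    and AB[measurable]: "A \<in> sets g" "B \<in> sets g"
    and fA[measurable]: "fA \<in> borel_measurable mu" and fB[measurable]: "fB \<in> borel_measurable mu"
    and dA: "\<And>h. h \<in> borel_measurable mu \<Longrightarrow> (\<integral>\<^sup>+ p. indicator A p * h (fst p) \<partial>g) = (\<integral>\<^sup>+ x. fA x * h x \<partial>mu)"
    and dB: "\<And>h. h \<in> borel_measurable mu \<Longrightarrow> (\<integral>\<^sup>+ p. indicator B p * h (fst p) \<partial>g) = (\<integral>\<^sup>+ x. fB x * h x \<partial>mu)"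
    and inA: "AE p in g. p \<in> A \<longrightarrow> c (V (fst p), snd p) + ennreal u \<le> c p + ennreal u'"
    and inB: "AE p in g. p \<in> B \<longrightarrow> c (W (fst p), snd p) + ennreal r \<le> c p + ennreal r'"
    and ur: "0 \<le> u" "0 \<le> u'" "0 \<le> r" "0 \<le> r'" "u' + r' < u + r"
  shows "AE x in mu. fA x = 0 \<or> fB (V x) = 0"
proof -
  interpret g: prob_space g using g by (rule couplings_D)
  note [measurable_cong] = couplings_D(2)[OF g]
  obtain s where s[measurable]: "s \<in> borel_measurable mu"
    and ds: "\<And>h. h \<in> borel_measurable mu \<Longrightarrow> (\<integral>\<^sup>+ x. fB x * h (W x) \<partial>mu) = (\<integral>\<^sup>+ x. s x * h x \<partial>mu)"
    using pushforward_density[OF mu fB W qi] by auto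
  have "(\<integral>\<^sup>+ x. fA x \<partial>mu) \<le> 1"
  proof -
    have "(\<integral>\<^sup>+ x. fA x \<partial>mu) = (\<integral>\<^sup>+ p. indicator A p \<partial>g)" using dA[of "\<lambda>_. 1"] by simp
    then show ?thesis using g.emeasure_le_1[of A] by simp
  qed
  then have "(\<integral>\<^sup>+ x. fA x \<partial>mu) \<noteq> \<infinity>" by (auto simp: top_unique)
  then have finA: "AE x in mu. fA x \<noteq> \<infinity>" by (intro nn_integral_PInf_AE) auto
  have "(\<integral>\<^sup>+ x. s x \<partial>mu) \<le> 1"
  proof -
    have "(\<integral>\<^sup>+ x. s x \<partial>mu) = (\<integral>\<^sup>+ x. fB x \<partial>mu)" using ds[of "\<lambda>_. 1"] by simp
    also have "\<dots> = (\<integral>\<^sup>+ p. indicator B p \<partial>g)" using dB[of "\<lambda>_. 1"] by simp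
    finally show ?thesis using g.emeasure_le_1[of B] by simp
  qed
  then have "(\<integral>\<^sup>+ x. s x \<partial>mu) \<noteq> \<infinity>" by (auto simp: top_unique)
  then have fins: "AE x in mu. s x \<noteq> \<infinity>" by (intro nn_integral_PInf_AE) auto
  \<comment> \<open>The first weight cuts \<open>fA\<close> down to the minimum. The second acts at
    the points \<open>V x\<close>, so it is evaluated after going back by \<open>W\<close>.\<close>
  define k where "k x = min (fA x) (s x) / fA x" for x
  define l where "l x = min (fA (W x)) (s (W x)) / s (W x)" for x
  have [measurable]: "k \<in> borel_measurable mu" "l \<in> borel_measurable mu" unfolding k_def l_def by measurable
  have kA: "(\<integral>\<^sup>+ p. k (fst p) * indicator A p * h (fst p) \<partial>g) = (\<integral>\<^sup>+ x. min (fA x) (s x) * h x \<partial>mu)"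
    if [measurable]: "h \<in> borel_measurable mu" for h
  proof -
    have "(\<integral>\<^sup>+ p. k (fst p) * indicator A p * h (fst p) \<partial>g) = (\<integral>\<^sup>+ p. indicator A p * (k (fst p) * h (fst p)) \<partial>g)"
      by (simp add: mult_ac)
    also have "\<dots> = (\<integral>\<^sup>+ x. fA x * (k x * h x) \<partial>mu)" by (rule dA) measurable
    also have "\<dots> = (\<integral>\<^sup>+ x. min (fA x) (s x) * h x \<partial>mu)"
      using finA by (intro nn_integral_cong_AE, eventually_elim) (simp add: k_def ennreal_mult_divide_cancel_le flip: mult.assoc)
    finally show ?thesis .
  qed
  have lB: "(\<integral>\<^sup>+ p. l (fst p) * indicator B p * h (fst p) \<partial>g) = (\<integral>\<^sup>+ x. min (fA x) (s x) * h (V x) \<partial>mu)"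
    if [measurable]: "h \<in> borel_measurable mu" for h
  proof -
    have "(\<integral>\<^sup>+ p. l (fst p) * indicator B p * h (fst p) \<partial>g) = (\<integral>\<^sup>+ p. indicator B p * (l (fst p) * h (fst p)) \<partial>g)"
      by (simp add: mult_ac)
    also have "\<dots> = (\<integral>\<^sup>+ x. fB x * (l x * h x) \<partial>mu)" by (rule dB) measurable
    also have "\<dots> = (\<integral>\<^sup>+ x. fB x * (\<lambda>x. (min (fA x) (s x) / s x) * h (V x)) (W x) \<partial>mu)"
      by (intro nn_integral_cong) (simp add: l_def VW)
    also have "\<dots> = (\<integral>\<^sup>+ x. s x * ((min (fA x) (s x) / s x) * h (V x)) \<partial>mu)" by (rule ds) measurable
    also have "\<dots> = (\<integral>\<^sup>+ x. min (fA x) (s x) * h (V x) \<partial>mu)"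
      using fins by (intro nn_integral_cong_AE, eventually_elim) (simp add: ennreal_mult_divide_cancel_le flip: mult.assoc)
    finally show ?thesis .
  qed
  have "(\<integral>\<^sup>+ p. k (fst p) * indicator A p \<partial>g) = 0"
  proof (rule swap_not_improving[OF g c opt fin V W WV AB])
    show "(\<integral>\<^sup>+ p. k (fst p) * indicator A p * h (V (fst p)) \<partial>g) = (\<integral>\<^sup>+ p. l (fst p) * indicator B p * h (fst p) \<partial>g)"
      if [measurable]: "h \<in> borel_measurable mu" for h
      using kA[of "\<lambda>x. h (V x)"] lB[of h] by simp
    show "k x \<le> 1" "l x \<le> 1" for x by (simp_all add: k_def l_def ennreal_divide_le_1)
  qed (use inA inB ur in auto)
  then have "(\<integral>\<^sup>+ x. min (fA x) (s x) \<partial>mu) = 0" using kA[of "\<lambda>_. 1"] by simp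
  then have 1: "AE x in mu. fA x = 0 \<or> s x = 0"
    by (subst (asm) nn_integral_0_iff_AE) (auto simp: min_def split: if_splits elim!: AE_mp)
  \<comment> \<open>Passing from \<open>s\<close> to \<open>fB\<close>: wherever \<open>W\<close>
    lands in \<open>Z\<close> the density \<open>fB\<close> is nonzero, while the image of the mass
    \<open>fB\<close> does not charge \<open>Z\<close>; hence \<open>Z\<close> is null by
    quasi-invariance.\<close>
  define Z where "Z = {x \<in> space mu. s x = 0 \<and> fB (V x) \<noteq> 0}"
  have [measurable]: "Z \<in> sets mu" unfolding Z_def by measurable
  have "(\<integral>\<^sup>+ x. fB x * indicator Z (W x) \<partial>mu) = (\<integral>\<^sup>+ x. s x * indicator Z x \<partial>mu)" by (rule ds) measurable
  also have "\<dots> = (\<integral>\<^sup>+ x. 0 \<partial>mu)" by (intro nn_integral_cong) (simp add: Z_def indicator_def)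
  finally have "AE x in mu. fB x * indicator Z (W x) = 0"
    by (simp add: nn_integral_0_iff_AE)
  then have "AE x in mu. W x \<notin> Z"
  proof (rule AE_mp, intro AE_I2 impI notI)
    fix x assume "x \<in> space mu" "fB x * indicator Z (W x) = 0" "W x \<in> Z"
    then show False by (simp add: Z_def VW)
  qed
  then have "emeasure mu {x \<in> space mu. W x \<in> Z} = 0" by (subst (asm) AE_iff_measurable[OF _ refl]) auto
  then have "emeasure mu (W -` Z \<inter> space mu) = 0" by (simp add: vimage_def Int_def conj_commute)
  then have "emeasure mu Z = 0" using quasi_invariant_null_iff[OF qi, of Z] by simp
  then have "AE x in mu. x \<notin> Z" by (intro AE_not_in) auto
  with 1 show ?thesis
    by (rule AE_mp[OF AE_conjI]) (auto simp: Z_def)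
qed

text \<open>A Poincare recurrence without an invariant measure: the preimages of \<open>E\<close>
  have positive measure but no common lower bound, so a sequence of times gives no contradiction. An
  uncountable family of pairwise almost disjoint sets of positive measure does.\<close>

lemma quasi_invariant_recurrence:
  fixes mu :: "'b measure" and V :: "real \<Rightarrow> 'b \<Rightarrow> 'b"
  assumes mu: "prob_space mu"
    and V[measurable]: "\<And>t. V t \<in> measurable mu mu"
    and add: "\<And>s t x. x \<in> space mu \<Longrightarrow> V s (V t x) = V (s + t) x"
    and qi: "\<And>t. quasi_invariant mu (V t)"
    and E[measurable]: "E \<in> sets mu" and pos: "emeasure mu E \<noteq> 0" and "0 < d"
  shows "\<exists>t. 0 < t \<and> t < d \<and> emeasure mu {x \<in> E. V t x \<in> E} \<noteq> 0"
proof (rule ccontr)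
  interpret prob_space mu by fact
  assume "\<not> ?thesis"
  then have null: "emeasure mu {x \<in> E. V t x \<in> E} = 0" if "0 < t" "t < d" for t using that by blast
  define F where "F s = V s -` E \<inter> space mu" for s
  have [measurable]: "F s \<in> sets mu" for s unfolding F_def by measurable
  have Fpos: "emeasure mu (F s) \<noteq> 0" for s
    using quasi_invariant_null_iff[OF qi E, of s] pos by (simp add: F_def)
  have disj: "AE x in mu. \<not> (x \<in> F s \<and> x \<in> F s')" if "0 < s" "s < s'" "s' < d" for s s'
  proof -
    \<comment> \<open>Common points of \<open>F s\<close> and \<open>F s'\<close> are carried by
      \<open>V s\<close> to points of \<open>E\<close> that return to \<open>E\<close> after time
      \<open>s' - s\<close>.\<close>
    let ?G = "{x \<in> E. V (s' - s) x \<in> E}"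
    have "?G = E \<inter> (V (s' - s) -` E \<inter> space mu)" using sets.sets_into_space[OF E] by auto
    then have G: "?G \<in> sets mu" by simp
    have "emeasure mu ?G = 0" using that by (intro null) auto
    then have "emeasure mu (V s -` ?G \<inter> space mu) = 0" using quasi_invariant_null_iff[OF qi G, of s] by simp
    moreover have "V s -` ?G \<inter> space mu \<in> sets mu" using G by measurable
    ultimately have "AE x in mu. x \<notin> V s -` ?G \<inter> space mu" by (intro AE_not_in) auto
    then show ?thesis by (rule AE_mp) (auto simp: F_def add)
  qed
  have sum_le: "(\<Sum>s\<in>S. emeasure mu (F s)) \<le> 1" if "finite S" "S \<subseteq> {0<..<d}" for S
  proof -
    have ae: "AE x in mu. \<forall>s\<in>S. \<forall>s'\<in>S. s < s' \<longrightarrow> \<not> (x \<in> F s \<and> x \<in> F s')"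
      using that disj by (intro AE_finite_allI) (auto simp: subset_eq)
    have "(\<integral>\<^sup>+ x. (\<Sum>s\<in>S. indicator (F s) x) \<partial>mu) \<le> (\<integral>\<^sup>+ x. 1 \<partial>mu)"
    proof (rule nn_integral_mono_AE, rule AE_mp[OF ae], intro AE_I2 impI)
      fix x assume elim: "\<forall>s\<in>S. \<forall>s'\<in>S. s < s' \<longrightarrow> \<not> (x \<in> F s \<and> x \<in> F s')"
      show "(\<Sum>s\<in>S. indicator (F s) x) \<le> (1::ennreal)"
      proof (cases "\<exists>s\<in>S. x \<in> F s")
        case True
        then obtain s where s: "s \<in> S" "x \<in> F s" by blast
        have "indicator (F s') x = (if s' = s then 1 else (0::ennreal))" if "s' \<in> S" for s'
        proof (cases "s' = s")
          case False
          then have "x \<notin> F s'"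
            using elim[THEN bspec, OF s(1), THEN bspec, OF that] elim[THEN bspec, OF that, THEN bspec, OF s(1)] s(2)
            by (cases "s < s'") simp_all
          then show ?thesis using False by simp
        qed (use s in simp)
        then have "(\<Sum>s'\<in>S. indicator (F s') x) = (\<Sum>s'\<in>S. if s' = s then 1 else (0::ennreal))"
          by (intro sum.cong refl)
        then show ?thesis using s(1) \<open>finite S\<close> by simp
      next
        case False
        then have "(\<Sum>s\<in>S. indicator (F s) x) = (0::ennreal)" by (intro sum.neutral) auto
        then show ?thesis by simp
      qed
    qed
    then show ?thesis by (simp add: nn_integral_sum emeasure_space_1)
  qed
  \<comment> \<open>\<open>Suc (Suc n)\<close> almost disjoint sets of measure at least
    \<open>1 / Suc n\<close> would exceed the total mass 1.\<close>
  have finS: "finite {s \<in> {0<..<d}. ennreal (1 / real (Suc n)) \<le> emeasure mu (F s)}" (is "finite ?S") for n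
  proof (rule ccontr)
    assume "infinite ?S"
    then obtain S where S: "finite S" "card S = Suc (Suc n)" "S \<subseteq> ?S"
      using infinite_arbitrarily_large by blast
    have "ennreal (real (Suc (Suc n)) * (1 / real (Suc n))) = ennreal (\<Sum>s\<in>S. 1 / real (Suc n))"
      using S by simp
    also have "\<dots> = (\<Sum>s\<in>S. ennreal (1 / real (Suc n)))" by (rule sum_ennreal[symmetric]) simp
    also have "\<dots> \<le> (\<Sum>s\<in>S. emeasure mu (F s))" using S by (intro sum_mono) auto
    also have "\<dots> \<le> 1" using S by (intro sum_le) auto
    finally have "real (Suc (Suc n)) * (1 / real (Suc n)) \<le> 1" by (simp add: ennreal_le_1 del: of_nat_Suc)
    then show False by (simp add: field_simps)
  qed
  have "countable (\<Union>n. {s \<in> {0<..<d}. ennreal (1 / real (Suc n)) \<le> emeasure mu (F s)})"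
    by (intro countable_UN countable_finite finS countableI_type)
  moreover have "{0<..<d} \<subseteq> (\<Union>n. {s \<in> {0<..<d}. ennreal (1 / real (Suc n)) \<le> emeasure mu (F s)})"
  proof
    fix s assume s: "s \<in> {0<..<d}"
    have m: "measure mu (F s) > 0" using Fpos[of s] by (simp add: emeasure_eq_measure zero_less_measure_iff)
    then obtain n where "inverse (real (Suc n)) < measure mu (F s)" using reals_Archimedean by blast
    then have "ennreal (1 / real (Suc n)) \<le> emeasure mu (F s)"
      by (simp add: emeasure_eq_measure inverse_eq_divide ennreal_leI del: of_nat_Suc)
    with s show "s \<in> (\<Union>n. {s \<in> {0<..<d}. ennreal (1 / real (Suc n)) \<le> emeasure mu (F s)})" by blast
  qed
  ultimately have "countable {0<..<d}" by (rule countable_subset[rotated])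
  then show False using uncountable_open_interval[of 0 d] \<open>0 < d\<close> by simp
qed

text \<open>A measurable subset of the envelope that misses \<open>A\<close> is null. Hence a
  measurable property valid everywhere on \<open>A\<close> is valid almost everywhere on the
  envelope.\<close>

lemma envelope_exists:
  assumes "finite_measure g" "A \<subseteq> space g"
  shows "\<exists>A'\<in>sets g. A \<subseteq> A' \<and> (\<forall>P. Measurable.pred g P \<longrightarrow> (\<forall>p\<in>A. P p) \<longrightarrow> (AE p in g. p \<in> A' \<longrightarrow> P p))"
proof -
  interpret finite_measure g by fact
  obtain A' where A': "A' \<in> sets g" "A \<subseteq> A'" "outer_measure_of g A = emeasure g A'"
    using outer_measure_of_attain[OF assms(2)] by blast
  then have env: "measurable_envelope g A A'"
    by (subst measurable_envelope_eq2) (auto simp: less_top[symmetric])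
  have "AE p in g. p \<in> A' \<longrightarrow> P p" if [measurable]: "Measurable.pred g P" and "\<forall>p\<in>A. P p" for P
  proof -
    have F: "{p \<in> space g. \<not> (p \<in> A' \<longrightarrow> P p)} \<in> sets g" using A'(1) by measurable
    have "emeasure g {p \<in> space g. \<not> (p \<in> A' \<longrightarrow> P p)} = 0"
      using that by (intro measurable_envelopeD1[OF env F]) auto
    then show ?thesis using F by (subst AE_iff_measurable[OF F refl])
  qed
  then show ?thesis using A' by blast
qed

text \<open>\<open>R p d\<close> stands for "\<open>d\<close> is the first variation of some minimizer at \<open>p\<close>". The sets it defines need not be
  measurable, so they are replaced by measurable envelopes; for each fixed \<open>t\<close> the cost inequalities pass to
  the envelope almost everywhere.\<close>

theorem derivative_determined:
  fixes mu nu :: "'b measure" and c :: "'b \<times> 'b \<Rightarrow> ennreal" and V :: "real \<Rightarrow> 'b \<Rightarrow> 'b"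
    and R :: "'b \<times> 'b \<Rightarrow> real \<Rightarrow> bool" and K :: "'b \<times> 'b \<Rightarrow> real"
  assumes g: "g \<in> couplings mu nu" and mu: "prob_space mu"
    and c[measurable]: "c \<in> borel_measurable (mu \<Otimes>\<^sub>M nu)"
    and opt: "\<And>g'. g' \<in> couplings mu nu \<Longrightarrow> (\<integral>\<^sup>+ p. c p \<partial>g) \<le> (\<integral>\<^sup>+ p. c p \<partial>g')"
    and fin: "(\<integral>\<^sup>+ p. c p \<partial>g) < \<infinity>"
    and V[measurable]: "\<And>t. V t \<in> measurable mu mu"
    and V0: "\<And>x. x \<in> space mu \<Longrightarrow> V 0 x = x"
    and add: "\<And>s t x. x \<in> space mu \<Longrightarrow> V s (V t x) = V (s + t) x"
    and qi: "\<And>t. quasi_invariant mu (V t)"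
    and K: "\<And>p. 0 \<le> K p"
    and est: "\<And>p d t. p \<in> space g \<Longrightarrow> R p d \<Longrightarrow> c p < \<infinity> \<and> c (V t (fst p), snd p) < \<infinity> \<and>
        enn2real (c (V t (fst p), snd p)) \<le> enn2real (c p) + t * d + K p * t\<^sup>2"
  shows "\<exists>S\<in>borel_measurable mu. AE p in g. \<forall>d. R p d \<longrightarrow> d = S (fst p)"
proof -
  interpret g: prob_space g using g by (rule couplings_D)
  note [measurable_cong] = couplings_D(2)[OF g]
  have cg[measurable]: "c \<in> borel_measurable g"
    using c couplings_D(2)[OF g] by (simp cong: measurable_cong_sets)
  have shift[measurable]: "(\<lambda>p. (V t (fst p), snd p)) \<in> measurable g (mu \<Otimes>\<^sub>M nu)" for t by measurable
  have cV[measurable]: "(\<lambda>p. c (V t (fst p), snd p)) \<in> borel_measurable g" for t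
    by (rule measurable_compose[OF shift c])
  have fst_g: "fst \<in> measurable g mu" by measurable
  \<comment> \<open>The real bound \<open>a\<close> may have either sign; writing it as
    \<open>max 0 a - max 0 (- a)\<close> and moving the second part across keeps the inequality in
    \<open>ennreal\<close>.\<close>
  have shift_ineq: "c (V t (fst p), snd p) + ennreal (max 0 (- a)) \<le> c p + ennreal (max 0 a)"
    if p: "p \<in> space g" and Rpd: "R p d" and le: "t * d + K p * t\<^sup>2 \<le> a" for p d t a
  proof -
    obtain x y where xy: "c p = ennreal x" "c (V t (fst p), snd p) = ennreal y" "0 \<le> x" "0 \<le> y"
      using est[OF p Rpd, of t] by (cases "c p"; cases "c (V t (fst p), snd p)") auto
    then have "y \<le> x + a" using est[OF p Rpd, of t] le by simp
    then have "ennreal (y + max 0 (- a)) \<le> ennreal (x + max 0 a)" by (intro ennreal_leI) (auto simp: max_def)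
    moreover have "ennreal (y + max 0 (- a)) = ennreal y + ennreal (max 0 (- a))"
      "ennreal (x + max 0 a) = ennreal x + ennreal (max 0 a)"
      using xy by (intro ennreal_plus; simp)+
    ultimately show ?thesis unfolding xy by (simp only:)
  qed
  define env where "env A A' \<longleftrightarrow> A' \<in> sets g \<and> A \<subseteq> A' \<and>
    (\<forall>P. Measurable.pred g P \<longrightarrow> (\<forall>p\<in>A. P p) \<longrightarrow> (AE p in g. p \<in> A' \<longrightarrow> P p))" for A A'
  \<comment> \<open>The slack \<open>K p / Suc n\<close> absorbs the error \<open>K p * t^2\<close>
    for every \<open>t\<close> in (0, 1 / Suc n), a range that does not depend on \<open>p\<close>.
    Every \<open>p\<close> with a derivative strictly below \<open>q\<close> lies in some
    \<open>A0 q n\<close>; \<open>B0\<close> is the mirror image for time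
    \<open>- t\<close>.\<close>
  define A0 where "A0 q n = {p \<in> space g. \<exists>d. R p d \<and> d + K p / real (Suc n) \<le> real_of_rat q}" for q n
  define B0 where "B0 q n = {p \<in> space g. \<exists>d. R p d \<and> real_of_rat q \<le> d - K p / real (Suc n)}" for q n
  have "\<forall>q n. \<exists>A'. env (A0 q n) A'"
    unfolding env_def by (intro allI envelope_exists[OF g.finite_measure_axioms, unfolded Bex_def]) (auto simp: A0_def)
  then obtain A where A': "\<And>q n. env (A0 q n) (A q n)" by metis
  have A: "\<And>q n. A q n \<in> sets g" "\<And>q n. A0 q n \<subseteq> A q n"
    "\<And>q n P. Measurable.pred g P \<Longrightarrow> (\<And>p. p \<in> A0 q n \<Longrightarrow> P p) \<Longrightarrow> AE p in g. p \<in> A q n \<longrightarrow> P p"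
    using A' unfolding env_def by simp_all
  have "\<forall>q n. \<exists>A'. env (B0 q n) A'"
    unfolding env_def by (intro allI envelope_exists[OF g.finite_measure_axioms, unfolded Bex_def]) (auto simp: B0_def)
  then obtain B where B': "\<And>q n. env (B0 q n) (B q n)" by metis
  have B: "\<And>q n. B q n \<in> sets g" "\<And>q n. B0 q n \<subseteq> B q n"
    "\<And>q n P. Measurable.pred g P \<Longrightarrow> (\<And>p. p \<in> B0 q n \<Longrightarrow> P p) \<Longrightarrow> AE p in g. p \<in> B q n \<longrightarrow> P p"
    using B' unfolding env_def by simp_all
  have "\<forall>q n. \<exists>f\<in>borel_measurable mu. \<forall>h\<in>borel_measurable mu.
    (\<integral>\<^sup>+ p. indicator (A q n) p * h (fst p) \<partial>g) = (\<integral>\<^sup>+ x. f x * h x \<partial>mu)"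
    by (intro allI marginal_density[OF g mu] A)
  then obtain fA where fA[measurable]: "\<And>q n. fA q n \<in> borel_measurable mu"
    and dA: "\<And>q n h. h \<in> borel_measurable mu \<Longrightarrow> (\<integral>\<^sup>+ p. indicator (A q n) p * h (fst p) \<partial>g) = (\<integral>\<^sup>+ x. fA q n x * h x \<partial>mu)"
    by metis
  have "\<forall>q n. \<exists>f\<in>borel_measurable mu. \<forall>h\<in>borel_measurable mu.
    (\<integral>\<^sup>+ p. indicator (B q n) p * h (fst p) \<partial>g) = (\<integral>\<^sup>+ x. f x * h x \<partial>mu)"
    by (intro allI marginal_density[OF g mu] B)
  then obtain fB where fB[measurable]: "\<And>q n. fB q n \<in> borel_measurable mu"
    and dB: "\<And>q n h. h \<in> borel_measurable mu \<Longrightarrow> (\<integral>\<^sup>+ p. indicator (B q n) p * h (fst p) \<partial>g) = (\<integral>\<^sup>+ x. fB q n x * h x \<partial>mu)"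
    by metis
  \<comment> \<open>Tested with the indicator of \<open>f = 0\<close>: the part of \<open>A'\<close>
    over the zeros of its density has no mass.\<close>
  have density_pos: "AE p in g. p \<in> A' \<longrightarrow> f (fst p) \<noteq> 0"
    if A'[measurable]: "A' \<in> sets g" and f[measurable]: "f \<in> borel_measurable mu"
    and d: "\<And>h. h \<in> borel_measurable mu \<Longrightarrow> (\<integral>\<^sup>+ p. indicator A' p * h (fst p) \<partial>g) = (\<integral>\<^sup>+ x. f x * h x \<partial>mu)"
    for A' and f :: "'b \<Rightarrow> ennreal"
  proof -
    let ?h = "\<lambda>x. indicator {0} (f x) :: ennreal"
    have "(\<integral>\<^sup>+ p. indicator A' p * ?h (fst p) \<partial>g) = (\<integral>\<^sup>+ x. f x * ?h x \<partial>mu)" by (rule d) measurable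
    also have "\<dots> = (\<integral>\<^sup>+ x. 0 \<partial>mu)" by (intro nn_integral_cong) (simp add: indicator_def)
    finally have "(\<integral>\<^sup>+ p. indicator A' p * ?h (fst p) \<partial>g) = 0" by simp
    moreover have "(\<lambda>p. indicator A' p * ?h (fst p)) \<in> borel_measurable g"
      by (intro borel_measurable_times_ennreal measurable_compose[OF fst_g]) measurable
    ultimately have "AE p in g. indicator A' p * ?h (fst p) = 0" by (simp only: nn_integral_0_iff_AE)
    then show ?thesis by (rule AE_mp) (intro AE_I2, simp add: indicator_def split: if_splits)
  qed
  have disj: "AE x in mu. fA q n x = 0 \<or> fB q' n' x = 0" if "q < q'" for q q' :: rat and n n'
  proof -
    define E where "E = {x \<in> space mu. fA q n x \<noteq> 0 \<and> fB q' n' x \<noteq> 0}"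
    have E[measurable]: "E \<in> sets mu" unfolding E_def by measurable
    have "emeasure mu E = 0"
    proof (rule ccontr)
      assume "emeasure mu E \<noteq> 0"
      from quasi_invariant_recurrence[OF mu V add qi E this, of "min (1 / real (Suc n)) (1 / real (Suc n'))"]
      obtain t where t: "0 < t" "t < 1 / real (Suc n)" "t < 1 / real (Suc n')"
        and ne: "emeasure mu {x \<in> E. V t x \<in> E} \<noteq> 0" by auto
      have Kt: "t * (K p * t) \<le> t * (K p / real (Suc n))" "t * (K p * t) \<le> t * (K p / real (Suc n'))" for p
        using t mult_left_mono[OF less_imp_le[OF t(2)] K[of p]] mult_left_mono[OF less_imp_le[OF t(3)] K[of p]]
        by (intro mult_left_mono; simp del: of_nat_Suc)+
      have "AE x in mu. fA q n x = 0 \<or> fB q' n' (V t x) = 0"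
      proof (rule shifted_densities_disjoint[OF g mu c opt fin V V _ _ qi A(1) B(1) fA fB dA dB, where
            u="max 0 (- (t * real_of_rat q))" and u'="max 0 (t * real_of_rat q)"
            and r="max 0 (- (- t * real_of_rat q'))" and r'="max 0 (- t * real_of_rat q')"])
        show "V (- t) (V t x) = x" "V t (V (- t) x) = x" if "x \<in> space mu" for x
          using that by (simp_all add: add V0)
        show "AE p in g. p \<in> A q n \<longrightarrow> c (V t (fst p), snd p) + ennreal (max 0 (- (t * real_of_rat q))) \<le> c p + ennreal (max 0 (t * real_of_rat q))"
        proof (rule A(3))
          fix p assume "p \<in> A0 q n"
          then obtain d where d: "p \<in> space g" "R p d" "d + K p / real (Suc n) \<le> real_of_rat q" by (auto simp: A0_def)
          have "t * d + K p * t\<^sup>2 \<le> t * (d + K p / real (Suc n))"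
            using Kt(1)[of p] by (simp add: power2_eq_square distrib_left mult_ac del: of_nat_Suc)
          also have "\<dots> \<le> t * real_of_rat q" using d(3) t by (intro mult_left_mono) auto
          finally show "c (V t (fst p), snd p) + ennreal (max 0 (- (t * real_of_rat q))) \<le> c p + ennreal (max 0 (t * real_of_rat q))"
            by (rule shift_ineq[OF d(1,2)])
        qed measurable
        show "AE p in g. p \<in> B q' n' \<longrightarrow> c (V (- t) (fst p), snd p) + ennreal (max 0 (- (- t * real_of_rat q'))) \<le> c p + ennreal (max 0 (- t * real_of_rat q'))"
        proof (rule B(3))
          fix p assume "p \<in> B0 q' n'"
          then obtain d where d: "p \<in> space g" "R p d" "real_of_rat q' \<le> d - K p / real (Suc n')" by (auto simp: B0_def)
          have "- t * d + K p * (- t)\<^sup>2 \<le> - (t * (d - K p / real (Suc n')))"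
            using Kt(2)[of p] by (simp add: power2_eq_square right_diff_distrib mult_ac del: of_nat_Suc)
          also have "\<dots> \<le> - t * real_of_rat q'" using mult_left_mono[OF d(3), of t] t by simp
          finally show "c (V (- t) (fst p), snd p) + ennreal (max 0 (- (- t * real_of_rat q'))) \<le> c p + ennreal (max 0 (- t * real_of_rat q'))"
            by (rule shift_ineq[OF d(1,2)])
        qed measurable
        \<comment> \<open>As \<open>max 0 a - max 0 (- a) = a\<close>, the net gain of the exchange
          is \<open>t * (q' - q)\<close>.\<close>
        have "t * real_of_rat q < t * real_of_rat q'" using t that by (simp add: of_rat_less)
        then show "max 0 (t * real_of_rat q) + max 0 (- t * real_of_rat q') < max 0 (- (t * real_of_rat q)) + max 0 (- (- t * real_of_rat q'))"
          by (auto simp: max_def)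
      qed auto
      then have "AE x in mu. \<not> (x \<in> E \<and> V t x \<in> E)" by (rule AE_mp) (auto simp: E_def)
      then have "emeasure mu {x \<in> space mu. \<not> \<not> (x \<in> E \<and> V t x \<in> E)} = 0"
        by (subst (asm) AE_iff_measurable[OF _ refl]) auto
      moreover have "{x \<in> space mu. \<not> \<not> (x \<in> E \<and> V t x \<in> E)} = {x \<in> E. V t x \<in> E}"
        by (auto simp: E_def)
      ultimately show False using ne by simp
    qed
    then have "AE x in mu. x \<notin> E" by (intro AE_not_in) auto
    then show ?thesis by (rule AE_mp) (auto simp: E_def)
  qed
  \<comment> \<open>The infimum sees only the densities, so it is a function of the first
    coordinate, measurable as a countable infimum. It takes values in \<open>ereal\<close> because
    possibly no \<open>q\<close> qualifies.\<close>
  define S' where "S' x = (INF z\<in>(UNIV :: (rat \<times> nat) set). if fA (fst z) (snd z) x \<noteq> 0 then ereal (real_of_rat (fst z)) else \<infinity>)" for x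
  have [measurable]: "S' \<in> borel_measurable mu"
    unfolding S'_def by (intro borel_measurable_INF) auto
  have "AE p in g. \<forall>q n q' n'. (p \<in> A q n \<longrightarrow> fA q n (fst p) \<noteq> 0) \<and> (p \<in> B q n \<longrightarrow> fB q n (fst p) \<noteq> 0)
      \<and> (q < q' \<longrightarrow> fA q n (fst p) = 0 \<or> fB q' n' (fst p) = 0)"
    unfolding AE_all_countable
  proof (intro allI AE_conjI)
    fix q q' :: rat and n n'
    show "AE p in g. p \<in> A q n \<longrightarrow> fA q n (fst p) \<noteq> 0" by (rule density_pos[OF A(1) fA dA])
    show "AE p in g. p \<in> B q n \<longrightarrow> fB q n (fst p) \<noteq> 0" by (rule density_pos[OF B(1) fB dB])
    show "AE p in g. q < q' \<longrightarrow> fA q n (fst p) = 0 \<or> fB q' n' (fst p) = 0"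
    proof (cases "q < q'")
      case True
      from coupling_AE_fst[OF g disj[OF True]] show ?thesis by (rule AE_mp) auto
    qed simp
  qed
  then have "AE p in g. \<forall>d. R p d \<longrightarrow> S' (fst p) = ereal d"
  proof (rule AE_mp, intro AE_I2 impI allI)
    fix p d
    assume p: "p \<in> space g" and R: "R p d" and all: "\<forall>q n q' n'. (p \<in> A q n \<longrightarrow> fA q n (fst p) \<noteq> 0) \<and> (p \<in> B q n \<longrightarrow> fB q n (fst p) \<noteq> 0)
      \<and> (q < q' \<longrightarrow> fA q n (fst p) = 0 \<or> fB q' n' (fst p) = 0)"
    have small: "\<exists>n. K p / real (Suc n) \<le> e" if "0 < e" for e
    proof -
      obtain n where "K p / e < real n" using reals_Archimedean2 by blast
      then have "K p \<le> e * real (Suc n)" using that by (simp add: field_simps)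
      then show ?thesis by (intro exI[of _ n]) (simp add: field_simps)
    qed
    \<comment> \<open>Above: for every rational \<open>q > d\<close> some \<open>fA q n\<close> is
      nonzero at this point. Below: a nonzero \<open>fA q n\<close> with \<open>q < d\<close> would
      coexist with a nonzero \<open>fB q' n'\<close> for some \<open>q < q' < d\<close>, against
      \<open>disj\<close>.\<close>
    show "S' (fst p) = ereal d"
    proof (rule antisym)
      show "S' (fst p) \<le> ereal d"
      proof (rule ccontr)
        assume "\<not> S' (fst p) \<le> ereal d"
        then have "ereal d < S' (fst p)" by simp
        from ereal_dense2[OF this] obtain e where e: "ereal d < ereal e" "ereal e < S' (fst p)" by blast
        obtain q where q: "d < real_of_rat q" "real_of_rat q < e" using of_rat_dense[of d e] e(1) by auto
        obtain n where "K p / real (Suc n) \<le> real_of_rat q - d" using small[of "real_of_rat q - d"] q by auto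
        then have "p \<in> A0 q n" using p R by (auto simp: A0_def intro!: exI[of _ d])
        then have "fA q n (fst p) \<noteq> 0" using all A(2) by blast
        then have "S' (fst p) \<le> ereal (real_of_rat q)"
          unfolding S'_def by (intro INF_lower2[of "(q, n)"]) auto
        also have "\<dots> < ereal e" using q by simp
        finally show False using e(2) by simp
      qed
      show "ereal d \<le> S' (fst p)"
        unfolding S'_def
      proof (intro INF_greatest)
        fix z :: "rat \<times> nat"
        show "ereal d \<le> (if fA (fst z) (snd z) (fst p) \<noteq> 0 then ereal (real_of_rat (fst z)) else \<infinity>)"
        proof (cases "fA (fst z) (snd z) (fst p) \<noteq> 0")
          case True
          have "d \<le> real_of_rat (fst z)"
          proof (rule ccontr)
            assume "\<not> d \<le> real_of_rat (fst z)"
            then obtain q' where q': "real_of_rat (fst z) < real_of_rat q'" "real_of_rat q' < d"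
              using of_rat_dense[of "real_of_rat (fst z)" d] by auto
            obtain n' where "K p / real (Suc n') \<le> d - real_of_rat q'" using small[of "d - real_of_rat q'"] q' by auto
            then have "p \<in> B0 q' n'" using p R by (auto simp: B0_def intro!: exI[of _ d])
            then have "fB q' n' (fst p) \<noteq> 0" using all B(2) by blast
            moreover have "fst z < q'" using q'(1) by (simp add: of_rat_less)
            ultimately show False using all True by blast
          qed
          then show ?thesis using True by simp
        qed simp
      qed
    qed
  qed
  then have "AE p in g. \<forall>d. R p d \<longrightarrow> d = real_of_ereal (S' (fst p))" by (rule AE_mp) auto
  moreover have "(\<lambda>x. real_of_ereal (S' x)) \<in> borel_measurable mu" by measurable
  ultimately show ?thesis by (intro bexI[of _ "\<lambda>x. real_of_ereal (S' x)"])
qed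

section \<open>First variation of the cost along a flow\<close>

definition plan_points :: "'a set \<Rightarrow> ('a \<times> 'a \<Rightarrow> nat) \<Rightarrow> ('a \<times> 'a) set" where
  "plan_points U beta = {p. beta p \<noteq> 0 \<and> fst p \<in> U}"

text \<open>The derivative at time 0 of the cost of \<open>beta\<close> when its first coordinates
  move along \<open>v\<close>. A bounded \<open>U\<close> containing all points where
  \<open>v\<close> is nonzero makes it a finite sum even when the plan is infinite.\<close>

definition drift :: "'a set \<Rightarrow> ('a::euclidean_space \<Rightarrow> 'a) \<Rightarrow> ('a \<times> 'a \<Rightarrow> nat) \<Rightarrow> real" where
  "drift U v beta = (\<Sum>p\<in>plan_points U beta. real (beta p) * (v (fst p) \<bullet> (fst p - snd p)))"

definition load :: "'a set \<Rightarrow> ('a \<Rightarrow> nat) \<Rightarrow> nat" where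
  "load U eta = (\<Sum>x\<in>{x \<in> U. eta x \<noteq> 0}. eta x)"

lemma marginals_row_finite:
  assumes "marginals beta eta om" shows "finite {y. beta (x, y) \<noteq> 0}"
  using assms by (intro nn_integral_of_nat_finite_support) (simp add: marginals_def of_nat_less_top)

lemma marginals_row_sum:
  assumes "marginals beta eta om" shows "(\<Sum>y\<in>{y. beta (x, y) \<noteq> 0}. beta (x, y)) = eta x"
proof -
  have "rowsum beta x = of_nat (\<Sum>y\<in>{y. beta (x, y) \<noteq> 0}. beta (x, y))"
    by (rule rowsum_finite_support[OF marginals_row_finite[OF assms]]) simp
  moreover have "rowsum beta x = of_nat (eta x)" using assms by (simp add: marginals_iff)
  ultimately have "(of_nat (\<Sum>y\<in>{y. beta (x, y) \<noteq> 0}. beta (x, y)) :: ennreal) = of_nat (eta x)" by (simp only:)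
  then show ?thesis by (simp only: of_nat_eq_iff)
qed

lemma plan_points_Sigma:
  assumes "marginals beta eta om"
  shows "plan_points U beta = Sigma {x \<in> U. eta x \<noteq> 0} (\<lambda>x. {y. beta (x, y) \<noteq> 0})"
  using marginals_support(1)[OF assms] unfolding plan_points_def by auto

lemma
  fixes eta :: "'a::euclidean_space \<Rightarrow> nat"
  assumes "marginals beta eta om" "eta \<in> Gamma UNIV" "bounded U"
  shows finite_plan_points: "finite (plan_points U beta)"
    and sum_plan_points: "(\<Sum>p\<in>plan_points U beta. beta p) = load U eta"
proof -
  have X: "finite {x \<in> U. eta x \<noteq> 0}" by (rule Gamma_finite[OF assms(2,3)])
  show "finite (plan_points U beta)"
    unfolding plan_points_Sigma[OF assms(1)] by (intro finite_SigmaI X marginals_row_finite[OF assms(1)])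
  have "(\<Sum>p\<in>plan_points U beta. beta p) = (\<Sum>x\<in>{x \<in> U. eta x \<noteq> 0}. \<Sum>y\<in>{y. beta (x, y) \<noteq> 0}. beta (x, y))"
    unfolding plan_points_Sigma[OF assms(1)]
    by (subst sum.Sigma[OF X]) (use marginals_row_finite[OF assms(1)] in \<open>simp_all del: neq0_conv\<close>)
  then show "(\<Sum>p\<in>plan_points U beta. beta p) = load U eta"
    by (simp only: marginals_row_sum[OF assms(1)] load_def)
qed

text \<open>In the application the flow does not touch the pairs outside \<open>F\<close>; their
  possibly infinite sum stays an \<open>ennreal\<close> integral, and real arithmetic with signed
  terms is confined to \<open>F\<close>.\<close>

lemma plan_cost_split:
  assumes "finite F" "\<And>p. 0 \<le> C p"
  shows "plan_cost C beta = (\<integral>\<^sup>+ p. of_nat (beta p) * ennreal (C p) * indicator (- F) p \<partial>count_space UNIV)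
    + ennreal (\<Sum>p\<in>F. real (beta p) * C p)"
proof -
  have "plan_cost C beta = (\<integral>\<^sup>+ p. of_nat (beta p) * ennreal (C p) * indicator (- F) p
      + of_nat (beta p) * ennreal (C p) * indicator F p \<partial>count_space UNIV)"
    unfolding plan_cost_def by (intro nn_integral_cong) (simp add: indicator_def)
  also have "\<dots> = (\<integral>\<^sup>+ p. of_nat (beta p) * ennreal (C p) * indicator (- F) p \<partial>count_space UNIV)
      + (\<integral>\<^sup>+ p. of_nat (beta p) * ennreal (C p) * indicator F p \<partial>count_space UNIV)"
    by (rule nn_integral_add) auto
  also have "(\<integral>\<^sup>+ p. of_nat (beta p) * ennreal (C p) * indicator F p \<partial>count_space UNIV) = (\<Sum>p\<in>F. of_nat (beta p) * ennreal (C p))"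
    using assms(1) by (subst nn_integral_indicator_finite) auto
  also have "\<dots> = (\<Sum>p\<in>F. ennreal (real (beta p) * C p))"
    using assms(2) by (intro sum.cong refl) (simp add: ennreal_mult ennreal_of_nat_eq_real_of_nat)
  also have "\<dots> = ennreal (\<Sum>p\<in>F. real (beta p) * C p)"
    using assms(2) by (intro sum_ennreal) simp
  finally show ?thesis .
qed

context lipschitz_flow
begin

text \<open>With \<open>z = V t x - x\<close> the square expands exactly. The term
  \<open>norm z^2 / 2\<close> is at most \<open>t^2 / 2\<close>, the Taylor remainder paired with
  \<open>x - y\<close> costs \<open>Lc * t^2 * norm (x - y)\<close>, and
  \<open>norm (x - y) <= 1/2 + norm (x - y)^2 / 2\<close> expresses this through the cost
  itself.\<close>

lemma half_dist_shift:
  "norm (V t x - y)^2 / 2 \<le> norm (x - y)^2 / 2 + t * (v x \<bullet> (x - y)) + (Lc + 1) * t\<^sup>2 * (1/2 + norm (x - y)^2 / 2)"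
proof -
  define z where "z = V t x - x"
  have L: "0 \<le> Lc" by (rule Lc_nonneg) simp
  have "norm (V t x - y)^2 = (x - y + z) \<bullet> (x - y + z)"
    by (simp add: z_def power2_norm_eq_inner)
  also have "\<dots> = norm (x - y)^2 + 2 * (z \<bullet> (x - y)) + norm z^2"
    by (simp add: inner_add_left inner_add_right inner_commute power2_norm_eq_inner)
  finally have 1: "norm (V t x - y)^2 / 2 = norm (x - y)^2 / 2 + z \<bullet> (x - y) + norm z^2 / 2" by simp
  have "norm z^2 \<le> \<bar>t\<bar>^2" using V_dist[of t x] by (intro power_mono) (auto simp: z_def)
  then have 2: "norm z^2 / 2 \<le> t\<^sup>2 / 2" by simp
  have "z \<bullet> (x - y) = t * (v x \<bullet> (x - y)) + (z - t *\<^sub>R v x) \<bullet> (x - y)" by (simp add: inner_diff_left)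
  also have "(z - t *\<^sub>R v x) \<bullet> (x - y) \<le> norm (z - t *\<^sub>R v x) * norm (x - y)" by (rule norm_cauchy_schwarz)
  also have "\<dots> \<le> (Lc * t\<^sup>2) * norm (x - y)"
    using V_taylor[of t x] by (intro mult_right_mono) (auto simp: z_def)
  also have "\<dots> \<le> (Lc * t\<^sup>2) * (1/2 + norm (x - y)^2 / 2)"
  proof (rule mult_left_mono)
    have "0 \<le> (norm (x - y) - 1)^2" by simp
    then show "norm (x - y) \<le> 1/2 + norm (x - y)^2 / 2" by (simp add: power2_eq_square algebra_simps)
  qed (use L in simp)
  finally have 3: "z \<bullet> (x - y) \<le> t * (v x \<bullet> (x - y)) + (Lc * t\<^sup>2) * (1/2 + norm (x - y)^2 / 2)" by simp
  have "t\<^sup>2 / 2 \<le> t\<^sup>2 * (1/2 + norm (x - y)^2 / 2)" by (simp add: distrib_left)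
  moreover have "(Lc + 1) * t\<^sup>2 * (1/2 + norm (x - y)^2 / 2) = (Lc * t\<^sup>2) * (1/2 + norm (x - y)^2 / 2) + t\<^sup>2 * (1/2 + norm (x - y)^2 / 2)"
    by (simp only: distrib_right mult_1_left)
  ultimately show ?thesis using 1 2 3 by linarith
qed

lemma shifted_plan_marginals:
  assumes "marginals beta eta om"
  shows "marginals (\<lambda>p. beta (V (- t) (fst p), snd p)) (push (V t) eta) om"
proof -
  have "(\<integral>\<^sup>+ x. (\<lambda>x. of_nat (beta (x, y))) (V (- t) x) \<partial>count_space UNIV) = (\<integral>\<^sup>+ x. of_nat (beta (x, y)) \<partial>count_space UNIV)" for y
    by (rule nn_integral_bij_count_space[OF bij_V])
  then show ?thesis
    using assms by (simp add: marginals_def push_inverse[of "V (- t)" "V t"] V_uminus)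
qed

lemma shifted_plan_cost:
  "beta_cost (\<lambda>p. beta (V (- t) (fst p), snd p)) = plan_cost (\<lambda>p. norm (V t (fst p) - snd p)^2 / 2) beta"
proof -
  let ?f = "\<lambda>p. (V t (fst p), snd p)"
  have bij: "bij_betw ?f UNIV UNIV"
    by (rule bij_betw_byWitness[where f'="\<lambda>p. (V (- t) (fst p), snd p)"]) (auto simp: V_uminus)
  have "plan_cost (\<lambda>p. norm (V t (fst p) - snd p)^2 / 2) beta =
    (\<integral>\<^sup>+ p. (\<lambda>p. of_nat (beta (V (- t) (fst p), snd p)) * ennreal (norm (fst p - snd p)^2 / 2)) (?f p) \<partial>count_space UNIV)"
    unfolding plan_cost_def by (intro nn_integral_cong) (simp add: V_uminus)
  also have "\<dots> = beta_cost (\<lambda>p. beta (V (- t) (fst p), snd p))"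
    unfolding beta_cost_def by (rule nn_integral_bij_count_space[OF bij])
  finally show ?thesis by simp
qed

text \<open>The plan with shifted first coordinates is admissible for the shifted configuration.
  Pairs starting outside \<open>U\<close> keep their cost; the errors of the others add up to at
  most a multiple of the number of points in \<open>U\<close> plus the total cost.\<close>

lemma cost_shift:
  assumes eta: "eta \<in> Gamma UNIV" and om: "om \<in> Gamma UNIV"
    and real: "realizes beta eta om" and fin: "cost eta om < \<infinity>"
    and U: "bounded U" "\<And>x. x \<notin> U \<Longrightarrow> v x = 0"
  shows "cost (push (V t) eta) om < \<infinity>"
    and "enn2real (cost (push (V t) eta) om) \<le>
      enn2real (cost eta om) + t * drift U v beta + (Lc + 1) * (real (load U eta) + enn2real (cost eta om)) * t\<^sup>2"
proof -
  have L: "0 \<le> Lc" by (rule Lc_nonneg) simp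
  have m: "marginals beta eta om" using real by (simp add: realizes_def admissible_def)
  define F where "F = plan_points U beta"
  have F: "finite F" unfolding F_def by (rule finite_plan_points[OF m eta U(1)])
  let ?C = "\<lambda>p::'a \<times> 'a. norm (fst p - snd p)^2 / 2" and ?D = "\<lambda>p::'a \<times> 'a. norm (V t (fst p) - snd p)^2 / 2"
  define I where "I = (\<integral>\<^sup>+ p. of_nat (beta p) * ennreal (?C p) * indicator (- F) p \<partial>count_space UNIV)"
  have 1: "cost eta om = I + ennreal (\<Sum>p\<in>F. real (beta p) * ?C p)"
    using real plan_cost_split[OF F, of ?C beta] by (simp add: realizes_def I_def beta_cost_eq_plan_cost)
  have "(\<integral>\<^sup>+ p. of_nat (beta p) * ennreal (?D p) * indicator (- F) p \<partial>count_space UNIV) = I"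
    unfolding I_def
  proof (intro nn_integral_cong)
    fix p
    show "of_nat (beta p) * ennreal (?D p) * indicator (- F) p = of_nat (beta p) * ennreal (?C p) * indicator (- F) p"
    proof (cases "beta p = 0 \<or> p \<in> F")
      case False
      then have "fst p \<notin> U" by (auto simp: F_def plan_points_def)
      then show ?thesis by (simp add: V_fixed[OF U(2)])
    qed auto
  qed
  then have 2: "beta_cost (\<lambda>p. beta (V (- t) (fst p), snd p)) = I + ennreal (\<Sum>p\<in>F. real (beta p) * ?D p)"
    using plan_cost_split[OF F, of ?D beta] by (simp add: shifted_plan_cost)
  have "push (V t) eta \<in> Gamma UNIV"
    by (rule push_Gamma[of "V (- t)"]) (simp_all add: V_uminus continuous_V eta)
  then have "(\<lambda>p. beta (V (- t) (fst p), snd p)) \<in> admissible (push (V t) eta) om"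
    using shifted_plan_marginals[OF m, of t] marginals_Gamma[OF shifted_plan_marginals[OF m, of t] _ om]
    by (simp add: admissible_def)
  then have le: "cost (push (V t) eta) om \<le> I + ennreal (\<Sum>p\<in>F. real (beta p) * ?D p)"
    unfolding cost_def 2[symmetric] by (rule INF_lower)
  obtain i where i: "I = ennreal i" "0 \<le> i" using fin 1 by (cases I) auto
  have nn: "0 \<le> (\<Sum>p\<in>F. real (beta p) * ?C p)" "0 \<le> (\<Sum>p\<in>F. real (beta p) * ?D p)"
    by (intro sum_nonneg; simp)+
  have c0: "enn2real (cost eta om) = i + (\<Sum>p\<in>F. real (beta p) * ?C p)"
    unfolding 1 i using nn i by (simp flip: ennreal_plus)
  have le': "cost (push (V t) eta) om \<le> ennreal (i + (\<Sum>p\<in>F. real (beta p) * ?D p))"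
    using le unfolding i using nn i by (simp add: ennreal_plus)
  then show "cost (push (V t) eta) om < \<infinity>" by (rule le_less_trans) simp
  have "enn2real (cost (push (V t) eta) om) \<le> i + (\<Sum>p\<in>F. real (beta p) * ?D p)"
    by (rule enn2real_leI[OF _ le']) (use nn i in simp)
  also have "(\<Sum>p\<in>F. real (beta p) * ?D p) \<le> (\<Sum>p\<in>F. real (beta p) * ?C p + t * (real (beta p) * (v (fst p) \<bullet> (fst p - snd p)))
      + (Lc + 1) * t\<^sup>2 * (real (beta p) * (1/2) + real (beta p) * ?C p))"
  proof (rule sum_mono)
    fix p
    have "real (beta p) * ?D p \<le> real (beta p) * (?C p + t * (v (fst p) \<bullet> (fst p - snd p)) + (Lc + 1) * t\<^sup>2 * (1/2 + ?C p))"
      by (intro mult_left_mono half_dist_shift) simp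
    then show "real (beta p) * ?D p \<le> real (beta p) * ?C p + t * (real (beta p) * (v (fst p) \<bullet> (fst p - snd p)))
      + (Lc + 1) * t\<^sup>2 * (real (beta p) * (1/2) + real (beta p) * ?C p)"
      by (simp add: algebra_simps)
  qed
  also have "\<dots> = (\<Sum>p\<in>F. real (beta p) * ?C p) + t * drift U v beta
      + (Lc + 1) * t\<^sup>2 * ((\<Sum>p\<in>F. real (beta p)) * (1/2) + (\<Sum>p\<in>F. real (beta p) * ?C p))"
    by (simp only: sum.distrib sum_distrib_left[symmetric] sum_distrib_right[symmetric] drift_def F_def[symmetric])
  also have "(\<Sum>p\<in>F. real (beta p)) = real (load U eta)"
    using sum_plan_points[OF m eta U(1)] by (simp add: F_def flip: of_nat_sum)
  also have "(Lc + 1) * t\<^sup>2 * (real (load U eta) * (1/2) + (\<Sum>p\<in>F. real (beta p) * ?C p))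
      \<le> (Lc + 1) * t\<^sup>2 * (real (load U eta) + enn2real (cost eta om))"
    using L i nn by (intro mult_left_mono) (simp_all add: c0)
  finally show "enn2real (cost (push (V t) eta) om) \<le>
      enn2real (cost eta om) + t * drift U v beta + (Lc + 1) * (real (load U eta) + enn2real (cost eta om)) * t\<^sup>2"
    by (simp add: c0 mult_ac)
qed

end

section \<open>The transport map\<close>

context lipschitz_flow
begin

lemma drift_determined:
  fixes mu nu :: "('a \<Rightarrow> nat) measure"
  assumes mu: "prob_space mu" and smu: "sets mu = sets (GammaM UNIV)" and snu: "sets nu = sets (GammaM UNIV)"
    and qi: "\<And>t. quasi_invariant mu (push (V t))"
    and c: "(\<lambda>p. cost (fst p) (snd p)) \<in> borel_measurable (GammaM UNIV \<Otimes>\<^sub>M GammaM (UNIV :: 'a set))"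
    and fin: "MKP_inf mu nu < \<infinity>" and opt: "optimal g mu nu"
    and U: "bounded U" "\<And>x. x \<notin> U \<Longrightarrow> v x = 0"
  shows "\<exists>S\<in>borel_measurable mu. AE p in g. \<forall>beta. realizes beta (fst p) (snd p) \<longrightarrow> drift U v beta = S (fst p)"
proof -
  have g: "g \<in> couplings mu nu" and og: "total_cost g = MKP_inf mu nu" using opt by (auto simp: optimal_def)
  have sp: "space mu = Gamma UNIV" "space nu = Gamma UNIV"
    using sets_eq_imp_space_eq[OF smu] sets_eq_imp_space_eq[OF snu] by simp_all
  have "sets (mu \<Otimes>\<^sub>M nu) = sets (GammaM UNIV \<Otimes>\<^sub>M GammaM (UNIV :: 'a set))"
    by (rule sets_pair_measure_cong[OF smu snu])
  then have c': "(\<lambda>p. cost (fst p) (snd p)) \<in> borel_measurable (mu \<Otimes>\<^sub>M nu)"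
    using c by (simp cong: measurable_cong_sets)
  then have cg: "(\<lambda>p. cost (fst p) (snd p)) \<in> borel_measurable g"
    using couplings_D(2)[OF g] by (simp cong: measurable_cong_sets)
  have "space g = Gamma UNIV \<times> Gamma UNIV"
    using sets_eq_imp_space_eq[OF couplings_D(2)[OF g]] by (simp add: space_pair_measure sp)
  then have spg: "fst p \<in> Gamma UNIV" "snd p \<in> Gamma UNIV" if "p \<in> space g" for p
    using that by (simp_all add: mem_Times_iff)
  have fin': "(\<integral>\<^sup>+ p. cost (fst p) (snd p) \<partial>g) < \<infinity>" using fin og by (simp add: total_cost_def)
  \<comment> \<open>Finite cost is part of \<open>R\<close> because the expansion is stated for real
    numbers; pairs with infinite cost are \<open>g\<close>-null, the optimal total cost being
    finite.\<close>
  define R where "R p d \<longleftrightarrow> (\<exists>beta. realizes beta (fst p) (snd p) \<and> cost (fst p) (snd p) < \<infinity> \<and> d = drift U v beta)"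
    for p d
  have "\<exists>S\<in>borel_measurable mu. AE p in g. \<forall>d. R p d \<longrightarrow> d = S (fst p)"
  proof (rule derivative_determined[OF g mu c', where V="\<lambda>t. push (V t)" and
        K="\<lambda>p. (Lc + 1) * (real (load U (fst p)) + enn2real (cost (fst p) (snd p)))"])
    show "(\<integral>\<^sup>+ p. cost (fst p) (snd p) \<partial>g) \<le> (\<integral>\<^sup>+ p. cost (fst p) (snd p) \<partial>g')" if "g' \<in> couplings mu nu" for g'
      using og that unfolding total_cost_def[symmetric] by (simp add: MKP_inf_def INF_lower)
    show "(\<integral>\<^sup>+ p. cost (fst p) (snd p) \<partial>g) < \<infinity>" by fact
    have "push (V t) \<in> measurable (GammaM UNIV) (GammaM UNIV)" for t
      by (rule measurable_push[of "V (- t)"]) (simp_all add: V_uminus continuous_V)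
    then show "push (V t) \<in> measurable mu mu" for t using smu by (simp cong: measurable_cong_sets)
    show "push (V 0) x = x" for x by (simp add: push_inverse[of "V 0" "V 0"] V_0)
    show "push (V s) (push (V t) x) = push (V (s + t)) x" for s t x
    proof -
      have "V s \<circ> V t = V (s + t)" by (auto simp: V_add)
      then show ?thesis using push_compose[of "V (- s)" "V s" "V (- t)" "V t" x] by (simp add: V_uminus)
    qed
    show "quasi_invariant mu (push (V t))" for t by (rule qi)
    show "0 \<le> (Lc + 1) * (real (load U (fst p)) + enn2real (cost (fst p) (snd p)))" for p
      using Lc_nonneg by simp
    fix p d t assume p: "p \<in> space g" and "R p d"
    then obtain beta where b: "realizes beta (fst p) (snd p)" "cost (fst p) (snd p) < \<infinity>" "d = drift U v beta"
      by (auto simp: R_def)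
    show "cost (fst p) (snd p) < \<infinity> \<and>
        cost (fst (push (V t) (fst p), snd p)) (snd (push (V t) (fst p), snd p)) < \<infinity> \<and>
        enn2real (cost (fst (push (V t) (fst p), snd p)) (snd (push (V t) (fst p), snd p)))
        \<le> enn2real (cost (fst p) (snd p)) + t * d + (Lc + 1) * (real (load U (fst p)) + enn2real (cost (fst p) (snd p))) * t\<^sup>2"
      using cost_shift[OF spg[OF p] b(1,2) U, of t] b(2,3) by simp
  qed
  then obtain S where S: "S \<in> borel_measurable mu" "AE p in g. \<forall>d. R p d \<longrightarrow> d = S (fst p)" by blast
  have "AE p in g. cost (fst p) (snd p) \<noteq> \<infinity>"
    using fin' by (intro nn_integral_PInf_AE[OF cg]) auto
  with S(2) have "AE p in g. \<forall>beta. realizes beta (fst p) (snd p) \<longrightarrow> drift U v beta = S (fst p)"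
  proof eventually_elim
    case (elim p)
    then show ?case by (auto simp: R_def less_top)
  qed
  with S(1) show ?thesis by blast
qed

end

lemma bumpf_flow:
  fixes a w :: "'a::euclidean_space"
  assumes "r > 0" "norm w = 1"
  shows "\<exists>V. lipschitz_flow (\<lambda>x. bumpf a r x *\<^sub>R w) V (4 * r)"
proof -
  have lip: "norm (bumpf a r x *\<^sub>R w - bumpf a r y *\<^sub>R w) \<le> 4 * r * norm (x - y)" for x y
    using bumpf_lipschitz[of r a x y] assms by (simp flip: scaleR_diff_left)
  have bdd: "norm (bumpf a r x *\<^sub>R w) \<le> 1" for x
    using bumpf_le_1[of a r x] assms by simp
  obtain V where "is_flow (\<lambda>x. bumpf a r x *\<^sub>R w) V" using flow_exists[OF lip bdd] by blast
  with lip bdd show ?thesis by (intro exI[of _ V]) (simp add: lipschitz_flow_def)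
qed

lemma bump_drift_determined:
  fixes mu nu :: "('a::euclidean_space \<Rightarrow> nat) measure"
  assumes H: "hypH mu" and snu: "sets nu = sets (GammaM UNIV)"
    and c: "(\<lambda>p. cost (fst p) (snd p)) \<in> borel_measurable (GammaM UNIV \<Otimes>\<^sub>M GammaM (UNIV :: 'a set))"
    and fin: "MKP_inf mu nu < \<infinity>" and opt: "optimal g mu nu"
    and "r > 0" "norm w = 1"
  shows "\<exists>S\<in>borel_measurable mu. AE p in g. \<forall>beta. realizes beta (fst p) (snd p) \<longrightarrow>
    drift (ball a r) (\<lambda>x. bumpf a r x *\<^sub>R w) beta = S (fst p)"
proof -
  obtain V where "lipschitz_flow (\<lambda>x. bumpf a r x *\<^sub>R w) V (4 * r)" using bumpf_flow[OF assms(6,7)] by blast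
  then interpret lipschitz_flow "\<lambda>x. bumpf a r x *\<^sub>R w" V "4 * r" .
  show ?thesis
  proof (rule drift_determined[OF _ _ snu _ c fin opt])
    show "prob_space mu" "sets mu = sets (GammaM UNIV)" using H by (simp_all add: hypH_def)
    have "smooth (\<lambda>x. bumpf a r x *\<^sub>R w) \<and> compact_support (\<lambda>x. bumpf a r x *\<^sub>R w) \<and> is_flow (\<lambda>x. bumpf a r x *\<^sub>R w) V"
      using \<open>r > 0\<close> by (intro conjI bumpf_smooth bumpf_compact_support flow) simp
    then show "quasi_invariant mu (push (V t))" for t using H unfolding hypH_def by blast
    show "bumpf a r x *\<^sub>R w = 0" if "x \<notin> ball a r" for x using bumpf_outside[of r x a] that \<open>r > 0\<close> by simp
  qed simp
qed

section \<open>Recovering the matched points from the drifts\<close>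

context ball_basis
begin

text \<open>Solves for the partner. If \<open>pt j eta\<close> is the only point in its ball and is
  matched with \<open>z\<close>, the drift along the bump in direction \<open>b\<close> is
  \<open>bumpf\<close> at the point times the \<open>b\<close>-coordinate of
  \<open>pt j eta - z\<close>, and \<open>bumpf\<close> is positive there.\<close>

definition image_point :: "(nat \<Rightarrow> 'a \<Rightarrow> ('a \<Rightarrow> nat) \<Rightarrow> real) \<Rightarrow> nat \<Rightarrow> ('a \<Rightarrow> nat) \<Rightarrow> 'a" where
  "image_point S j eta = (\<Sum>b\<in>Basis. (pt j eta \<bullet> b - S j b eta / bumpf (ctr j) (rad j) (pt j eta)) *\<^sub>R b)"

text \<open>A cardinality, because several points in \<open>L\<close> may have the same image point,
  which then counts with multiplicity.\<close>

definition image_config :: "(nat \<Rightarrow> 'a \<Rightarrow> ('a \<Rightarrow> nat) \<Rightarrow> real) \<Rightarrow> 'a set \<Rightarrow> ('a \<Rightarrow> nat) \<Rightarrow> 'a \<Rightarrow> nat" where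
  "image_config S L eta y = card {j. act j eta \<and> pt j eta \<in> L \<and> image_point S j eta = y}"

lemma finite_active_in:
  assumes "eta \<in> Gamma UNIV" "bounded L"
  shows "finite {j. act j eta \<and> pt j eta \<in> L}"
proof -
  have "finite {x \<in> L. eta x \<noteq> 0}" by (rule Gamma_finite[OF assms])
  moreover have "(\<lambda>j. pt j eta) ` {j. act j eta \<and> pt j eta \<in> L} \<subseteq> {x \<in> L. eta x \<noteq> 0}"
    using pt_act(2) by blast
  ultimately have "finite ((\<lambda>j. pt j eta) ` {j. act j eta \<and> pt j eta \<in> L})" by (rule finite_subset[rotated])
  moreover have "inj_on (\<lambda>j. pt j eta) {j. act j eta \<and> pt j eta \<in> L}"
    by (rule inj_onI) (auto intro: act_inj)
  ultimately show ?thesis by (rule finite_imageD)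
qed

lemma measurable_bumpf [measurable]: "bumpf a r \<in> borel_measurable borel"
proof (rule borel_measurable_continuous_onI)
  have "continuous_on UNIV (bump 0)" using DERIV_bump by (intro DERIV_continuous_on) blast
  then show "continuous_on UNIV (bumpf a r)"
    unfolding bumpf_def by (rule continuous_on_compose2) (auto intro!: continuous_intros)
qed

text \<open>The count in \<open>B\<close> is a series of indicators over all numbers
  \<open>j\<close>. Boundedness of \<open>L\<close> leaves finitely many nonzero terms, so the
  result is a configuration even for those \<open>eta\<close> where \<open>S\<close> carries no
  information.\<close>

lemma measurable_image_config:
  assumes L: "compact L" and S: "\<And>j b. b \<in> Basis \<Longrightarrow> S j b \<in> borel_measurable (GammaM UNIV)"
  shows "image_config S L \<in> measurable (GammaM UNIV) (GammaM UNIV)"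
proof (rule measurable_GammaM_I)
  have bL: "bounded L" and [measurable]: "L \<in> sets borel"
    using L by (auto intro: compact_imp_bounded borel_compact)
  have supp: "{y. image_config S L eta y \<noteq> 0} \<subseteq> (\<lambda>j. image_point S j eta) ` {j. act j eta \<and> pt j eta \<in> L}" for eta
    by (auto simp: image_config_def card_gt_0_iff)
  have fs: "finite {y. image_config S L eta y \<noteq> 0}" if "eta \<in> Gamma UNIV" for eta
    by (rule finite_subset[OF supp finite_imageI[OF finite_active_in[OF that bL]]])
  show "image_config S L eta \<in> Gamma UNIV" if "eta \<in> space (GammaM UNIV)" for eta
    using fs[of eta] that by (intro Gamma_UNIV_I) (auto elim: finite_subset[rotated])
  fix B :: "'a set" assume [measurable]: "B \<in> sets borel" and "bounded B"
  have [measurable]: "image_point S j \<in> borel_measurable (GammaM UNIV)" for j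
    unfolding image_point_def
    by (intro borel_measurable_sum borel_measurable_scaleR borel_measurable_diff borel_measurable_divide
        borel_measurable_inner measurable_pt borel_measurable_const S measurable_compose[OF measurable_pt measurable_bumpf])
  have eq: "npts (image_config S L eta) B =
      (\<Sum>j. if act j eta \<and> pt j eta \<in> L \<and> image_point S j eta \<in> B then 1 else 0)" if eta: "eta \<in> Gamma UNIV" for eta
  proof -
    let ?S = "{j. act j eta \<and> pt j eta \<in> L \<and> image_point S j eta \<in> B}" and ?T = "{y \<in> B. image_config S L eta y \<noteq> 0}"
    have fJ: "finite {j. act j eta \<and> pt j eta \<in> L}" by (rule finite_active_in[OF eta bL])
    have fS: "finite ?S" by (rule finite_subset[OF _ fJ]) auto
    have fT: "finite ?T" by (rule finite_subset[OF _ fs[OF eta]]) auto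
    have im: "(\<lambda>j. image_point S j eta) ` ?S \<subseteq> ?T"
    proof
      fix y assume "y \<in> (\<lambda>j. image_point S j eta) ` ?S"
      then obtain j where j: "act j eta" "pt j eta \<in> L" "image_point S j eta = y" "y \<in> B" by blast
      have "finite {j. act j eta \<and> pt j eta \<in> L \<and> image_point S j eta = y}" by (rule finite_subset[OF _ fJ]) auto
      then have "image_config S L eta y \<noteq> 0" using j by (auto simp: image_config_def)
      then show "y \<in> ?T" using j by simp
    qed
    have "(\<Sum>y\<in>?T. image_config S L eta y) = (\<Sum>y\<in>?T. \<Sum>j\<in>{j \<in> ?S. image_point S j eta = y}. 1)"
    proof (intro sum.cong refl)
      fix y assume "y \<in> ?T"
      then have "{j. act j eta \<and> pt j eta \<in> L \<and> image_point S j eta = y} = {j \<in> ?S. image_point S j eta = y}" by auto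
      then show "image_config S L eta y = (\<Sum>j\<in>{j \<in> ?S. image_point S j eta = y}. 1)"
        by (simp add: image_config_def)
    qed
    also have "\<dots> = (\<Sum>j\<in>?S. 1)" by (rule sum.group[OF fS fT im])
    finally have card: "(\<Sum>y\<in>?T. image_config S L eta y) = card ?S" by simp
    have "npts (image_config S L eta) B = of_nat (card ?S)"
      unfolding card[symmetric] by (rule npts_eq_sum[OF fT])
    also have "\<dots> = (\<Sum>j\<in>?S. if act j eta \<and> pt j eta \<in> L \<and> image_point S j eta \<in> B then 1 else 0)" by simp
    also have "\<dots> = (\<Sum>j. if act j eta \<and> pt j eta \<in> L \<and> image_point S j eta \<in> B then 1 else 0)"
      by (rule suminf_finite[OF fS, symmetric]) auto
    finally show ?thesis .
  qed
  have "(\<lambda>eta. \<Sum>j. if act j eta \<and> pt j eta \<in> L \<and> image_point S j eta \<in> B then 1 else 0 :: ennreal) \<in> borel_measurable (GammaM UNIV)"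
    by measurable
  then show "(\<lambda>eta. npts (image_config S L eta) B) \<in> borel_measurable (GammaM UNIV)"
    by (subst measurable_cong[OF eq]) simp_all
qed

text \<open>A simple \<open>eta\<close> leaves each row of \<open>beta\<close> over a point of
  \<open>eta\<close> a single entry 1, so \<open>beta\<close> gives that point one partner. An
  active ball contains a single point, hence its drift has one term, which
  \<open>image_point\<close> inverts.\<close>

lemma r2_eq_image_config:
  assumes eta: "eta \<in> Gamma UNIV" and simple: "\<And>x. eta x \<le> 1" and m: "marginals beta eta om"
    and S: "\<And>j b. b \<in> Basis \<Longrightarrow> drift (bl j) (\<lambda>x. bumpf (ctr j) (rad j) x *\<^sub>R b) beta = S j b eta"
  shows "r2 L beta = image_config S L eta"
proof
  fix y
  have one: "beta (x, y) = 1" if "beta (x, y) \<noteq> 0" for x y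
  proof -
    have "beta (x, y) \<le> (\<Sum>y\<in>{y. beta (x, y) \<noteq> 0}. beta (x, y))"
      using that by (intro member_le_sum marginals_row_finite[OF m]) auto
    then show ?thesis using that simple[of x] by (simp add: marginals_row_sum[OF m] del: neq0_conv)
  qed
  have uniq: "\<exists>y. {y. beta (x, y) \<noteq> 0} = {y}" if "eta x \<noteq> 0" for x
  proof -
    have "(\<Sum>y\<in>{y. beta (x, y) \<noteq> 0}. 1) = (\<Sum>y\<in>{y. beta (x, y) \<noteq> 0}. beta (x, y))"
      by (intro sum.cong refl one[symmetric]) simp
    also have "\<dots> = 1" using that simple[of x] by (simp add: marginals_row_sum[OF m] del: neq0_conv)
    finally have "card {y. beta (x, y) \<noteq> 0} = 1" by (simp only: card_eq_sum)
    then show ?thesis by (rule card_1_singletonE) blast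
  qed
  have ip: "image_point S j eta = y \<longleftrightarrow> beta (pt j eta, y) \<noteq> 0" if j: "act j eta" for j y
  proof -
    define x where "x = pt j eta"
    have x: "x \<in> bl j" "eta x \<noteq> 0" unfolding x_def by (rule pt_act[OF j])+
    obtain z where z: "{y. beta (x, y) \<noteq> 0} = {z}" using uniq[OF x(2)] by blast
    have X: "{x \<in> bl j. eta x \<noteq> 0} = {x}"
    proof (intro equalityI subsetI)
      fix x' assume "x' \<in> {x \<in> bl j. eta x \<noteq> 0}"
      then have "pt j eta = x'" by (intro act_unique[OF j]) auto
      then show "x' \<in> {x}" by (simp add: x_def)
    qed (use x in simp)
    have pp: "plan_points (bl j) beta = {(x, z)}"
      unfolding plan_points_Sigma[OF m] X using z by auto
    have "beta (x, z) \<noteq> 0" using z by blast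
    then have "beta (x, z) = 1" by (rule one)
    then have dr: "S j b eta = bumpf (ctr j) (rad j) x * (b \<bullet> (x - z))" if "b \<in> Basis" for b
      using S[OF that, of j] by (simp add: drift_def pp)
    have "bumpf (ctr j) (rad j) x > 0" using x(1) by (intro bumpf_pos) (simp add: bl_def)
    then have "image_point S j eta = (\<Sum>b\<in>Basis. (z \<bullet> b) *\<^sub>R b)"
      unfolding image_point_def x_def[symmetric]
      by (intro sum.cong refl) (simp add: dr inner_diff_right inner_commute)
    then have "image_point S j eta = z" by (simp add: euclidean_representation)
    moreover have "beta (x, y) \<noteq> 0 \<longleftrightarrow> y = z" using z by blast
    ultimately show ?thesis unfolding x_def by auto
  qed
  have "r2 L beta y = card {x. x \<in> L \<and> beta (x, y) \<noteq> 0}"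
    unfolding r2_def card_eq_sum by (intro sum.cong refl one) simp
  also have "\<dots> = card {j. act j eta \<and> pt j eta \<in> L \<and> image_point S j eta = y}"
  proof (rule bij_betw_same_card[symmetric])
    show "bij_betw (\<lambda>j. pt j eta) {j. act j eta \<and> pt j eta \<in> L \<and> image_point S j eta = y} {x. x \<in> L \<and> beta (x, y) \<noteq> 0}"
    proof (rule bij_betw_byWitness[where f'="ix eta"])
      show "\<forall>j\<in>{j. act j eta \<and> pt j eta \<in> L \<and> image_point S j eta = y}. ix eta (pt j eta) = j"
        using ix_pt[OF eta] by blast
      show "\<forall>x\<in>{x. x \<in> L \<and> beta (x, y) \<noteq> 0}. pt (ix eta x) eta = x"
        using ix_act(2)[OF eta] marginals_support(1)[OF m] by blast
      show "(\<lambda>j. pt j eta) ` {j. act j eta \<and> pt j eta \<in> L \<and> image_point S j eta = y} \<subseteq> {x. x \<in> L \<and> beta (x, y) \<noteq> 0}"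
        using ip by blast
      show "ix eta ` {x. x \<in> L \<and> beta (x, y) \<noteq> 0} \<subseteq> {j. act j eta \<and> pt j eta \<in> L \<and> image_point S j eta = y}"
      proof
        fix j assume "j \<in> ix eta ` {x. x \<in> L \<and> beta (x, y) \<noteq> 0}"
        then obtain x where x: "j = ix eta x" "x \<in> L" "beta (x, y) \<noteq> 0" by blast
        have "act j eta" "pt j eta = x" unfolding x(1) by (rule ix_act[OF eta marginals_support(1)[OF m x(3)]])+
        then show "j \<in> {j. act j eta \<and> pt j eta \<in> L \<and> image_point S j eta = y}" using ip x by simp
      qed
    qed
  qed
  finally show "r2 L beta y = image_config S L eta y" by (simp add: image_config_def)
qed

end

text \<open>The restrictions of a configuration to \<open>L\<close> and to its complement add up to
  it again; \<open>T\<close> begins with this addition.\<close>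

lemma measurable_join:
  "(\<lambda>p x. fst p x + snd p x) \<in> measurable (GammaM L \<Otimes>\<^sub>M GammaM (- L)) (GammaM (UNIV :: 'a::euclidean_space set))"
proof (rule measurable_GammaM_I)
  fix p :: "('a \<Rightarrow> nat) \<times> ('a \<Rightarrow> nat)" assume "p \<in> space (GammaM L \<Otimes>\<^sub>M GammaM (- L))"
  then have p: "fst p \<in> Gamma L" "snd p \<in> Gamma (- L)" by (auto simp: space_pair_measure)
  show "(\<lambda>x. fst p x + snd p x) \<in> Gamma UNIV"
  proof (rule Gamma_UNIV_I)
    fix K :: "'a set" assume "compact K"
    then have "finite ({x \<in> K. fst p x \<noteq> 0} \<union> {x \<in> K. snd p x \<noteq> 0})"
      using p by (auto simp: Gamma_def locfin_def)
    then show "finite {x \<in> K. fst p x + snd p x \<noteq> 0}" by (rule finite_subset[rotated]) auto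
  qed
next
  fix B :: "'a set" assume "B \<in> sets borel" "bounded B"
  then have [measurable]: "(\<lambda>eta. npts eta B) \<in> borel_measurable (GammaM L)" "(\<lambda>eta. npts eta B) \<in> borel_measurable (GammaM (- L))"
    by (auto intro: measurable_npts)
  show "(\<lambda>p. npts (\<lambda>x. fst p x + snd p x) B) \<in> borel_measurable (GammaM L \<Otimes>\<^sub>M GammaM (- L))"
    unfolding npts_add by measurable
qed

theorem theorem5p3:
  fixes mu nu :: "(real^'k \<Rightarrow> nat) measure"
    and g :: "((real^'k \<Rightarrow> nat) \<times> (real^'k \<Rightarrow> nat)) measure"
    and L :: "(real^'k) set"
  assumes "hypH mu" and "hypH nu"
    and "emeasure mu {eta \<in> space mu. npts eta UNIV = \<infinity>} = 1"
    and "regular mu"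
    and "MKP_inf mu nu < \<infinity>"
    and "optimal g mu nu"
    and "compact L"
  shows "\<exists>T \<in> GammaM L \<Otimes>\<^sub>M GammaM (- L) \<rightarrow>\<^sub>M GammaM UNIV.
           AE p in g. \<forall>beta. realizes beta (fst p) (snd p) \<longrightarrow>
              r2 L beta = T (proj L (fst p), proj (- L) (fst p))"
proof -
  obtain ctr :: "nat \<Rightarrow> real^'k" and rad where "\<forall>j. rad j > 0"
    "\<forall>x e. e > 0 \<longrightarrow> (\<exists>j. x \<in> ball (ctr j) (rad j) \<and> ball (ctr j) (rad j) \<subseteq> ball x e)"
    using ball_basis_exists by blast
  then interpret ball_basis ctr rad by unfold_locales auto
  have smu: "sets mu = sets (GammaM UNIV)" and snu: "sets nu = sets (GammaM UNIV)"
    and simple: "AE eta in mu. \<forall>x. eta x \<le> 1"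
    using assms(1,2) by (auto simp: hypH_def)
  have g: "g \<in> couplings mu nu" using assms(6) by (simp add: optimal_def)
  define Q where "Q j b S \<longleftrightarrow> S \<in> borel_measurable mu \<and> (AE p in g. \<forall>beta. realizes beta (fst p) (snd p) \<longrightarrow>
      drift (bl j) (\<lambda>x. bumpf (ctr j) (rad j) x *\<^sub>R b) beta = S (fst p))" for j b S
  have ex: "\<exists>S. b \<in> Basis \<longrightarrow> Q j b S" for j b
  proof (cases "b \<in> Basis")
    case True
    then show ?thesis
      using bump_drift_determined[OF assms(1) snu measurable_cost assms(5,6) rad_pos[of j], of b "ctr j"]
      unfolding Q_def bl_def Bex_def by simp
  qed simp
  define S where "S j b = (SOME s. b \<in> Basis \<longrightarrow> Q j b s)" for j b
  have "b \<in> Basis \<longrightarrow> Q j b (S j b)" for j b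
    unfolding S_def by (rule someI_ex[OF ex])
  then have S: "\<And>j b. b \<in> Basis \<Longrightarrow> S j b \<in> borel_measurable mu"
    "\<And>j b. b \<in> Basis \<Longrightarrow> AE p in g. \<forall>beta. realizes beta (fst p) (snd p) \<longrightarrow>
      drift (bl j) (\<lambda>x. bumpf (ctr j) (rad j) x *\<^sub>R b) beta = S j b (fst p)"
    unfolding Q_def by simp_all
  have S': "S j b \<in> borel_measurable (GammaM UNIV)" if "b \<in> Basis" for j b
    using S(1)[OF that] smu by (simp cong: measurable_cong_sets)
  let ?T = "\<lambda>p. image_config S L (\<lambda>x. fst p x + snd p x)"
  have T: "?T \<in> measurable (GammaM L \<Otimes>\<^sub>M GammaM (- L)) (GammaM UNIV)"
    by (rule measurable_compose[OF measurable_join measurable_image_config[OF assms(7) S']])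
  \<comment> \<open>One null set serves the countably many balls and the finitely many basis
    directions.\<close>
  have "AE p in g. \<forall>j. \<forall>b\<in>Basis. \<forall>beta. realizes beta (fst p) (snd p) \<longrightarrow>
      drift (bl j) (\<lambda>x. bumpf (ctr j) (rad j) x *\<^sub>R b) beta = S j b (fst p)"
    unfolding AE_all_countable by (intro allI AE_finite_allI S) auto
  moreover have "AE p in g. \<forall>x. fst p x \<le> 1" by (rule coupling_AE_fst[OF g simple])
  moreover have "AE p in g. p \<in> space g" by (rule AE_space)
  ultimately have "AE p in g. \<forall>beta. realizes beta (fst p) (snd p) \<longrightarrow> r2 L beta = ?T (proj L (fst p), proj (- L) (fst p))"
  proof eventually_elim
    case (elim p)
    have "space g = Gamma UNIV \<times> space nu"
      using sets_eq_imp_space_eq[OF couplings_D(2)[OF g]] sets_eq_imp_space_eq[OF smu]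
      by (simp add: space_pair_measure)
    then have eta: "fst p \<in> Gamma UNIV" using elim(3) by (simp add: mem_Times_iff)
    have join: "(\<lambda>x. fst (proj L (fst p), proj (- L) (fst p)) x + snd (proj L (fst p), proj (- L) (fst p)) x) = fst p"
      by (auto simp: proj_def)
    show ?case
    proof (intro allI impI)
      fix beta assume b: "realizes beta (fst p) (snd p)"
      have "r2 L beta = image_config S L (fst p)"
      proof (rule r2_eq_image_config[OF eta])
        show "marginals beta (fst p) (snd p)" using b by (simp add: realizes_def admissible_def)
        show "fst p x \<le> 1" for x using elim(2) by blast
        show "drift (bl j) (\<lambda>x. bumpf (ctr j) (rad j) x *\<^sub>R b) beta = S j b (fst p)" if "b \<in> Basis" for j b
          using elim(1) b that by blast
      qed
      then show "r2 L beta = ?T (proj L (fst p), proj (- L) (fst p))" unfolding join .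
    qed
  qed
  with T show ?thesis by (intro bexI[of _ ?T])
qed

end
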